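(* Assume the following. (1) There is $L>0$ with $\|\nabla F_k(\mathbf{x})-\nabla F_k(\mathbf{x}')\|\le L\|\mathbf{x}-\mathbf{x}'\|$ for all $\mathbf{x},\mathbf{x}'\in\mathbb{R}^d$ and all devices $k$. (2) For all $\mathbf{x}\in\mathbb{R}^d$ and all $k$, $\mathbb{E}_{\theta_k}[\mathbf{g}_k(\mathbf{x})]=\nabla F_k(\mathbf{x})$ and $\mathbb{E}_{\theta_k}\|\mathbf{g}_k(\mathbf{x})-\nabla F_k(\mathbf{x})\|^2\le\sigma^2$. (3) There is a constant $F_{\inf}$ with $F(\mathbf{x})\ge F_{\inf}$ for all $\mathbf{x}\in\mathbb{R}^d$. (4) The graph $\mathcal{G}=([m],E)$ is connected, and $\mathbf{H}\in[0,1]^{m\times m}$ is symmetric and doubly stochastic, with (for $i\neq j$) $\mathbf{H}_{i,j}>0$ if $(i,j)\in E$ and $\mathbf{H}_{i,j}=0$ otherwise, and with eigenvalues $1=\lambda_1(\mathbf{H})\ge\dots\ge\lambda_m(\mathbf{H})$ satisfying $\zeta:=\max\{|\lambda_2(\mathbf{H})|,|\lambda_m(\mathbf{H})|\}<1$. (5) For each cluster $i\in[m]$ there is $\epsilon_i\ge0$ with $\frac1{n_i}\sum_{k\in\mathcal{S}_i}\|\nabla f_i(\mathbf{x})-\nabla F_k(\mathbf{x})\|^2\le\epsilon_i^2$ for all $\mathbf{x}\in\mathbb{R}^d$. (6) There is $\epsilon\ge0$ with $\sum_{i=1}^m\frac{n_i}{n}\|\nabla f_i(\mathbf{x})-\nabla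 F(\mathbf{x})\|^2\le\epsilon^2$ for all $\mathbf{x}\in\mathbb{R}^d$. Let $\Omega_1=\frac{\zeta^{2\pi}}{1-\zeta^{2\pi}}$ and $\Omega_2=\frac{1}{1-\zeta^{2\pi}}+\frac{2}{1-\zeta^{\pi}}+\frac{\zeta^{\pi}}{(1-\zeta^{\pi})^2}$. If the learning rate satisfies $$\eta\le\min\left\{\frac{1}{2L\tau},\ \frac{1}{2\sqrt{2\Omega_2}\,Lq\tau}\right\},$$ then for any $T>0$ (with $T=pq\tau$) the iterates of CE-FedAvg satisfy $$\frac1T\sum_{t=0}^{T-1}\mathbb{E}\|\nabla F(\mathbf{u}_t)\|^2\le\frac{2(F(\mathbf{x}_1)-F_{\inf})}{\eta T}+\frac{\eta L\sigma^2}{n}+8\eta^2L^2\Big(\Omega_1q\tau+\frac{m-1}{n}q\tau\Big)\sigma^2+16\eta^2L^2q^2\tau^2\Omega_2\epsilon^2+8\,\frac{n-m}{n}\,\eta^2L^2\tau\sigma^2+16L^2\eta^2\tau^2\sum_{i=1}^m\frac{n_i}{n}\epsilon_i^2.$$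
   Context: Setting (CE-FedAvg). There are $n$ devices $k=1,\dots,n$ partitioned into $m$ nonempty clusters $\mathcal{S}_1,\dots,\mathcal{S}_m$ with $n_i=|\mathcal{S}_i|$. Device $k$ has a differentiable objective $F_k:\mathbb{R}^d\to\mathbb{R}$; $f_i=\frac1{n_i}\sum_{k\in\mathcal{S}_i}F_k$ and $F=\frac1n\sum_{k=1}^nF_k=\sum_{i=1}^m\frac{n_i}{n}f_i$. The integers $\tau,q,p,\pi\ge1$ are the intra-cluster aggregation period, the number of edge rounds per global round, the number of global rounds and the number of gossip steps; $T=pq\tau$; $\eta>0$ is the learning rate. $\mathbf{B}\in\{0,1\}^{m\times n}$ has $\mathbf{B}_{i,k}=1$ iff $k\in\mathcal{S}_i$; $\mathbf{c}=[1/n_1,\dots,1/n_m]$; $\mathbf{V}=\mathbf{B}^\intercal\mathrm{diag}(\mathbf{c})\mathbf{B}$; $\mathbf{H}\in[0,1]^{m\times m}$ is the mixing matrix of the edge servers (server $j$'s model gets weight $\mathbf{H}_{j,i}$ at server $i$) and $\mathbf{H}^\pi$ its $\pi$-th power; $\mathbf{Z}=\mathbf{B}^\intercal\mathrm{diag}(\mathbf{c})\mathbf{H}^{\pi}\mathbf{B}$. Standing property: $\mathbf{Z}\mathbf{1}_n=\mathbf{1}_n$, where $\mathbf{1}_n$ is the all-ones vector. Iterates: $\mathbf{X}_t=[\mathbf{x}_t^{(1)},\dots,\mathbf{x}_t^{(n)}]\in\mathbb{R}^{d\times n}$ collects the local models. All devices start from the same (deterministic) model, denoted $\mathbf{x}_1\in\mathbb{R}^d$,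 i.e. every column of $\mathbf{X}_0$ equals $\mathbf{x}_1$. For $t=0,1,\dots,T-1$, $\mathbf{X}_{t+1}=(\mathbf{X}_t-\eta\mathbf{G}_t)\mathbf{W}_t$ with $\mathbf{G}_t=[\mathbf{g}_1(\mathbf{x}_t^{(1)}),\dots,\mathbf{g}_n(\mathbf{x}_t^{(n)})]$, where $\mathbf{W}_t=\mathbf{Z}$ if $(t+1)\bmod q\tau=0$; $\mathbf{W}_t=\mathbf{V}$ if $(t+1)\bmod\tau=0$ and $(t+1)\bmod q\tau\ne0$; $\mathbf{W}_t=\mathbf{I}$ otherwise. Here $\mathbf{g}_k(\mathbf{x})$ is the stochastic gradient of device $k$ at $\mathbf{x}$ computed on a random mini-batch $\theta_k$; fresh mini-batches are drawn independently across devices and iterations. $\mathbf{u}_t=\frac1n\mathbf{X}_t\mathbf{1}_n=\frac1n\sum_k\mathbf{x}_t^{(k)}$. $\|\cdot\|$ is the Euclidean norm and $\mathbb{E}$ is total expectation. By convention $\zeta=0$ when $m=1$. *)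

theory Defs
  imports "HOL-Probability.Probability"
begin

text \<open>Junk value where \<open>f\<close> is not differentiable.\<close>

definition gradient :: "('a::euclidean_space \<Rightarrow> real) \<Rightarrow> 'a \<Rightarrow> 'a" where
  "gradient f x = (THE D. GDERIV f x :> D)"

lemma gradient_eqI:
  assumes "GDERIV f x :> D"
  shows "gradient f x = D"
  unfolding gradient_def
proof (rule the_equality)
  fix D' assume "GDERIV f x :> D'"
  then have "(\<lambda>h. inner h D') = (\<lambda>h. inner h D)"
    using assms unfolding gderiv_def by (rule has_derivative_unique)
  then have "\<forall>h. inner h D' = inner h D" by (simp add: fun_eq_iff)
  then show "D' = D" by (simp only: vector_eq_ldot)
qed (rule assms)

definition diag_matrix :: "real^'n \<Rightarrow> real^'n^'n" where
  "diag_matrix v = (\<chi> i j. if i = j then v $ i else 0)"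

text \<open>The class instance \<open>^\<close> on vectors is componentwise, so powers with respect to
  the matrix product \<open>**\<close> need their own definition.\<close>

primrec matrix_power :: "real^'n^'n \<Rightarrow> nat \<Rightarrow> real^'n^'n" where
  "matrix_power A 0 = mat 1"
| "matrix_power A (Suc l) = matrix_power A l ** A"

text \<open>\<open>eig 1 \<ge> \<dots> \<ge> eig m\<close> are the eigenvalues of the \<open>m \<times> m\<close> matrix \<open>A\<close>, repeated
  according to their multiplicity as roots of the characteristic polynomial. Values of
  \<open>eig\<close> outside \<open>{1..m}\<close> are irrelevant.\<close>

definition ordered_eigenvalues :: "real^'m^'m \<Rightarrow> (nat \<Rightarrow> real) \<Rightarrow> bool" where
  "ordered_eigenvalues A eig \<longleftrightarrow>
     antimono_on {1..CARD('m)} eig \<and>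
     (\<forall>x. det (mat x - A) = (\<Prod>i = 1..CARD('m). x - eig i))"

definition doubly_stochastic :: "real^'m^'m \<Rightarrow> bool" where
  "doubly_stochastic A \<longleftrightarrow>
     (\<forall>i j. 0 \<le> A $ i $ j \<and> A $ i $ j \<le> 1) \<and>
     (\<forall>i. (\<Sum>j\<in>UNIV. A $ i $ j) = 1) \<and> (\<forall>j. (\<Sum>i\<in>UNIV. A $ i $ j) = 1)"

text \<open>Undirected graphs on the vertex set \<open>UNIV\<close>, given by their edge relation.\<close>

definition connected_graph :: "('m \<times> 'm) set \<Rightarrow> bool" where
  "connected_graph E \<longleftrightarrow> sym E \<and> E\<^sup>* = UNIV"

text \<open>Devices are the elements of \<open>'n\<close>, clusters those of \<open>'m\<close>.\<close>

definition is_clustering :: "('m \<Rightarrow> 'n set) \<Rightarrow> bool" where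
  "is_clustering S \<longleftrightarrow> (\<forall>i. S i \<noteq> {}) \<and> disjoint_family S \<and> (\<Union>i. S i) = UNIV"

definition cluster_objective ::
    "('m \<Rightarrow> 'n set) \<Rightarrow> ('n \<Rightarrow> real^'d \<Rightarrow> real) \<Rightarrow> 'm \<Rightarrow> real^'d \<Rightarrow> real" where
  "cluster_objective S F i x = (1 / real (card (S i))) * (\<Sum>k\<in>S i. F k x)"

definition global_objective :: "('n \<Rightarrow> real^'d \<Rightarrow> real) \<Rightarrow> real^'d \<Rightarrow> real" where
  "global_objective F x = (1 / real CARD('n)) * (\<Sum>k\<in>UNIV. F k x)"

definition B_matrix :: "('m \<Rightarrow> 'n set) \<Rightarrow> real^'n^'m" where
  "B_matrix S = (\<chi> i k. if k \<in> S i then 1 else 0)"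

definition c_vector :: "('m \<Rightarrow> 'n set) \<Rightarrow> real^'m" where
  "c_vector S = (\<chi> i. 1 / real (card (S i)))"

definition V_matrix :: "('m::finite \<Rightarrow> 'n set) \<Rightarrow> real^'n^'n" where
  "V_matrix S = transpose (B_matrix S) ** diag_matrix (c_vector S) ** B_matrix S"

definition Z_matrix :: "('m::finite \<Rightarrow> 'n set) \<Rightarrow> real^'m^'m \<Rightarrow> nat \<Rightarrow> real^'n^'n" where
  "Z_matrix S H \<pi> =
     transpose (B_matrix S) ** diag_matrix (c_vector S) ** matrix_power H \<pi> ** B_matrix S"

definition W_matrix ::
    "('m::finite \<Rightarrow> 'n set) \<Rightarrow> real^'m^'m \<Rightarrow> nat \<Rightarrow> nat \<Rightarrow> nat \<Rightarrow> nat \<Rightarrow> real^'n^'n" where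
  "W_matrix S H \<pi> q \<tau> t =
     (if (t + 1) mod (q * \<tau>) = 0 then Z_matrix S H \<pi>
      else if (t + 1) mod \<tau> = 0 then V_matrix S
      else mat 1)"

text \<open>The matrix of the stochastic gradients \<open>g k b (column k X)\<close>, where the mini-batch
  of device \<open>k\<close> is \<open>b = \<xi> k\<close>.\<close>

definition G_matrix ::
    "('n \<Rightarrow> 'b \<Rightarrow> real^'d \<Rightarrow> real^'d) \<Rightarrow> ('n \<Rightarrow> 'b) \<Rightarrow> real^'n^'d \<Rightarrow> real^'n^'d" where
  "G_matrix g \<xi> X = (\<chi> r k. g k (\<xi> k) (column k X) $ r)"

text \<open>The iterates along a fixed realisation of all mini-batches; \<open>\<xi> t k\<close> is the
  mini-batch of device \<open>k\<close> in iteration \<open>t\<close>.\<close>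

primrec ce_fedavg ::
    "('m::finite \<Rightarrow> 'n set) \<Rightarrow> real^'m^'m \<Rightarrow> nat \<Rightarrow> nat \<Rightarrow> nat \<Rightarrow> real \<Rightarrow>
     ('n \<Rightarrow> 'b \<Rightarrow> real^'d \<Rightarrow> real^'d) \<Rightarrow> real^'d \<Rightarrow> (nat \<Rightarrow> 'n \<Rightarrow> 'b) \<Rightarrow> nat \<Rightarrow> real^'n^'d" where
  "ce_fedavg S H \<pi> q \<tau> \<eta> g x1 \<xi> 0 = (\<chi> r k. x1 $ r)"
| "ce_fedavg S H \<pi> q \<tau> \<eta> g x1 \<xi> (Suc t) =
     (ce_fedavg S H \<pi> q \<tau> \<eta> g x1 \<xi> t
        - \<eta> *\<^sub>R G_matrix g (\<xi> t) (ce_fedavg S H \<pi> q \<tau> \<eta> g x1 \<xi> t))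
      ** W_matrix S H \<pi> q \<tau> t"

text \<open>The numeral \<open>1\<close> on vectors is the all-ones vector.\<close>

definition average_model :: "real^'n^'d \<Rightarrow> real^'d" where
  "average_model X = (1 / real CARD('n)) *\<^sub>R (X *v 1)"

end

theory Submission
  imports Defs
begin

text \<open>By \<open>L\<close>-smoothness the averaged model performs inexact gradient descent, and the error is
  the mean squared deviation \<open>\<parallel>X(I - J)\<parallel>\<^sup>2\<close> of the local models from their average, where
  \<open>J = 11\<^sup>T/n\<close>. Since \<open>I - J = (I - V) + (V - J)\<close> is an orthogonal decomposition, this
  deviation is the sum of a part within the clusters, which every aggregation erases, and
  a part between the clusters, which every gossip round contracts by \<open>\<zeta>\<^sup>\<pi>\<close>. Unrolling
  both recursions, the sampling noises are pairwise orthogonal in \<open>L\<^sup>2\<close>, while the gradients are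
  controlled by the divergence assumptions and, through smoothness, by the deviations
  themselves; the bound on \<open>\<eta>\<close> allows the latter to be absorbed.\<close>

section \<open>The mixing matrix\<close>

text \<open>The unrolled sums are measured in two ways. Noise is summed in mean square with
  Frobenius norms, so trace(I - V) = n - m and trace(V - J) = m - 1 appear, and the weights z =
  \<zeta>^\<pi> enter squared. Gradients at different times are dependent; they go through a
  weighted Cauchy-Schwarz inequality whose doubly summed weights are bounded uniformly in T by
  \<open>block_kernel\<close>, and this by a multiple of \<open>\<Omega>\<^sub>2\<close>. The two
  deviations are not treated alike. Gradients projected by I - V are compared with those at the
  cluster averages, so the estimate within clusters closes on itself and only asks for \<eta> L
  \<tau> <= 1/2. Gradients projected by V - J are compared with those at the global average, where
  the full deviation enters; this estimate is absorbed second, by the condition on \<eta> that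
  involves \<open>\<Omega>\<^sub>2\<close>. One obstacle is that Z has to commute with V and J,
  which rests on its symmetry, while its entries are weighted by the cluster size of the row only.
  The property Z 1 = 1 removes the obstacle: it forces all clusters to have the same size.\<close>

text \<open>Diagonalisation is avoided: on an invariant subspace the operator norm of a symmetric
  map is attained by compactness of the unit sphere, and the attained value is, up to sign, an
  eigenvalue with an eigenvector in \<open>W\<close>. Hence a bound on the eigenvalues inside
  \<open>W\<close> suffices.\<close>

lemma symmetric_contraction_on_subspace:
  fixes A :: "real^'m^'m"
  assumes sym: "transpose A = A"
    and W: "subspace W"
    and inv: "\<And>v. v \<in> W \<Longrightarrow> A *v v \<in> W"
    and c: "0 \<le> c"
    and eig: "\<And>\<mu> v. v \<in> W \<Longrightarrow> v \<noteq> 0 \<Longrightarrow> A *v v = \<mu> *\<^sub>R v \<Longrightarrow> \<bar>\<mu>\<bar> \<le> c"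
    and v: "v \<in> W"
  shows "norm (A *v v) \<le> c * norm v"
proof (cases "v = 0")
  case False
  have self_adj: "(A *v x) \<bullet> y = x \<bullet> (A *v y)" for x y
    by (metis dot_lmul_matrix sym transpose_matrix_vector)
  let ?K = "W \<inter> sphere 0 1"
  have "compact ?K" using closed_subspace[OF W] by (simp add: closed_Int_compact)
  moreover have "(1 / norm v) *\<^sub>R v \<in> ?K"
    using v False W by (auto simp: subspace_scale)
  then have "?K \<noteq> {}" by blast
  moreover have "continuous_on ?K (\<lambda>x. norm (A *v x))"
    by (intro continuous_intros matrix_vector_mult_linear_continuous_on)
  ultimately obtain w where w: "w \<in> ?K" and max: "\<And>x. x \<in> ?K \<Longrightarrow> norm (A *v x) \<le> norm (A *v w)"
    using continuous_attains_sup[of ?K "\<lambda>x. norm (A *v x)"] by blast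
  define N where "N = norm (A *v w)"
  have bound: "norm (A *v x) \<le> N * norm x" if "x \<in> W" for x
  proof (cases "x = 0")
    case False
    have "(1 / norm x) *\<^sub>R x \<in> ?K" using that False W by (auto simp: subspace_scale)
    from max[OF this] False show ?thesis
      by (simp add: N_def matrix_vector_mult_scaleR field_simps)
  qed simp
  have w1: "w \<in> W" "norm w = 1" "w \<noteq> 0" using w by auto
  txt \<open>Maximality of \<open>N\<close> forces equality in Cauchy--Schwarz, so \<open>A\<^sup>2 w = N\<^sup>2 w\<close>: either
    \<open>(A + N) w\<close> is an eigenvector for \<open>N\<close>, or it vanishes and \<open>w\<close> is one for \<open>- N\<close>.\<close>
  let ?d = "A *v (A *v w) - N\<^sup>2 *\<^sub>R w"
  have "(norm ?d)\<^sup>2 = (norm (A *v (A *v w)))\<^sup>2 - 2 * N\<^sup>2 * ((A *v (A *v w)) \<bullet> w) + N^4 * (norm w)\<^sup>2"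
    unfolding power2_norm_eq_inner
    by (simp add: inner_diff inner_commute power2_eq_square[of N] power4_eq_xxxx algebra_simps)
  also have "(A *v (A *v w)) \<bullet> w = N\<^sup>2"
    by (simp add: self_adj N_def power2_norm_eq_inner)
  also have "(norm (A *v (A *v w)))\<^sup>2 \<le> (N * N)\<^sup>2"
    using bound[OF inv[OF w1(1)]] by (intro power_mono) (auto simp: N_def)
  finally have "(norm ?d)\<^sup>2 \<le> 0"
    using w1(2) by (simp add: power2_eq_square power4_eq_xxxx)
  then have sq: "A *v (A *v w) = N\<^sup>2 *\<^sub>R w" by simp
  have "N \<le> c"
  proof (cases "A *v w + N *\<^sub>R w = 0")
    case True
    then have "A *v w = (- N) *\<^sub>R w" by (simp add: eq_neg_iff_add_eq_0)
    from eig[OF w1(1,3) this] show ?thesis by simp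
  next
    case nz: False
    have "A *v (A *v w + N *\<^sub>R w) = N *\<^sub>R (A *v w + N *\<^sub>R w)"
      using sq by (simp add: matrix_vector_right_distrib matrix_vector_mult_scaleR
          scaleR_add_right power2_eq_square)
    moreover have "A *v w + N *\<^sub>R w \<in> W"
      using W w1(1) inv by (auto intro: subspace_add subspace_scale)
    ultimately have "\<bar>N\<bar> \<le> c" using eig nz by blast
    then show ?thesis by simp
  qed
  then show ?thesis using bound[OF v] by (meson mult_right_mono norm_ge_zero order_trans)
qed simp

lemma eigenvalue_imp_det_eq_0:
  fixes A :: "real^'m^'m"
  assumes "A *v v = \<mu> *\<^sub>R v" "v \<noteq> 0"
  shows "det (mat \<mu> - A) = 0"
proof -
  have "mat \<mu> *v v = \<mu> *\<^sub>R v"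
    by (simp add: vec_eq_iff matrix_vector_mult_def mat_def if_distrib[of "\<lambda>x. x * _"] cong: if_cong)
  then have "(mat \<mu> - A) *v v = 0"
    using assms(1) by (simp add: matrix_vector_mult_diff_rdistrib)
  then have "\<not> invertible (mat \<mu> - A)"
    using assms(2) by (metis invertible_def matrix_left_invertible_ker)
  then show ?thesis using invertible_det_nz by blast
qed

text \<open>Since rows and columns sum to 1, the Dirichlet form, the sum of H_ab (v_a - v_b)^2 over
  all a and b, equals 2 (|v|^2 - v . H v). It vanishes for a fixed vector, and then so does each of
  its nonnegative terms.\<close>

lemma fixed_point_const_on_edge:
  fixes H :: "real^'m^'m"
  assumes sym: "transpose H = H"
    and stoch: "doubly_stochastic H"
    and fixed: "H *v v = v"
    and pos: "0 < H $ i $ j"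
  shows "v $ i = v $ j"
proof -
  have nn: "0 \<le> H $ a $ b" for a b using stoch by (simp add: doubly_stochastic_def)
  have rows: "(\<Sum>b\<in>UNIV. H $ a $ b) = 1" and cols: "(\<Sum>a\<in>UNIV. H $ a $ b) = 1" for a b
    using stoch by (simp_all add: doubly_stochastic_def)
  have fx: "(\<Sum>b\<in>UNIV. H $ a $ b * v $ b) = v $ a" for a
    using fixed by (simp add: vec_eq_iff matrix_vector_mult_def)
  have "(\<Sum>a\<in>UNIV. \<Sum>b\<in>UNIV. H $ a $ b * (v $ a - v $ b)\<^sup>2)
      = (\<Sum>a\<in>UNIV. \<Sum>b\<in>UNIV. H $ a $ b * (v $ a)\<^sup>2)
        - 2 * (\<Sum>a\<in>UNIV. \<Sum>b\<in>UNIV. v $ a * (H $ a $ b * v $ b))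
        + (\<Sum>a\<in>UNIV. \<Sum>b\<in>UNIV. H $ a $ b * (v $ b)\<^sup>2)"
    by (simp add: sum_distrib_left sum.distrib[symmetric] sum_subtractf[symmetric]
        power2_eq_square algebra_simps)
  also have "(\<Sum>a\<in>UNIV. \<Sum>b\<in>UNIV. H $ a $ b * (v $ a)\<^sup>2) = (\<Sum>a\<in>UNIV. (v $ a)\<^sup>2)"
    by (simp add: sum_distrib_right[symmetric] rows)
  also have "(\<Sum>a\<in>UNIV. \<Sum>b\<in>UNIV. v $ a * (H $ a $ b * v $ b)) = (\<Sum>a\<in>UNIV. (v $ a)\<^sup>2)"
    by (simp add: sum_distrib_left[symmetric] fx power2_eq_square)
  also have "(\<Sum>a\<in>UNIV. \<Sum>b\<in>UNIV. H $ a $ b * (v $ b)\<^sup>2) = (\<Sum>a\<in>UNIV. (v $ a)\<^sup>2)"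
    by (subst sum.swap) (simp add: sum_distrib_right[symmetric] cols)
  finally have "(\<Sum>a\<in>UNIV. \<Sum>b\<in>UNIV. H $ a $ b * (v $ a - v $ b)\<^sup>2) = 0" by simp
  then have "H $ i $ j * (v $ i - v $ j)\<^sup>2 = 0"
    by (simp add: sum_nonneg_eq_0_iff sum_nonneg nn)
  then show ?thesis using pos by simp
qed

lemma doubly_stochastic_fixed_const:
  fixes H :: "real^'m^'m"
  assumes graph: "connected_graph E"
    and sym: "transpose H = H"
    and stoch: "doubly_stochastic H"
    and edge: "\<And>i j. i \<noteq> j \<Longrightarrow> (i, j) \<in> E \<Longrightarrow> H $ i $ j > 0"
    and fixed: "H *v v = v"
  shows "v $ i = v $ j"
proof -
  have "(i, j) \<in> E\<^sup>*" using graph by (auto simp: connected_graph_def)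
  then show ?thesis
  proof induction
    case (step y z)
    \<comment> \<open>A loop \<open>y = z\<close> is trivial; otherwise \<open>edge\<close> makes
      \<open>H $ y $ z\<close> positive.\<close>
    then show ?case using fixed_point_const_on_edge[OF sym stoch fixed] edge by metis
  qed simp
qed

text \<open>The zero-sum vectors are invariant because columns of \<open>H\<close> sum to 1, and a
  fixed vector among them is constant, hence 0. So only the eigenvalues other than 1 act there. For
  m = 1 the only zero-sum vector is 0, in accordance with \<zeta> = 0.\<close>

lemma mixing_contraction:
  fixes H :: "real^'m^'m"
  assumes graph: "connected_graph E"
    and sym: "transpose H = H"
    and stoch: "doubly_stochastic H"
    and edge: "\<And>i j. i \<noteq> j \<Longrightarrow> (i, j) \<in> E \<Longrightarrow> H $ i $ j > 0"
    and ev: "ordered_eigenvalues H eig" "eig 1 = 1"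
    and zeta: "\<zeta> = (if CARD('m) = 1 then 0 else max \<bar>eig 2\<bar> \<bar>eig CARD('m)\<bar>)"
    and v: "(\<Sum>i\<in>UNIV. v $ i) = 0"
  shows "(\<Sum>i\<in>UNIV. (H *v v) $ i) = 0" and "norm (H *v v) \<le> \<zeta> * norm v"
proof -
  let ?W = "{v::real^'m. (\<Sum>i\<in>UNIV. v $ i) = 0}"
  have W: "subspace ?W"
    by (auto simp: subspace_def sum.distrib sum_distrib_left[symmetric])
  have cols: "(\<Sum>a\<in>UNIV. H $ a $ b) = 1" for b
    using stoch by (simp add: doubly_stochastic_def)
  have sum_H: "(\<Sum>i\<in>UNIV. (H *v w) $ i) = (\<Sum>i\<in>UNIV. w $ i)" for w
    unfolding matrix_vector_mult_def vec_lambda_beta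
    by (subst sum.swap) (simp add: sum_distrib_right[symmetric] cols)
  show "(\<Sum>i\<in>UNIV. (H *v v) $ i) = 0" using sum_H v by simp
  show "norm (H *v v) \<le> \<zeta> * norm v"
  proof (rule symmetric_contraction_on_subspace[OF sym W])
    show "0 \<le> \<zeta>" by (auto simp: zeta)
    show "v \<in> ?W" using v by simp
    show "H *v w \<in> ?W" if "w \<in> ?W" for w using that sum_H by simp
  next
    fix \<mu> w assume w: "w \<in> ?W" "w \<noteq> 0" and e: "H *v w = \<mu> *\<^sub>R w"
    txt \<open>Connectivity excludes \<open>\<mu> = 1\<close>, so \<open>\<mu>\<close> is one of \<open>eig 2, \<dots>, eig m\<close>
      without any argument about multiplicities.\<close>
    have ne1: "\<mu> \<noteq> 1"
    proof
      assume "\<mu> = 1"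
      then have Hw: "H *v w = w" using e by simp
      have const: "w $ i = w $ j" for i j
        using doubly_stochastic_fixed_const[OF graph sym stoch _ Hw] edge by blast
      have "w $ i = 0" for i
      proof -
        have "(\<Sum>j\<in>UNIV. w $ j) = real CARD('m) * w $ i"
          using const by (simp add: sum.cong[of UNIV UNIV "\<lambda>j. w $ j" "\<lambda>j. w $ i"])
        with w show ?thesis by simp
      qed
      with w(2) show False by (simp add: vec_eq_iff)
    qed
    have "(\<Prod>i = 1..CARD('m). \<mu> - eig i) = 0"
      using eigenvalue_imp_det_eq_0[OF e w(2)] ev(1) by (simp add: ordered_eigenvalues_def)
    then obtain i where i: "i \<in> {1..CARD('m)}" "\<mu> = eig i" by auto
    with ne1 ev(2) have "i \<noteq> 1" by auto
    with i have i2: "2 \<le> i" "i \<le> CARD('m)" by auto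
    have anti: "antimono_on {1..CARD('m)} eig" using ev(1) by (simp add: ordered_eigenvalues_def)
    \<comment> \<open>The eigenvalue lies between \<open>eig CARD('m)\<close> and
      \<open>eig 2\<close>, so its modulus is at most the larger of the two moduli;
      \<open>2 \<le> i\<close> also rules out the case m = 1 in \<open>zeta\<close>.\<close>
    have "eig i \<le> eig 2" "eig CARD('m) \<le> eig i"
      using anti i2 by (auto simp: monotone_on_def)
    then show "\<bar>\<mu>\<bar> \<le> \<zeta>" using i i2 zeta by auto
  qed
qed

lemma matrix_power_contraction:
  fixes H :: "real^'m^'m"
  assumes inv: "\<And>v. (\<Sum>i\<in>UNIV. v $ i) = 0 \<Longrightarrow> (\<Sum>i\<in>UNIV. (H *v v) $ i) = 0"
    and bound: "\<And>v. (\<Sum>i\<in>UNIV. v $ i) = 0 \<Longrightarrow> norm (H *v v) \<le> c * norm v"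
    and c: "0 \<le> c"
    and v: "(\<Sum>i\<in>UNIV. v $ i) = 0"
  shows "norm (matrix_power H l *v v) \<le> c ^ l * norm v"
  using v
proof (induction l arbitrary: v)
  case (Suc l)
  have "norm (matrix_power H (Suc l) *v v) = norm (matrix_power H l *v (H *v v))"
    by (simp add: matrix_vector_mul_assoc)
  also have "\<dots> \<le> c ^ l * norm (H *v v)"
    by (rule Suc.IH) (rule inv[OF Suc.prems])
  also have "\<dots> \<le> c ^ l * (c * norm v)"
    using c bound[OF Suc.prems] by (intro mult_left_mono) auto
  finally show ?case by (simp add: ac_simps)
qed simp

lemma transpose_matrix_power:
  fixes H :: "real^'m^'m"
  assumes "transpose H = H"
  shows "transpose (matrix_power H l) = matrix_power H l"
proof -
  have comm: "H ** matrix_power H l = matrix_power H l ** H" for l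
    by (induction l) (simp_all add: matrix_mul_assoc)
  show ?thesis
    by (induction l) (simp_all add: matrix_transpose_mul assms comm transpose_mat)
qed

lemma matrix_power_fixes_one:
  fixes H :: "real^'m^'m"
  assumes "H *v 1 = 1"
  shows "matrix_power H l *v 1 = 1"
  by (induction l) (simp_all add: matrix_vector_mul_assoc[symmetric] assms)

section \<open>Projections and the Frobenius norm\<close>

text \<open>The norm of the type \<^typ>\<open>real^'n^'d\<close> is the Frobenius norm.\<close>

lemma norm_matrix_rows: "(norm X)\<^sup>2 = (\<Sum>r\<in>UNIV. (norm (X $ r))\<^sup>2)" for X :: "real^'n^'d"
  by (simp add: norm_vec_def L2_set_def sum_nonneg)

lemma norm_vec_sq: "(norm x)\<^sup>2 = (\<Sum>i\<in>UNIV. (x $ i)\<^sup>2)" for x :: "real^'n"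
  by (simp add: norm_vec_def L2_set_def sum_nonneg)

lemma norm_matrix_columns: "(norm X)\<^sup>2 = (\<Sum>k\<in>UNIV. (norm (column k X))\<^sup>2)" for X :: "real^'n^'d"
  by (simp add: norm_matrix_rows norm_vec_sq column_def) (rule sum.swap)

lemma row_matrix_mult: "(X ** A) $ r = (X $ r) v* A" for X :: "real^'n^'d"
  by (simp add: matrix_matrix_mult_def vector_matrix_mult_def vec_eq_iff mult.commute)

lemma column_matrix_mult: "column j (X ** A) = (\<Sum>k\<in>UNIV. A $ k $ j *\<^sub>R column k X)"
  for X :: "real^'n^'d"
  by (simp add: matrix_matrix_mult_def column_def vec_eq_iff mult.commute)

text \<open>Right multiplication acts on each row separately and the squared Frobenius norm is a sum
  over rows, so inequalities for row vectors lift to matrices.\<close>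

lemma norm_matrix_mult_le:
  fixes X :: "real^'n^'d" and A B :: "real^'n^'n"
  assumes "\<And>x. norm (x v* A) \<le> c * norm (x v* B)"
    and "0 \<le> c"
  shows "norm (X ** A) \<le> c * norm (X ** B)"
proof (rule power2_le_imp_le)
  have "(norm (X ** A))\<^sup>2 \<le> (\<Sum>r\<in>UNIV. (c * norm (X $ r v* B))\<^sup>2)"
    unfolding norm_matrix_rows row_matrix_mult by (intro sum_mono power_mono assms norm_ge_zero)
  then show "(norm (X ** A))\<^sup>2 \<le> (c * norm (X ** B))\<^sup>2"
    by (simp add: norm_matrix_rows[of "X ** B"] row_matrix_mult power_mult_distrib sum_distrib_left)
qed (use assms in auto)

lemma matrix_diff_rdistrib: "(X - Y) ** A = X ** A - Y ** A" for X Y :: "real^'n^'d"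
  by (simp add: matrix_matrix_mult_def vec_eq_iff left_diff_distrib sum_subtractf)

lemma matrix_diff_ldistrib: "X ** (A - B) = X ** A - X ** B" for X :: "real^'n^'d"
  by (simp add: matrix_matrix_mult_def vec_eq_iff right_diff_distrib sum_subtractf)

lemma matrix_scaleR_left: "(c *\<^sub>R X) ** A = c *\<^sub>R (X ** A)" for X :: "real^'n^'d"
  by (simp add: matrix_matrix_mult_def vec_eq_iff sum_distrib_left mult.assoc)

lemma matrix_add_rdistrib: "(X + Y) ** A = X ** A + Y ** A" for X Y :: "real^'n^'d"
  by (simp add: matrix_matrix_mult_def vec_eq_iff distrib_right sum.distrib)

lemma bounded_linear_matrix_mult_left: "bounded_linear (\<lambda>X::real^'n^'d. X ** A)"
  by (rule linear_conv_bounded_linear[THEN iffD1])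
    (auto simp: linear_iff matrix_add_rdistrib matrix_scaleR_left)

lemma matrix_sum_rdistrib: "(\<Sum>s\<in>I. X s) ** A = (\<Sum>s\<in>I. X s ** A)" for X :: "'s \<Rightarrow> real^'n^'d"
  using bounded_linear.linear[OF bounded_linear_matrix_mult_left] by (rule linear_sum)

definition orthogonal_projection :: "real^'n^'n \<Rightarrow> bool" where
  "orthogonal_projection P \<longleftrightarrow> P ** P = P \<and> transpose P = P"

lemma orthogonal_projection_norm_row:
  assumes "orthogonal_projection P"
  shows "(norm (x v* P))\<^sup>2 = x \<bullet> (x v* P)"
proof -
  have "(x v* P) \<bullet> (x v* P) = x \<bullet> (P *v (x v* P))" by (rule dot_lmul_matrix)
  also have "P *v (x v* P) = (x v* P) v* P"
    using assms by (metis orthogonal_projection_def transpose_matrix_vector)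
  also have "\<dots> = x v* P"
    using assms by (simp add: vector_matrix_mul_assoc orthogonal_projection_def)
  finally show ?thesis by (simp add: power2_norm_eq_inner)
qed

lemma orthogonal_projection_norm_le:
  fixes X :: "real^'n^'d"
  assumes "orthogonal_projection P"
  shows "norm (X ** P) \<le> norm X"
proof -
  have "norm (x v* P) \<le> norm x" for x
  proof (cases "x v* P = 0")
    case False
    have "norm (x v* P) * norm (x v* P) \<le> norm x * norm (x v* P)"
      using orthogonal_projection_norm_row[OF assms, of x] Cauchy_Schwarz_ineq2[of x "x v* P"]
      by (simp add: power2_eq_square)
    then show ?thesis using False by simp
  qed simp
  then show ?thesis using norm_matrix_mult_le[of P 1 "mat 1" X] by simp
qed

text \<open>The trace of a projection is its rank. This is how the factors n - m and m - 1 of the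
  noise terms arise.\<close>

lemma orthogonal_projection_norm:
  fixes P :: "real^'n^'n"
  assumes "orthogonal_projection P"
  shows "(norm P)\<^sup>2 = trace P"
proof -
  have "(norm P)\<^sup>2 = (\<Sum>r\<in>UNIV. \<Sum>k\<in>UNIV. P $ r $ k * transpose P $ k $ r)"
    unfolding norm_matrix_rows norm_vec_sq by (simp add: power2_eq_square transpose_def)
  also have "\<dots> = trace (P ** transpose P)"
    by (simp add: trace_def matrix_matrix_mult_def)
  finally show ?thesis using assms by (simp add: orthogonal_projection_def)
qed

text \<open>For a projection the squared norm of \<open>x v* P\<close> is
  \<open>x \<bullet> (x v* P)\<close>, which is linear in \<open>P\<close>. Asking that
  \<open>P + Q\<close> be a projection encodes the orthogonality of the two ranges.\<close>

lemma orthogonal_projection_pythagoras: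
  fixes X :: "real^'n^'d"
  assumes "orthogonal_projection P" "orthogonal_projection Q" "orthogonal_projection (P + Q)"
  shows "(norm (X ** (P + Q)))\<^sup>2 = (norm (X ** P))\<^sup>2 + (norm (X ** Q))\<^sup>2"
proof -
  have "x v* (P + Q) = x v* P + x v* Q" for x :: "real^'n"
    by (simp add: vector_matrix_mult_def vec_eq_iff distrib_right distrib_left sum.distrib)
  then have "(norm (x v* (P + Q)))\<^sup>2 = (norm (x v* P))\<^sup>2 + (norm (x v* Q))\<^sup>2" for x :: "real^'n"
    unfolding orthogonal_projection_norm_row[OF assms(1)] orthogonal_projection_norm_row[OF assms(2)]
      orthogonal_projection_norm_row[OF assms(3)] by (simp add: inner_right_distrib)
  then show ?thesis
    by (simp add: norm_matrix_rows row_matrix_mult sum.distrib)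
qed

definition J_matrix :: "real^'n^'n" where
  "J_matrix = (\<chi> k l. 1 / real CARD('n))"

lemma orthogonal_projection_diff:
  assumes "orthogonal_projection P" "orthogonal_projection Q" "P ** Q = Q" "Q ** P = Q"
  shows "orthogonal_projection (P - Q)"
proof -
  have "transpose (P - Q) = transpose P - transpose Q"
    by (simp add: transpose_def vec_eq_iff)
  then show ?thesis
    using assms by (simp add: orthogonal_projection_def matrix_diff_ldistrib matrix_diff_rdistrib)
qed

lemma orthogonal_projection_mat_1: "orthogonal_projection (mat 1)"
  by (simp add: orthogonal_projection_def transpose_mat)

lemma orthogonal_projection_J: "orthogonal_projection J_matrix"
  by (simp add: orthogonal_projection_def J_matrix_def matrix_matrix_mult_def transpose_def vec_eq_iff)

lemma mult_J_matrix:
  assumes "A *v 1 = 1"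
  shows "A ** J_matrix = J_matrix"
  using assms by (simp add: J_matrix_def matrix_matrix_mult_def matrix_vector_mult_def vec_eq_iff
      sum_divide_distrib[symmetric])

lemma J_matrix_mult:
  assumes "A *v 1 = 1" "transpose A = A"
  shows "J_matrix ** A = J_matrix"
  using mult_J_matrix[OF assms(1)] orthogonal_projection_J assms(2)
  by (metis matrix_transpose_mul orthogonal_projection_def)

section \<open>Clusterings\<close>

locale clustering =
  fixes S :: "'m::finite \<Rightarrow> 'n::finite set"
  assumes is_clustering: "is_clustering S"
begin

text \<open>The labelling map replaces the family of sets: entries of V and Z become functions of
  labels, and sums over clusters become sums over fibres.\<close>

definition cluster_of :: "'n \<Rightarrow> 'm" where
  "cluster_of k = (THE i. k \<in> S i)"

lemma in_cluster_iff: "k \<in> S i \<longleftrightarrow> cluster_of k = i"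
proof -
  have "\<exists>!i. k \<in> S i"
    using is_clustering by (auto simp: is_clustering_def disjoint_family_on_def)
  then show ?thesis using theI'[of "\<lambda>i. k \<in> S i"] unfolding cluster_of_def by blast
qed

lemma cluster_eq: "S i = {k. cluster_of k = i}"
  using in_cluster_iff by auto

lemma card_cluster_pos: "0 < card (S i)"
  using is_clustering by (simp add: is_clustering_def card_gt_0_iff)

lemma cluster_nonempty [simp]: "S i \<noteq> {}"
  using is_clustering by (simp add: is_clustering_def)

lemma sum_clusters: "(\<Sum>i\<in>UNIV. \<Sum>k\<in>S i. f i k) = (\<Sum>k\<in>UNIV. f (cluster_of k) k)"
  for f :: "'m \<Rightarrow> 'n \<Rightarrow> 'c::comm_monoid_add"
proof -
  have "(\<Sum>k\<in>UNIV. f (cluster_of k) k) = (\<Sum>i\<in>UNIV. \<Sum>k\<in>{k\<in>UNIV. cluster_of k = i}. f (cluster_of k) k)"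
    by (rule sum.group[symmetric]) auto
  also have "\<dots> = (\<Sum>i\<in>UNIV. \<Sum>k\<in>S i. f i k)"
    by (auto intro!: sum.cong simp: cluster_eq)
  finally show ?thesis by simp
qed

lemma sum_cluster_of: "(\<Sum>k\<in>UNIV. f (cluster_of k)) = (\<Sum>i\<in>UNIV. real (card (S i)) * f i)"
  for f :: "'m \<Rightarrow> real"
  using sum_clusters[of "\<lambda>i k. f i"] by simp

lemma sum_in_cluster: "(\<Sum>l\<in>UNIV. if cluster_of l = i then f l else 0) = sum f (S i)"
  for f :: "'n \<Rightarrow> 'c::comm_monoid_add"
  by (simp add: cluster_eq sum.If_cases)

lemma B_matrix_nth: "B_matrix S $ i $ k = (if cluster_of k = i then 1 else 0)"
  by (simp add: B_matrix_def in_cluster_iff)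

lemma transpose_B_diag_nth:
  "(transpose (B_matrix S) ** diag_matrix (c_vector S)) $ k $ i =
     (if cluster_of k = i then 1 / real (card (S i)) else 0)"
proof -
  have "(transpose (B_matrix S) ** diag_matrix (c_vector S)) $ k $ i =
    (\<Sum>j\<in>UNIV. if j = i then (if cluster_of k = i then 1 / real (card (S i)) else 0) else 0)"
    unfolding matrix_matrix_mult_def vec_lambda_beta
    by (rule sum.cong) (auto simp: transpose_def B_matrix_nth diag_matrix_def c_vector_def)
  then show ?thesis by simp
qed

lemma V_matrix_nth:
  "V_matrix S $ k $ l = (if cluster_of k = cluster_of l then 1 / real (card (S (cluster_of k))) else 0)"
proof -
  have "V_matrix S $ k $ l = (\<Sum>i\<in>UNIV. if cluster_of k = i
      then (if cluster_of l = i then 1 / real (card (S i)) else 0) else 0)"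
    unfolding V_matrix_def matrix_matrix_mult_def[of _ "B_matrix S"] vec_lambda_beta transpose_B_diag_nth
    by (rule sum.cong) (auto simp: B_matrix_nth)
  then show ?thesis by simp
qed

text \<open>Only the size of the cluster of the row index occurs, so the symmetry of
  \<open>H\<close> passes to Z once all clusters are known to have the same size.\<close>

lemma Z_matrix_nth:
  "Z_matrix S H \<pi> $ k $ l =
     matrix_power H \<pi> $ cluster_of k $ cluster_of l / real (card (S (cluster_of k)))"
proof -
  let ?A = "transpose (B_matrix S) ** diag_matrix (c_vector S)"
  have A: "(?A ** matrix_power H \<pi>) $ k $ i = matrix_power H \<pi> $ cluster_of k $ i / real (card (S (cluster_of k)))"
    for i
  proof -
    have "(?A ** matrix_power H \<pi>) $ k $ i =
      (\<Sum>j\<in>UNIV. if cluster_of k = j then matrix_power H \<pi> $ j $ i / real (card (S j)) else 0)"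
      unfolding matrix_matrix_mult_def[of _ "matrix_power H \<pi>"] vec_lambda_beta transpose_B_diag_nth
      by (rule sum.cong) auto
    then show ?thesis by simp
  qed
  have "Z_matrix S H \<pi> $ k $ l = (\<Sum>i\<in>UNIV. if cluster_of l = i
     then (?A ** matrix_power H \<pi>) $ k $ i else 0)"
    unfolding Z_matrix_def matrix_matrix_mult_def[of _ "B_matrix S"] vec_lambda_beta
    by (rule sum.cong) (auto simp: B_matrix_nth)
  then show ?thesis by (simp add: A)
qed

lemma V_matrix_one: "V_matrix S *v 1 = 1"
proof -
  have "(\<Sum>l\<in>UNIV. V_matrix S $ k $ l) = 1" for k
  proof -
    have "(\<Sum>l\<in>UNIV. V_matrix S $ k $ l) =
      (\<Sum>l\<in>UNIV. if cluster_of l = cluster_of k then 1 / real (card (S (cluster_of k))) else 0)"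
      by (rule sum.cong) (auto simp: V_matrix_nth)
    then show ?thesis
      unfolding sum_in_cluster by simp
  qed
  then show ?thesis by (simp add: matrix_vector_mult_def vec_eq_iff)
qed

lemma column_mult_V:
  fixes X :: "real^'n^'d"
  shows "column k (X ** V_matrix S) =
    (1 / real (card (S (cluster_of k)))) *\<^sub>R (\<Sum>l\<in>S (cluster_of k). column l X)"
proof -
  have "column k (X ** V_matrix S) = (\<Sum>l\<in>UNIV. if cluster_of l = cluster_of k
      then (1 / real (card (S (cluster_of k)))) *\<^sub>R column l X else 0)"
    unfolding column_matrix_mult by (rule sum.cong) (auto simp: V_matrix_nth)
  then show ?thesis unfolding sum_in_cluster by (simp add: scaleR_sum_right)
qed

text \<open>Left multiplication by V averages the rows within each cluster, which changes nothing if
  these rows agree. Applied to V and to Z themselves, it gives V V = V and V Z = Z.\<close>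

lemma V_matrix_mult_cluster_const:
  fixes A :: "real^'n^'n"
  assumes "\<And>k l j. cluster_of k = cluster_of l \<Longrightarrow> A $ k $ j = A $ l $ j"
  shows "V_matrix S ** A = A"
proof -
  have "(V_matrix S ** A) $ k $ j = A $ k $ j" for k j
  proof -
    have "(V_matrix S ** A) $ k $ j =
      (\<Sum>l\<in>UNIV. if cluster_of l = cluster_of k then A $ k $ j / real (card (S (cluster_of k))) else 0)"
      unfolding matrix_matrix_mult_def vec_lambda_beta
      by (rule sum.cong) (auto simp: V_matrix_nth intro: assms)
    then show ?thesis
      unfolding sum_in_cluster by simp
  qed
  then show ?thesis by (simp add: vec_eq_iff)
qed

lemma orthogonal_projection_V: "orthogonal_projection (V_matrix S)"
  unfolding orthogonal_projection_def
proof
  show "V_matrix S ** V_matrix S = V_matrix S"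
    by (rule V_matrix_mult_cluster_const) (simp add: V_matrix_nth)
  show "transpose (V_matrix S) = V_matrix S"
    by (simp add: transpose_def vec_eq_iff V_matrix_nth)
qed

lemma V_J: "V_matrix S ** J_matrix = J_matrix" and J_V: "J_matrix ** V_matrix S = J_matrix"
  using mult_J_matrix J_matrix_mult V_matrix_one orthogonal_projection_V
  by (auto simp: orthogonal_projection_def)

lemma orthogonal_projection_mat_1_V: "orthogonal_projection (mat 1 - V_matrix S)"
  by (rule orthogonal_projection_diff) (simp_all add: orthogonal_projection_mat_1 orthogonal_projection_V)

lemma orthogonal_projection_V_J: "orthogonal_projection (V_matrix S - J_matrix)"
  by (rule orthogonal_projection_diff) (simp_all add: orthogonal_projection_J orthogonal_projection_V V_J J_V)

text \<open>Both squared norms are traces of projections. Each cluster contributes n_i * (1 / n_i) =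
  1 to the trace of V, so that trace is m, and J has trace 1.\<close>

lemma norm_mat_1_V: "(norm (mat 1 - V_matrix S))\<^sup>2 = real CARD('n) - real CARD('m)"
  and norm_V_J: "(norm (V_matrix S - J_matrix))\<^sup>2 = real CARD('m) - 1"
proof -
  have "trace (V_matrix S) = (\<Sum>k\<in>UNIV. 1 / real (card (S (cluster_of k))))"
    by (simp add: trace_def V_matrix_nth)
  also have "\<dots> = real CARD('m)"
    by (subst sum_cluster_of[of "\<lambda>i. 1 / real (card (S i))"]) simp
  finally have tr: "trace (V_matrix S) = real CARD('m)" .
  have "trace (J_matrix :: real^'n^'n) = 1"
    by (simp add: trace_def J_matrix_def)
  moreover have "trace (mat 1 :: real^'n^'n) = real CARD('n)"
    by (simp add: trace_I)
  ultimately show "(norm (mat 1 - V_matrix S))\<^sup>2 = real CARD('n) - real CARD('m)"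
      "(norm (V_matrix S - J_matrix))\<^sup>2 = real CARD('m) - 1"
    using tr by (simp_all add: orthogonal_projection_norm orthogonal_projection_mat_1_V
        orthogonal_projection_V_J trace_sub)
qed

end

section \<open>Gossip averaging between clusters of equal size\<close>

locale cluster_mixing = clustering S for S :: "'m::finite \<Rightarrow> 'n::finite set" +
  fixes H :: "real^'m^'m" and \<pi> :: nat and z :: real
  assumes H_sym: "transpose H = H"
    and H_one: "H *v 1 = 1"
    and contraction: "\<And>v. (\<Sum>i\<in>UNIV. v $ i) = 0 \<Longrightarrow> norm (matrix_power H \<pi> *v v) \<le> z * norm v"
    and z: "0 \<le> z" "z < 1"
    and Z_one: "Z_matrix S H \<pi> *v 1 = 1"
begin

text \<open>\<open>Z 1 = 1\<close> says that the vector of cluster sizes is fixed by \<open>H\<^sup>\<pi>\<close>, which contracts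
  the complement of the constants. Hence \<open>Z\<close> is symmetric.\<close>

lemma card_cluster_eq: "card (S i) = card (S j)"
proof -
  let ?N = "\<chi> i. real (card (S i))"
  have "(\<Sum>j\<in>UNIV. matrix_power H \<pi> $ i $ j * real (card (S j))) = real (card (S i))" for i
  proof -
    obtain k where k: "cluster_of k = i"
      using cluster_nonempty[of i] in_cluster_iff by blast
    \<comment> \<open>Row \<open>k\<close> of Z 1 = 1, grouped by clusters and multiplied by the
      size of cluster \<open>i\<close>, is the coordinate \<open>i\<close> of the fixed point
      equation for the vector of sizes.\<close>
    have "1 = (\<Sum>l\<in>UNIV. Z_matrix S H \<pi> $ k $ l)"
      using Z_one by (simp add: matrix_vector_mult_def vec_eq_iff)
    also have "\<dots> = (\<Sum>j\<in>UNIV. real (card (S j)) * (matrix_power H \<pi> $ i $ j / real (card (S i))))"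
      unfolding Z_matrix_nth k by (rule sum_cluster_of)
    also have "\<dots> = (\<Sum>j\<in>UNIV. matrix_power H \<pi> $ i $ j * real (card (S j))) / real (card (S i))"
      by (simp add: sum_divide_distrib mult.commute)
    finally show ?thesis using card_cluster_pos[of i] by (simp add: field_simps)
  qed
  then have fix_N: "matrix_power H \<pi> *v ?N = ?N"
    by (simp add: matrix_vector_mult_def vec_eq_iff)
  \<comment> \<open>Subtracting the mean size makes the fixed vector zero-sum, and there
    \<open>z < 1\<close> leaves 0 as the only fixed vector.\<close>
  define a where "a = (\<Sum>i\<in>UNIV. real (card (S i))) / real CARD('m)"
  let ?v = "?N - a *\<^sub>R 1"
  have "matrix_power H \<pi> *v ?v = ?v"
    using fix_N matrix_power_fixes_one[OF H_one, of \<pi>]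
    by (simp add: matrix_vector_mult_diff_distrib matrix_vector_mult_scaleR)
  moreover have "(\<Sum>i\<in>UNIV. ?v $ i) = 0"
    by (simp add: sum_subtractf a_def)
  ultimately have "norm ?v \<le> z * norm ?v" using contraction[of ?v] by simp
  then have "(1 - z) * norm ?v \<le> 0" by (simp add: algebra_simps)
  then have "?v = 0" using z by (simp add: mult_le_0_iff)
  then have "real (card (S i)) = a" for i by (simp add: vec_eq_iff)
  then have "real (card (S i)) = real (card (S j))" by simp
  then show ?thesis by simp
qed

lemma transpose_Z: "transpose (Z_matrix S H \<pi>) = Z_matrix S H \<pi>"
proof -
  have "matrix_power H \<pi> $ i $ j = matrix_power H \<pi> $ j $ i" for i j
    using arg_cong[OF transpose_matrix_power[OF H_sym, of \<pi>], of "\<lambda>A. A $ i $ j"]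
    by (simp add: transpose_def)
  then show ?thesis
    using card_cluster_eq[of "cluster_of _" "cluster_of _"]
    by (auto simp: transpose_def vec_eq_iff Z_matrix_nth intro!: arg_cong2[of _ _ _ _ "(/)"])
qed

lemma V_Z: "V_matrix S ** Z_matrix S H \<pi> = Z_matrix S H \<pi>"
  by (rule V_matrix_mult_cluster_const) (simp add: Z_matrix_nth)

lemma Z_V: "Z_matrix S H \<pi> ** V_matrix S = Z_matrix S H \<pi>"
  using V_Z transpose_Z orthogonal_projection_V
  by (metis matrix_transpose_mul orthogonal_projection_def)

lemma Z_J: "Z_matrix S H \<pi> ** J_matrix = J_matrix" and J_Z: "J_matrix ** Z_matrix S H \<pi> = J_matrix"
  using mult_J_matrix[OF Z_one] J_matrix_mult[OF Z_one transpose_Z] by auto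

text \<open>A row in the range of V - J is constant on clusters and zero-sum, hence the lift
  \<open>w \<circ> cluster_of\<close> of a zero-sum vector \<open>w\<close> with one coordinate per
  cluster. By symmetry of Z, multiplication by Z acts on \<open>w\<close> as H^\<pi>. Since all
  clusters have \<open>s\<close> devices, lifting multiplies squared norms by \<open>s\<close> on
  both sides, so the contraction factor is preserved.\<close>

lemma Z_contraction:
  "norm (x v* ((V_matrix S - J_matrix) ** Z_matrix S H \<pi>)) \<le> z * norm (x v* (V_matrix S - J_matrix))"
proof -
  define y where "y = x v* (V_matrix S - J_matrix)"
  obtain s where s: "\<And>i. card (S i) = s" using card_cluster_eq by blast
  have s0: "0 < s" using card_cluster_pos s by metis
  define w :: "real^'m" where "w = (\<chi> i. (\<Sum>l\<in>S i. y $ l) / real s)"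
  have "(V_matrix S - J_matrix) ** V_matrix S = V_matrix S - J_matrix"
    using orthogonal_projection_V by (simp add: matrix_diff_rdistrib J_V orthogonal_projection_def)
  then have "y v* V_matrix S = y"
    by (simp add: y_def vector_matrix_mul_assoc)
  then have "y $ k = (\<Sum>l\<in>UNIV. V_matrix S $ l $ k * y $ l)" for k
    by (simp add: vector_matrix_mult_def vec_eq_iff mult.commute[of "y $ _"])
  also have "(\<Sum>l\<in>UNIV. V_matrix S $ l $ k * y $ l) =
      (\<Sum>l\<in>UNIV. if cluster_of l = cluster_of k then y $ l / real s else 0)" for k
    by (rule sum.cong) (auto simp: V_matrix_nth s)
  also have "(\<Sum>l\<in>UNIV. if cluster_of l = cluster_of k then y $ l / real s else 0) = w $ cluster_of k" for k
    unfolding sum_in_cluster by (simp add: w_def sum_divide_distrib)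
  finally have y_w: "y $ k = w $ cluster_of k" for k .
  have "(\<Sum>k\<in>UNIV. y $ k) = y \<bullet> 1" by (simp add: inner_vec_def)
  also have "\<dots> = x \<bullet> ((V_matrix S - J_matrix) *v 1)"
    unfolding y_def by (rule dot_lmul_matrix)
  also have "(V_matrix S - J_matrix) *v 1 = 0"
    by (simp add: matrix_vector_mult_diff_rdistrib V_matrix_one)
      (simp add: matrix_vector_mult_def J_matrix_def vec_eq_iff)
  finally have "(\<Sum>i\<in>UNIV. real s * w $ i) = 0"
    unfolding y_w by (subst (asm) sum_cluster_of) (simp add: s)
  then have w0: "(\<Sum>i\<in>UNIV. w $ i) = 0"
    using s0 by (simp add: sum_distrib_left[symmetric])
  have sq: "(norm v)\<^sup>2 = real s * (norm u)\<^sup>2" if "\<And>k. v $ k = u $ cluster_of k" for v :: "real^'n" and u :: "real^'m"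
    unfolding norm_vec_sq that by (subst sum_cluster_of) (simp add: s sum_distrib_left)
  have "(y v* Z_matrix S H \<pi>) $ l = (matrix_power H \<pi> *v w) $ cluster_of l" for l
  proof -
    have "(y v* Z_matrix S H \<pi>) $ l = (\<Sum>k\<in>UNIV. transpose (Z_matrix S H \<pi>) $ l $ k * y $ k)"
      by (simp add: vector_matrix_mult_def transpose_def mult.commute)
    also have "\<dots> = (\<Sum>k\<in>UNIV. matrix_power H \<pi> $ cluster_of l $ cluster_of k * w $ cluster_of k / real s)"
      unfolding transpose_Z Z_matrix_nth y_w s by simp
    also have "\<dots> = (\<Sum>i\<in>UNIV. matrix_power H \<pi> $ cluster_of l $ i * w $ i)"
      using s0 by (subst sum_cluster_of[of "\<lambda>i. matrix_power H \<pi> $ cluster_of l $ i * w $ i / real s"]) (simp add: s)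
    finally show ?thesis by (simp add: matrix_vector_mult_def)
  qed
  then have "(norm (y v* Z_matrix S H \<pi>))\<^sup>2 = real s * (norm (matrix_power H \<pi> *v w))\<^sup>2"
    by (rule sq)
  also have "\<dots> \<le> real s * (z * norm w)\<^sup>2"
    using contraction[OF w0] by (intro mult_left_mono power_mono) auto
  also have "\<dots> = (z * norm y)\<^sup>2"
    using sq[OF y_w] by (simp add: power_mult_distrib)
  finally have "norm (y v* Z_matrix S H \<pi>) \<le> z * norm y"
    by (rule power2_le_imp_le) (simp add: z)
  then show ?thesis by (simp add: y_def vector_matrix_mul_assoc)
qed

end

section \<open>Geometric sums over blocks\<close>

lemma geometric_sum_le:
  fixes z :: real
  assumes "0 \<le> z" "z < 1"
  shows "(\<Sum>j<n. z ^ j) \<le> 1 / (1 - z)"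
proof -
  have "(\<Sum>j<n. z ^ j) = (1 - z ^ n) / (1 - z)"
    using assms by (subst sum_gp_strict) auto
  also have "\<dots> \<le> 1 / (1 - z)" using assms by (intro divide_right_mono) auto
  finally show ?thesis .
qed

lemma sum_blocks:
  fixes h :: "nat \<Rightarrow> nat \<Rightarrow> 'a::comm_monoid_add"
  assumes "0 < R"
  shows "(\<Sum>i<n * R. h (i div R) (i mod R)) = (\<Sum>j<n. \<Sum>r<R. h j r)"
proof -
  have "(\<Sum>i<n * R. h (i div R) (i mod R)) = (\<Sum>j<n. \<Sum>i\<in>{j * R..<j * R + R}. h (i div R) (i mod R))"
    by (rule sum.nat_group[symmetric])
  also have "\<dots> = (\<Sum>j<n. \<Sum>r<R. h j r)"
  proof (rule sum.cong[OF refl])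
    fix j
    have "(\<Sum>i\<in>{0 + j * R..<R + j * R}. h (i div R) (i mod R)) = (\<Sum>r\<in>{0..<R}. h j r)"
      by (subst sum.shift_bounds_nat_ivl) (auto intro!: sum.cong)
    then show "(\<Sum>i\<in>{j * R..<j * R + R}. h (i div R) (i mod R)) = (\<Sum>r<R. h j r)"
      by (simp add: add.commute atLeast0LessThan)
  qed
  finally show ?thesis .
qed

text \<open>The weight is constant on each block of length \<open>R\<close> and
  \<open>f (t mod R)\<close> is periodic. All terms being nonnegative, the range may be enlarged to
  \<open>T\<close> whole blocks starting with the block of \<open>s\<close>, where the sum factors
  into a geometric sum and a sum over one period.\<close>

lemma geometric_block_sum_future:
  fixes z :: real and f :: "nat \<Rightarrow> real"
  assumes z: "0 \<le> z" "z < 1" and R: "0 < R" and f: "\<And>r. 0 \<le> f r"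
  shows "(\<Sum>t\<in>{s..<T}. z ^ (t div R - s div R) * f (t mod R)) \<le> (\<Sum>r<R. f r) / (1 - z)"
proof -
  define b where "b = s div R"
  have sub: "{s..<T} \<subseteq> {0 + b * R..<T * R + b * R}"
  proof -
    have "b * R \<le> s" by (simp add: b_def)
    moreover have "T \<le> T * R + b * R" using R by (metis One_nat_def Suc_leI le_add1 le_trans mult_le_mono2 nat_mult_1_right)
    ultimately show ?thesis by auto
  qed
  have "(\<Sum>t\<in>{s..<T}. z ^ (t div R - b) * f (t mod R))
      \<le> (\<Sum>t\<in>{0 + b * R..<T * R + b * R}. z ^ (t div R - b) * f (t mod R))"
    by (rule sum_mono2[OF _ sub]) (use z f in auto)
  also have "\<dots> = (\<Sum>i<T * R. z ^ (i div R) * f (i mod R))"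
    unfolding sum.shift_bounds_nat_ivl using R by (simp add: atLeast0LessThan)
  also have "\<dots> = (\<Sum>j<T. z ^ j) * (\<Sum>r<R. f r)"
    using sum_blocks[OF R, of "\<lambda>j r. z ^ j * f r"] by (simp add: sum_product)
  also have "\<dots> \<le> 1 / (1 - z) * (\<Sum>r<R. f r)"
    by (intro mult_right_mono geometric_sum_le z sum_nonneg f)
  finally show ?thesis by (simp add: b_def)
qed

text \<open>The started block of \<open>t\<close> contributes \<open>t mod R\<close> terms of weight
  1. An earlier block lies at least one mixing step back, so the full blocks carry the weights z,
  z^2, ..., which explains the numerator \<open>z\<close>.\<close>

lemma geometric_block_sum_past:
  fixes z :: real
  assumes z: "0 \<le> z" "z < 1" and R: "0 < R"
  shows "(\<Sum>s<t. z ^ (t div R - s div R)) \<le> real (t mod R) + real R * z / (1 - z)"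
proof -
  define b where "b = t div R"
  have t: "t = t mod R + b * R" by (simp add: b_def)
  have "(\<Sum>s<t. z ^ (b - s div R)) = (\<Sum>s<b * R. z ^ (b - s div R)) + (\<Sum>s\<in>{b * R..<t}. z ^ (b - s div R))"
    by (simp add: sum.atLeastLessThan_concat atLeast0LessThan[symmetric] b_def)
  also have "(\<Sum>s\<in>{b * R..<t}. z ^ (b - s div R)) = (\<Sum>s\<in>{b * R..<t}. 1)"
  proof (rule sum.cong[OF refl])
    fix s assume "s \<in> {b * R..<t}"
    then have "b \<le> s div R" using R by (simp add: less_eq_div_iff_mult_less_eq)
    then show "z ^ (b - s div R) = 1" by simp
  qed
  also have "\<dots> = real (t mod R)" by (subst t) simp
  also have "(\<Sum>s<b * R. z ^ (b - s div R)) = (\<Sum>j<b. \<Sum>r<R. z ^ (b - j))"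
    using sum_blocks[OF R, of "\<lambda>j r. z ^ (b - j)"] by simp
  also have "\<dots> = real R * (\<Sum>j<b. z ^ (b - j))"
    by (simp add: sum_distrib_left)
  also have "(\<Sum>j<b. z ^ (b - j)) = (\<Sum>j<b. z ^ Suc j)"
    by (subst sum.nat_diff_reindex[symmetric]) (auto intro!: sum.cong)
  also have "\<dots> = z * (\<Sum>j<b. z ^ j)" by (simp add: sum_distrib_left)
  finally have "(\<Sum>s<t. z ^ (b - s div R)) = real R * (z * (\<Sum>j<b. z ^ j)) + real (t mod R)" .
  also have "\<dots> \<le> real R * (z * (1 / (1 - z))) + real (t mod R)"
    by (intro add_mono mult_left_mono geometric_sum_le z order_refl) auto
  finally show ?thesis by (simp add: b_def)
qed

lemma geometric_block_sum_past_const: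
  fixes z :: real
  assumes z: "0 \<le> z" "z < 1" and R: "0 < R"
  shows "(\<Sum>s<t. z ^ (t div R - s div R)) \<le> real R / (1 - z)"
proof -
  have "real (t mod R) \<le> real R" using R by (simp add: less_imp_le)
  then have "real (t mod R) + real R * z / (1 - z) \<le> real R + real R * z / (1 - z)" by simp
  also have "\<dots> = real R / (1 - z)" using z by (simp add: field_simps)
  finally show ?thesis using geometric_block_sum_past[OF assms, of t] by linarith
qed

text \<open>This is the sum of r + R z / (1 - z) over one period r < R, with R (R - 1) / 2 rounded
  up to R^2 / 2, divided by 1 - z: the bound on the past, averaged against the weights of the
  future. For z = 0 it is R^2 / 2.\<close>

definition block_kernel :: "nat \<Rightarrow> real \<Rightarrow> real" where
  "block_kernel R z = (real R)\<^sup>2 / (2 * (1 - z)) + (real R)\<^sup>2 * z / (1 - z)\<^sup>2"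

text \<open>The left side is the total weight with which the squared gradient at time
  \<open>s\<close> enters the deviations at all later times; the inner sum is the normalising factor
  that Cauchy-Schwarz produces at time \<open>t\<close>. The bound does not depend on
  \<open>T\<close>.\<close>

lemma geometric_block_sum_kernel:
  fixes z :: real
  assumes z: "0 \<le> z" "z < 1" and R: "0 < R"
  shows "(\<Sum>t\<in>{s<..<T}. z ^ (t div R - s div R) * (\<Sum>r<t. z ^ (t div R - r div R))) \<le> block_kernel R z"
proof -
  define c where "c = real R * z / (1 - z)"
  have c: "0 \<le> c" using z by (simp add: c_def)
  have "(\<Sum>t\<in>{s<..<T}. z ^ (t div R - s div R) * (\<Sum>r<t. z ^ (t div R - r div R)))
     \<le> (\<Sum>t\<in>{s<..<T}. z ^ (t div R - s div R) * (real (t mod R) + c))"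
    unfolding c_def by (intro sum_mono mult_left_mono geometric_block_sum_past z R) (use z in auto)
  also have "\<dots> \<le> (\<Sum>t\<in>{s..<T}. z ^ (t div R - s div R) * (real (t mod R) + c))"
    by (rule sum_mono2) (use z c in auto)
  also have "\<dots> \<le> (\<Sum>r<R. real r + c) / (1 - z)"
    using c by (intro geometric_block_sum_future z R) auto
  also have "(\<Sum>r<R. real r + c) = real R * (real R - 1) / 2 + real R * c"
  proof -
    have "(\<Sum>r<n. real r) = real n * (real n - 1) / 2" for n
      by (induction n) (auto simp: field_simps)
    then show ?thesis by (simp add: sum.distrib)
  qed
  also have "\<dots> / (1 - z) \<le> ((real R)\<^sup>2 / 2 + real R * c) / (1 - z)"
    using z by (intro divide_right_mono add_mono) (auto simp: power2_eq_square algebra_simps)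
  also have "\<dots> = block_kernel R z"
    using z by (simp add: block_kernel_def c_def power2_eq_square add_divide_distrib)
  finally show ?thesis .
qed

text \<open>Cauchy-Schwarz with the weight split as \<open>sqrt (w i) * sqrt (w i)\<close>.\<close>

lemma weighted_sum_power2_le:
  fixes w a :: "'i \<Rightarrow> real"
  assumes "\<And>i. i \<in> I \<Longrightarrow> 0 \<le> w i"
  shows "(\<Sum>i\<in>I. w i * a i)\<^sup>2 \<le> (\<Sum>i\<in>I. w i) * (\<Sum>i\<in>I. w i * (a i)\<^sup>2)"
proof -
  have "(\<Sum>i\<in>I. sqrt (w i) * (sqrt (w i) * a i))\<^sup>2
      \<le> (\<Sum>i\<in>I. (sqrt (w i))\<^sup>2) * (\<Sum>i\<in>I. (sqrt (w i) * a i)\<^sup>2)"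
    by (rule Cauchy_Schwarz_ineq_sum)
  also have "(\<Sum>i\<in>I. sqrt (w i) * (sqrt (w i) * a i)) = (\<Sum>i\<in>I. w i * a i)"
    using assms by (intro sum.cong) (auto simp: mult.assoc[symmetric])
  also have "(\<Sum>i\<in>I. (sqrt (w i))\<^sup>2) = (\<Sum>i\<in>I. w i)"
    using assms by (intro sum.cong) auto
  also have "(\<Sum>i\<in>I. (sqrt (w i) * a i)\<^sup>2) = (\<Sum>i\<in>I. w i * (a i)\<^sup>2)"
    using assms by (intro sum.cong) (auto simp: power_mult_distrib)
  finally show ?thesis .
qed

section \<open>Gradients and smoothness\<close>

lemma norm_add_power2_le: "(norm (x + y))\<^sup>2 \<le> 2 * (norm x)\<^sup>2 + 2 * (norm y)\<^sup>2"
  for x y :: "'a::real_inner"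
proof -
  have "0 \<le> (norm (x - y))\<^sup>2" by simp
  then show ?thesis
    unfolding power2_norm_eq_inner by (simp add: inner_add inner_diff inner_commute)
qed

text \<open>Riesz representation: the derivative is a linear functional, and its representing vector
  is the image of 1 under the adjoint.\<close>

lemma GDERIV_gradient:
  assumes "f differentiable (at x)"
  shows "GDERIV f x :> gradient f x"
proof -
  obtain f' where f': "(f has_derivative f') (at x)" using assms by (auto simp: differentiable_def)
  then have "linear f'" by (rule has_derivative_linear)
  then have "f' = (\<lambda>h. h \<bullet> adjoint f' 1)" by (simp add: adjoint_works fun_eq_iff)
  then have "GDERIV f x :> adjoint f' 1" using f' by (simp add: gderiv_def)
  then show ?thesis using gradient_eqI by metis
qed

text \<open>The function \<open>\<phi>\<close> restricts \<open>f\<close> to the segment from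
  \<open>x\<close> to \<open>y\<close> and subtracts the linear and quadratic terms of the claim.
  The Lipschitz bound makes its derivative nonpositive on [0, 1], so comparing the end points
  replaces an integration of the gradient.\<close>

lemma smooth_upper_bound:
  fixes f :: "'a::euclidean_space \<Rightarrow> real"
  assumes deriv: "\<And>x. GDERIV f x :> g x"
    and lip: "\<And>x y. norm (g x - g y) \<le> L * norm (x - y)"
  shows "f y \<le> f x + g x \<bullet> (y - x) + L / 2 * (norm (y - x))\<^sup>2"
proof -
  define d where "d = y - x"
  define \<phi> where "\<phi> t = f (x + t *\<^sub>R d) - t * (g x \<bullet> d) - L / 2 * t\<^sup>2 * (norm d)\<^sup>2" for t :: real
  have D: "(\<phi> has_real_derivative ((g (x + t *\<^sub>R d) - g x) \<bullet> d - L * t * (norm d)\<^sup>2)) (at t)" for t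
  proof -
    have "(f has_derivative (\<lambda>h. h \<bullet> g (x + t *\<^sub>R d))) (at (x + t *\<^sub>R d))"
      using deriv by (simp add: gderiv_def)
    moreover have "((\<lambda>t. x + t *\<^sub>R d) has_derivative (\<lambda>h. h *\<^sub>R d)) (at t)"
      by (auto intro!: derivative_eq_intros)
    ultimately have "((\<lambda>t. f (x + t *\<^sub>R d)) has_derivative (\<lambda>h. (h *\<^sub>R d) \<bullet> g (x + t *\<^sub>R d))) (at t)"
      by (rule has_derivative_compose[rotated])
    then have "((\<lambda>t. f (x + t *\<^sub>R d)) has_real_derivative (g (x + t *\<^sub>R d) \<bullet> d)) (at t)"
      by (simp add: has_field_derivative_def inner_commute mult_commute_abs)
    from this show ?thesis
      unfolding \<phi>_def
      by (auto intro!: derivative_eq_intros simp: inner_diff_left)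
  qed
  have "\<phi> 1 \<le> \<phi> 0"
  proof (rule DERIV_nonpos_imp_nonincreasing[of 0 1 \<phi>])
    fix t :: real assume t: "0 \<le> t" "t \<le> 1"
    have "(g (x + t *\<^sub>R d) - g x) \<bullet> d \<le> norm (g (x + t *\<^sub>R d) - g x) * norm d"
      by (rule norm_cauchy_schwarz)
    also have "\<dots> \<le> (L * norm (t *\<^sub>R d)) * norm d"
      using lip[of "x + t *\<^sub>R d" x] by (intro mult_right_mono) auto
    also have "\<dots> = L * t * (norm d)\<^sup>2" using t by (simp add: power2_eq_square)
    finally show "\<exists>m. DERIV \<phi> t :> m \<and> m \<le> 0" using D[of t] by force
  qed simp
  then show ?thesis by (simp add: \<phi>_def d_def)
qed

section \<open>Orthogonal noise\<close>

definition square_integrable :: "'w measure \<Rightarrow> ('w \<Rightarrow> 'a::euclidean_space) \<Rightarrow> bool" where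
  "square_integrable M f \<longleftrightarrow> f \<in> borel_measurable M \<and> integrable M (\<lambda>\<omega>. (norm (f \<omega>))\<^sup>2)"

lemma square_integrable_measurable [measurable_dest]:
  "square_integrable M f \<Longrightarrow> f \<in> borel_measurable M"
  by (simp add: square_integrable_def)

lemma square_integrable_dominated:
  assumes f: "f \<in> borel_measurable M" and g: "integrable M g"
    and le: "\<And>\<omega>. (norm (f \<omega>))\<^sup>2 \<le> g \<omega>"
  shows "square_integrable M f"
  unfolding square_integrable_def
proof
  show "integrable M (\<lambda>\<omega>. (norm (f \<omega>))\<^sup>2)"
    by (rule Bochner_Integration.integrable_bound[OF g])
      (use f le in \<open>auto intro!: AE_I2 order_trans[OF le abs_ge_self]\<close>)
qed (rule f)

lemma square_integrable_add:
  assumes "square_integrable M f" "square_integrable M g"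
  shows "square_integrable M (\<lambda>\<omega>. f \<omega> + g \<omega>)"
  by (rule square_integrable_dominated[where g = "\<lambda>\<omega>. 2 * (norm (f \<omega>))\<^sup>2 + 2 * (norm (g \<omega>))\<^sup>2"])
    (use assms in \<open>auto simp: square_integrable_def norm_add_power2_le\<close>)

lemma square_integrable_scaleR:
  assumes "square_integrable M f"
  shows "square_integrable M (\<lambda>\<omega>. c *\<^sub>R f \<omega>)"
  using assms by (auto simp: square_integrable_def power_mult_distrib)

lemma square_integrable_diff:
  assumes "square_integrable M f" "square_integrable M g"
  shows "square_integrable M (\<lambda>\<omega>. f \<omega> - g \<omega>)"
  using square_integrable_add[OF assms(1) square_integrable_scaleR[OF assms(2), of "-1"]] by simp

lemma square_integrable_zero: "square_integrable M (\<lambda>\<omega>. 0)"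
  by (simp add: square_integrable_def)

lemma square_integrable_sum:
  assumes "\<And>i. i \<in> I \<Longrightarrow> square_integrable M (f i)"
  shows "square_integrable M (\<lambda>\<omega>. \<Sum>i\<in>I. f i \<omega>)"
  using assms
  by (induction I rule: infinite_finite_induct)
    (auto intro: square_integrable_add square_integrable_zero)

lemma square_integrable_bounded_linear:
  assumes "bounded_linear h" "square_integrable M f"
  shows "square_integrable M (\<lambda>\<omega>. h (f \<omega>))"
proof -
  obtain K where K: "\<And>x. norm (h x) \<le> norm x * K"
    using bounded_linear.bounded[OF assms(1)] by blast
  have h: "h \<in> borel_measurable borel"
    by (intro borel_measurable_continuous_onI) (rule linear_continuous_on[OF assms(1)])
  show ?thesis
  proof (rule square_integrable_dominated)
    show "(\<lambda>\<omega>. h (f \<omega>)) \<in> borel_measurable M"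
      using measurable_compose[OF _ h] assms(2) by (auto simp: square_integrable_def)
    show "integrable M (\<lambda>\<omega>. K\<^sup>2 * (norm (f \<omega>))\<^sup>2)"
      using assms(2) by (simp add: square_integrable_def)
    show "(norm (h (f \<omega>)))\<^sup>2 \<le> K\<^sup>2 * (norm (f \<omega>))\<^sup>2" for \<omega>
      using power_mono[OF K[of "f \<omega>"], of 2] by (simp add: power_mult_distrib mult.commute)
  qed
qed

lemma square_integrable_inner:
  assumes "square_integrable M f" "square_integrable M g"
  shows "integrable M (\<lambda>\<omega>. f \<omega> \<bullet> g \<omega>)"
proof (rule Bochner_Integration.integrable_bound)
  show "integrable M (\<lambda>\<omega>. (norm (f \<omega>))\<^sup>2 + (norm (g \<omega>))\<^sup>2)"
    using assms by (simp add: square_integrable_def)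
  show "(\<lambda>\<omega>. f \<omega> \<bullet> g \<omega>) \<in> borel_measurable M"
    using assms by (auto simp: square_integrable_def)
  show "AE \<omega> in M. norm (f \<omega> \<bullet> g \<omega>) \<le> norm ((norm (f \<omega>))\<^sup>2 + (norm (g \<omega>))\<^sup>2)"
  proof (rule AE_I2)
    fix \<omega>
    have "\<bar>f \<omega> \<bullet> g \<omega>\<bar> \<le> norm (f \<omega>) * norm (g \<omega>)" by (rule Cauchy_Schwarz_ineq2)
    also have "\<dots> \<le> (norm (f \<omega>))\<^sup>2 + (norm (g \<omega>))\<^sup>2"
      using sum_squares_bound[of "norm (f \<omega>)" "norm (g \<omega>)"]
        mult_nonneg_nonneg[OF norm_ge_zero[of "f \<omega>"] norm_ge_zero[of "g \<omega>"]] by linarith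
    finally show "norm (f \<omega> \<bullet> g \<omega>) \<le> norm ((norm (f \<omega>))\<^sup>2 + (norm (g \<omega>))\<^sup>2)" by simp
  qed
qed

lemma square_integrable_norm_sq:
  "square_integrable M f \<Longrightarrow> integrable M (\<lambda>\<omega>. (norm (f \<omega>))\<^sup>2)"
  by (simp add: square_integrable_def)

lemma borel_measurable_lipschitz:
  fixes h :: "'a::euclidean_space \<Rightarrow> 'b::euclidean_space"
  assumes lip: "\<And>x y. norm (h x - h y) \<le> L * norm (x - y)"
  shows "h \<in> borel_measurable borel"
proof -
  have "norm (h x - h y) \<le> \<bar>L\<bar> * norm (x - y)" for x y
    using lip[of x y] mult_right_mono[OF abs_ge_self[of L] norm_ge_zero[of "x - y"]] by linarith
  then have "\<bar>L\<bar>-lipschitz_on UNIV h" by (auto simp: lipschitz_on_def dist_norm)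
  then show ?thesis
    by (intro borel_measurable_continuous_onI lipschitz_on_continuous_on)
qed

text \<open>A Lipschitz map grows at most linearly, and the constant \<open>h 0\<close> is square
  integrable because the measure is finite.\<close>

lemma square_integrable_lipschitz:
  fixes h :: "'a::euclidean_space \<Rightarrow> 'b::euclidean_space"
  assumes M: "finite_measure M" and f: "square_integrable M f"
    and lip: "\<And>x y. norm (h x - h y) \<le> L * norm (x - y)"
  shows "square_integrable M (\<lambda>\<omega>. h (f \<omega>))"
proof (rule square_integrable_dominated)
  interpret finite_measure M by (rule M)
  have h: "h \<in> borel_measurable borel" by (rule borel_measurable_lipschitz[OF lip])
  show "(\<lambda>\<omega>. h (f \<omega>)) \<in> borel_measurable M"
    using measurable_compose[OF _ h] f by (auto simp: square_integrable_def)
  show "integrable M (\<lambda>\<omega>. 2 * (L\<^sup>2 * (norm (f \<omega>))\<^sup>2) + 2 * (norm (h 0))\<^sup>2)"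
    using f by (simp add: square_integrable_def)
  show "(norm (h (f \<omega>)))\<^sup>2 \<le> 2 * (L\<^sup>2 * (norm (f \<omega>))\<^sup>2) + 2 * (norm (h 0))\<^sup>2" for \<omega>
    using norm_add_power2_le[of "h (f \<omega>) - h 0" "h 0"] power_mono[OF lip[of "f \<omega>" 0], of 2]
    by (simp add: power_mult_distrib)
qed

text \<open>The cross terms of the expanded square integrate to 0, so variances add without the
  factor \<open>card I\<close> that a triangle inequality would cost.\<close>

lemma expectation_orthogonal_sum:
  fixes v :: "'i \<Rightarrow> 'w \<Rightarrow> 'a::euclidean_space"
  assumes I: "finite I"
    and sq: "\<And>i. i \<in> I \<Longrightarrow> square_integrable M (v i)"
    and orth: "\<And>i j. i \<in> I \<Longrightarrow> j \<in> I \<Longrightarrow> i \<noteq> j \<Longrightarrow> (\<integral>\<omega>. v i \<omega> \<bullet> v j \<omega> \<partial>M) = 0"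
    and var: "\<And>i. i \<in> I \<Longrightarrow> (\<integral>\<omega>. (norm (v i \<omega>))\<^sup>2 \<partial>M) \<le> V"
  shows "(\<integral>\<omega>. (norm (\<Sum>i\<in>I. c i *\<^sub>R v i \<omega>))\<^sup>2 \<partial>M) \<le> V * (\<Sum>i\<in>I. (c i)\<^sup>2)"
proof -
  have int: "integrable M (\<lambda>\<omega>. v i \<omega> \<bullet> v j \<omega>)" if "i \<in> I" "j \<in> I" for i j
    using square_integrable_inner[OF sq[OF that(1)] sq[OF that(2)]] .
  have "(\<integral>\<omega>. (norm (\<Sum>i\<in>I. c i *\<^sub>R v i \<omega>))\<^sup>2 \<partial>M)
      = (\<integral>\<omega>. (\<Sum>i\<in>I. \<Sum>j\<in>I. c i * c j * (v i \<omega> \<bullet> v j \<omega>)) \<partial>M)"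
  proof (intro Bochner_Integration.integral_cong refl)
    fix \<omega>
    show "(norm (\<Sum>i\<in>I. c i *\<^sub>R v i \<omega>))\<^sup>2 = (\<Sum>i\<in>I. \<Sum>j\<in>I. c i * c j * (v i \<omega> \<bullet> v j \<omega>))"
      unfolding power2_norm_eq_inner inner_sum_left inner_sum_right inner_scaleR_left inner_scaleR_right
      by (simp add: mult.assoc sum_distrib_left inner_commute)
  qed
  also have "\<dots> = (\<Sum>i\<in>I. \<Sum>j\<in>I. c i * c j * (\<integral>\<omega>. v i \<omega> \<bullet> v j \<omega> \<partial>M))"
    by (simp add: Bochner_Integration.integral_sum int)
  also have "\<dots> = (\<Sum>i\<in>I. (c i)\<^sup>2 * (\<integral>\<omega>. (norm (v i \<omega>))\<^sup>2 \<partial>M))"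
  proof (rule sum.cong[OF refl])
    fix i assume i: "i \<in> I"
    have "(\<Sum>j\<in>I. c i * c j * (\<integral>\<omega>. v i \<omega> \<bullet> v j \<omega> \<partial>M))
       = (\<Sum>j\<in>I. if j = i then (c i)\<^sup>2 * (\<integral>\<omega>. (norm (v i \<omega>))\<^sup>2 \<partial>M) else 0)"
      using orth i by (intro sum.cong) (auto simp: power2_norm_eq_inner power2_eq_square[of "c i"])
    then show "(\<Sum>j\<in>I. c i * c j * (\<integral>\<omega>. v i \<omega> \<bullet> v j \<omega> \<partial>M)) = (c i)\<^sup>2 * (\<integral>\<omega>. (norm (v i \<omega>))\<^sup>2 \<partial>M)"
      using i I by simp
  qed
  also have "\<dots> \<le> (\<Sum>i\<in>I. (c i)\<^sup>2 * V)"
    by (intro sum_mono mult_left_mono var) auto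
  finally show ?thesis by (simp add: sum_distrib_left mult.commute)
qed

lemma bounded_linear_column: "bounded_linear (\<lambda>X::real^'n^'d. column k X)"
  by (rule linear_conv_bounded_linear[THEN iffD1])
    (auto simp: linear_iff column_def vec_eq_iff)

text \<open>An interface of second moments: the estimate of the deviations sees the sampling only
  through these three properties, with orthogonality required both across time and across
  devices.\<close>

locale orthogonal_noise = prob_space M for M :: "'w measure" +
  fixes N :: "nat \<Rightarrow> 'w \<Rightarrow> real^'n^'d" and T :: nat and \<sigma> :: real
  assumes noise_square_integrable: "\<And>t. t < T \<Longrightarrow> square_integrable M (N t)"
    and noise_variance: "\<And>t k. t < T \<Longrightarrow> expectation (\<lambda>\<omega>. (norm (column k (N t \<omega>)))\<^sup>2) \<le> \<sigma>\<^sup>2"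
    and noise_orthogonal: "\<And>s t k l. s < T \<Longrightarrow> t < T \<Longrightarrow> (s, k) \<noteq> (t, l) \<Longrightarrow>
      expectation (\<lambda>\<omega>. column k (N s \<omega>) \<bullet> column l (N t \<omega>)) = 0"
begin

text \<open>Each column of the sum is a linear combination of the pairwise orthogonal noise columns,
  with the entries of \<open>A s\<close> as coefficients. Adding the squares of all coefficients
  gives the Frobenius norm, so a projection is charged its rank.\<close>

lemma expectation_noise_sum:
  assumes "t \<le> T"
  shows "expectation (\<lambda>\<omega>. (norm (\<Sum>s<t. N s \<omega> ** A s))\<^sup>2) \<le> \<sigma>\<^sup>2 * (\<Sum>s<t. (norm (A s))\<^sup>2)"
proof -
  let ?I = "{..<t} \<times> (UNIV::'n set)"
  let ?v = "\<lambda>(s, k) \<omega>. column k (N s \<omega>)"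
  have sq: "square_integrable M (?v i)" if "i \<in> ?I" for i
    using that assms
    by (auto intro!: square_integrable_bounded_linear[OF bounded_linear_column] noise_square_integrable)
  have "column j (\<Sum>s<t. N s \<omega> ** A s) = (\<Sum>i\<in>?I. (A (fst i) $ snd i $ j) *\<^sub>R ?v i \<omega>)" for j \<omega>
    by (simp add: linear_sum[OF bounded_linear.linear[OF bounded_linear_column]] column_matrix_mult
        sum.cartesian_product case_prod_beta)
  then have "expectation (\<lambda>\<omega>. (norm (\<Sum>s<t. N s \<omega> ** A s))\<^sup>2)
     = expectation (\<lambda>\<omega>. \<Sum>j\<in>UNIV. (norm (\<Sum>i\<in>?I. (A (fst i) $ snd i $ j) *\<^sub>R ?v i \<omega>))\<^sup>2)"
    by (simp add: norm_matrix_columns)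
  also have "\<dots> = (\<Sum>j\<in>UNIV. expectation (\<lambda>\<omega>. (norm (\<Sum>i\<in>?I. (A (fst i) $ snd i $ j) *\<^sub>R ?v i \<omega>))\<^sup>2))"
    by (intro Bochner_Integration.integral_sum square_integrable_norm_sq square_integrable_sum
        square_integrable_scaleR sq)
  also have "\<dots> \<le> (\<Sum>j\<in>UNIV. \<sigma>\<^sup>2 * (\<Sum>i\<in>?I. (A (fst i) $ snd i $ j)\<^sup>2))"
    by (intro sum_mono expectation_orthogonal_sum sq)
      (use assms in \<open>auto intro!: noise_variance noise_orthogonal\<close>)
  also have "\<dots> = \<sigma>\<^sup>2 * (\<Sum>s<t. (norm (A s))\<^sup>2)"
  proof -
    have "(\<Sum>j\<in>UNIV. \<Sum>i\<in>?I. (A (fst i) $ snd i $ j)\<^sup>2) = (\<Sum>i\<in>?I. \<Sum>j\<in>UNIV. (A (fst i) $ snd i $ j)\<^sup>2)"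
      by (rule sum.swap)
    also have "\<dots> = (\<Sum>s<t. (norm (A s))\<^sup>2)"
      by (simp add: norm_matrix_rows norm_vec_sq sum.cartesian_product')
    finally show ?thesis by (simp add: sum_distrib_left[symmetric])
  qed
  finally show ?thesis .
qed

end

section \<open>Linear recursions with periodic mixing\<close>

lemma unroll_recursion:
  fixes Y G :: "nat \<Rightarrow> real^'n^'d" and P K :: "real^'n^'n"
  assumes R: "0 < R" and Y0: "Y 0 = 0"
    and step: "\<And>t. t < T \<Longrightarrow> Y (Suc t) =
      (if R dvd Suc t then (Y t - \<eta> *\<^sub>R (G t ** P)) ** K else Y t - \<eta> *\<^sub>R (G t ** P))"
    and t: "t \<le> T"
  shows "Y t = - \<eta> *\<^sub>R (\<Sum>s<t. G s ** (P ** matrix_power K (t div R - s div R)))"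
  using t
proof (induction t)
  case (Suc t)
  then have IH: "Y t = - \<eta> *\<^sub>R (\<Sum>s<t. G s ** (P ** matrix_power K (t div R - s div R)))"
    by simp
  \<comment> \<open>This is the state just before a possible mixing: the new term has exponent 0,
    and a factor \<open>K\<close> at time \<open>Suc t\<close> hits it together with all older
    terms.\<close>
  have cur: "Y t - \<eta> *\<^sub>R (G t ** P) = - \<eta> *\<^sub>R (\<Sum>s<Suc t. G s ** (P ** matrix_power K (t div R - s div R)))"
    unfolding IH by (simp add: scaleR_add_right)
  show ?case
  proof (cases "R dvd Suc t")
    case True
    then have "Suc t div R = Suc (t div R)" by (simp add: div_Suc dvd_eq_mod_eq_0)
    moreover have "s div R \<le> t div R" if "s < Suc t" for s
      using that by (simp add: div_le_mono)
    ultimately have "matrix_power K (Suc t div R - s div R) = matrix_power K (t div R - s div R) ** K"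
      if "s < Suc t" for s using that by (simp add: Suc_diff_le)
    moreover have "Y (Suc t) = - \<eta> *\<^sub>R (\<Sum>s<Suc t. G s ** (P ** (matrix_power K (t div R - s div R) ** K)))"
      using step[of t] Suc.prems True unfolding cur
      by (simp only: matrix_scaleR_left matrix_sum_rdistrib matrix_mul_assoc) simp
    ultimately show ?thesis by simp
  next
    case False
    then have "Suc t div R = t div R" by (simp add: div_Suc dvd_eq_mod_eq_0)
    then show ?thesis using step[of t] Suc.prems False cur by simp
  qed
qed (simp add: Y0)

text \<open>Because \<open>P\<close> commutes with \<open>K\<close>, the vector
  \<open>x v* (P ** matrix_power K l)\<close> stays in the range of \<open>P\<close>, so the
  one-step bound applies again at each power.\<close>

lemma projected_power_contraction:
  fixes P K :: "real^'n^'n"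
  assumes P: "P ** P = P" and comm: "P ** K = K ** P"
    and bound: "\<And>x. norm (x v* (P ** K)) \<le> z * norm (x v* P)" and z: "0 \<le> z"
  shows "norm (x v* (P ** matrix_power K l)) \<le> z ^ l * norm (x v* P)"
proof (induction l)
  case (Suc l)
  have PK: "P ** matrix_power K l ** P = P ** matrix_power K l" for l
  proof (induction l)
    case (Suc l)
    have "P ** matrix_power K (Suc l) ** P = P ** matrix_power K l ** (K ** P)"
      by (simp add: matrix_mul_assoc)
    also have "\<dots> = P ** matrix_power K l ** P ** K"
      by (simp add: comm[symmetric] matrix_mul_assoc)
    finally show ?case by (simp add: Suc matrix_mul_assoc)
  qed (simp add: P)
  let ?y = "x v* (P ** matrix_power K l)"
  have "x v* (P ** matrix_power K (Suc l)) = ?y v* (P ** K)"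
    by (simp add: vector_matrix_mul_assoc matrix_mul_assoc PK)
  also have "norm \<dots> \<le> z * norm (?y v* P)" by (rule bound)
  also have "?y v* P = ?y" by (simp add: vector_matrix_mul_assoc PK)
  also have "z * norm ?y \<le> z * (z ^ l * norm (x v* P))"
    by (intro mult_left_mono Suc.IH z)
  finally show ?case by (simp add: mult.assoc)
qed simp

context orthogonal_noise
begin

text \<open>The two instances are \<open>P = I - V\<close>, \<open>K = 0\<close>, \<open>z = 0\<close>, \<open>R = \<tau>\<close> for the deviation within the
  clusters and \<open>P = V - J\<close>, \<open>K = Z\<close>, \<open>z = \<zeta>\<^sup>\<pi>\<close>, \<open>R = q\<tau>\<close> for the deviation between
  them. The exponent \<open>t div R - s div R\<close> counts the mixing steps between the times \<open>s\<close>
  and \<open>t\<close>.\<close>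

lemma expectation_recursion_sum:
  fixes Y Gr :: "nat \<Rightarrow> 'w \<Rightarrow> real^'n^'d" and P K :: "real^'n^'n"
  assumes R: "0 < R" and z: "0 \<le> z" "z < 1"
    and P: "P ** P = P" and comm: "P ** K = K ** P"
    and bound: "\<And>x. norm (x v* (P ** K)) \<le> z * norm (x v* P)"
    and Y0: "\<And>\<omega>. Y 0 \<omega> = 0"
    and step: "\<And>t \<omega>. t < T \<Longrightarrow> Y (Suc t) \<omega> =
      (if R dvd Suc t then (Y t \<omega> - \<eta> *\<^sub>R ((Gr t \<omega> + N t \<omega>) ** P)) ** K
       else Y t \<omega> - \<eta> *\<^sub>R ((Gr t \<omega> + N t \<omega>) ** P))"
    and Gr: "\<And>t. t < T \<Longrightarrow> square_integrable M (Gr t)"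
  shows "(\<Sum>t<T. expectation (\<lambda>\<omega>. (norm (Y t \<omega>))\<^sup>2))
    \<le> 2 * \<eta>\<^sup>2 * (real T * real R * \<sigma>\<^sup>2 * (norm P)\<^sup>2 / (1 - z\<^sup>2))
      + 2 * \<eta>\<^sup>2 * (block_kernel R z * (\<Sum>s<T. expectation (\<lambda>\<omega>. (norm (Gr s \<omega> ** P))\<^sup>2)))"
proof -
  define \<rho> where "\<rho> s t = t div R - s div R" for s t
  define A where "A t s = P ** matrix_power K (\<rho> s t)" for t s
  define c where "c t = (\<Sum>r<t. z ^ \<rho> r t)" for t
  define a where "a s = expectation (\<lambda>\<omega>. (norm (Gr s \<omega> ** P))\<^sup>2)" for s
  have bl: "bounded_linear (\<lambda>X::real^'n^'d. X ** B)" for B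
    by (rule bounded_linear_matrix_mult_left)
  have norm_A: "norm (X ** A t s) \<le> z ^ \<rho> s t * norm (X ** P)" for X :: "real^'n^'e::finite" and t s
    unfolding A_def
    by (rule norm_matrix_mult_le) (use projected_power_contraction[OF P comm bound z(1)] z in auto)
  have c0: "0 \<le> c t" for t unfolding c_def by (intro sum_nonneg) (use z in auto)
  have a0: "0 \<le> a s" for s unfolding a_def by simp
  have z2: "0 \<le> z\<^sup>2" "z\<^sup>2 < 1" using z by (auto simp: power_less_one_iff abs_square_less_1)
  have sq_Gr: "square_integrable M (\<lambda>\<omega>. Gr s \<omega> ** B)" if "s < T" for s B
    by (rule square_integrable_bounded_linear[OF bl Gr[OF that]])
  have sq_N: "square_integrable M (\<lambda>\<omega>. N s \<omega> ** B)" if "s < T" for s B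
    by (rule square_integrable_bounded_linear[OF bl noise_square_integrable[OF that]])
  have Y_bound: "expectation (\<lambda>\<omega>. (norm (Y t \<omega>))\<^sup>2) \<le>
     2 * \<eta>\<^sup>2 * (\<sigma>\<^sup>2 * (norm P)\<^sup>2 * (real R / (1 - z\<^sup>2))) + 2 * \<eta>\<^sup>2 * (c t * (\<Sum>s<t. z ^ \<rho> s t * a s))"
    if t: "t < T" for t
  proof -
    have Y: "Y t \<omega> = - \<eta> *\<^sub>R (\<Sum>s<t. (Gr s \<omega> + N s \<omega>) ** A t s)" for \<omega>
      unfolding A_def \<rho>_def using t
      by (intro unroll_recursion[OF R, of "\<lambda>t. Y t \<omega>" T \<eta> "\<lambda>t. Gr t \<omega> + N t \<omega>"]) (auto simp: Y0 step)
    have Gr_bound: "(norm (\<Sum>s<t. Gr s \<omega> ** A t s))\<^sup>2 \<le> c t * (\<Sum>s<t. z ^ \<rho> s t * (norm (Gr s \<omega> ** P))\<^sup>2)" for \<omega>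
    proof -
      have "norm (\<Sum>s<t. Gr s \<omega> ** A t s) \<le> (\<Sum>s<t. z ^ \<rho> s t * norm (Gr s \<omega> ** P))"
        by (rule order_trans[OF norm_sum]) (intro sum_mono norm_A)
      then have "(norm (\<Sum>s<t. Gr s \<omega> ** A t s))\<^sup>2 \<le> (\<Sum>s<t. z ^ \<rho> s t * norm (Gr s \<omega> ** P))\<^sup>2"
        by (intro power_mono) auto
      also have "\<dots> \<le> c t * (\<Sum>s<t. z ^ \<rho> s t * (norm (Gr s \<omega> ** P))\<^sup>2)"
        unfolding c_def by (rule weighted_sum_power2_le) (use z in auto)
      finally show ?thesis .
    qed
    \<comment> \<open>Later gradients depend on earlier noise, so the two sums need not be
      orthogonal; they are separated at the price of a factor 2.\<close>
    have pw: "(norm (Y t \<omega>))\<^sup>2 \<le> 2 * \<eta>\<^sup>2 * (norm (\<Sum>s<t. N s \<omega> ** A t s))\<^sup>2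
        + 2 * \<eta>\<^sup>2 * (c t * (\<Sum>s<t. z ^ \<rho> s t * (norm (Gr s \<omega> ** P))\<^sup>2))" for \<omega>
    proof -
      have "(norm (Y t \<omega>))\<^sup>2 = \<eta>\<^sup>2 * (norm ((\<Sum>s<t. N s \<omega> ** A t s) + (\<Sum>s<t. Gr s \<omega> ** A t s)))\<^sup>2"
        unfolding Y by (simp add: matrix_add_rdistrib sum.distrib power_mult_distrib add.commute)
      also have "\<dots> \<le> \<eta>\<^sup>2 * (2 * (norm (\<Sum>s<t. N s \<omega> ** A t s))\<^sup>2 + 2 * (norm (\<Sum>s<t. Gr s \<omega> ** A t s))\<^sup>2)"
        by (intro mult_left_mono norm_add_power2_le) auto
      also have "\<dots> \<le> \<eta>\<^sup>2 * (2 * (norm (\<Sum>s<t. N s \<omega> ** A t s))\<^sup>2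
          + 2 * (c t * (\<Sum>s<t. z ^ \<rho> s t * (norm (Gr s \<omega> ** P))\<^sup>2)))"
        using Gr_bound by (intro mult_left_mono add_mono order_refl) auto
      finally show ?thesis by (simp add: algebra_simps)
    qed
    have int1: "integrable M (\<lambda>\<omega>. (norm (\<Sum>s<t. N s \<omega> ** A t s))\<^sup>2)"
      using t by (intro square_integrable_norm_sq square_integrable_sum sq_N) auto
    have int2: "integrable M (\<lambda>\<omega>. (norm (Gr s \<omega> ** P))\<^sup>2)" if "s < t" for s
      using t that by (intro square_integrable_norm_sq sq_Gr) auto
    have "expectation (\<lambda>\<omega>. (norm (Y t \<omega>))\<^sup>2) \<le> expectation (\<lambda>\<omega>. 2 * \<eta>\<^sup>2 * (norm (\<Sum>s<t. N s \<omega> ** A t s))\<^sup>2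
        + 2 * \<eta>\<^sup>2 * (c t * (\<Sum>s<t. z ^ \<rho> s t * (norm (Gr s \<omega> ** P))\<^sup>2)))"
    proof (rule integral_mono_AE')
      show "integrable M (\<lambda>\<omega>. 2 * \<eta>\<^sup>2 * (norm (\<Sum>s<t. N s \<omega> ** A t s))\<^sup>2
        + 2 * \<eta>\<^sup>2 * (c t * (\<Sum>s<t. z ^ \<rho> s t * (norm (Gr s \<omega> ** P))\<^sup>2)))"
        using int1 int2 by (intro Bochner_Integration.integrable_add integrable_mult_right
            Bochner_Integration.integrable_sum) auto
    qed (auto intro!: AE_I2 pw order_trans[OF zero_le_power2 pw])
    also have "\<dots> = 2 * \<eta>\<^sup>2 * expectation (\<lambda>\<omega>. (norm (\<Sum>s<t. N s \<omega> ** A t s))\<^sup>2)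
        + 2 * \<eta>\<^sup>2 * (c t * (\<Sum>s<t. z ^ \<rho> s t * a s))"
    proof -
      have "integrable M (\<lambda>\<omega>. \<Sum>s<t. z ^ \<rho> s t * (norm (Gr s \<omega> ** P))\<^sup>2)"
        using int2 by (intro Bochner_Integration.integrable_sum integrable_mult_right) auto
      moreover have "expectation (\<lambda>\<omega>. \<Sum>s<t. z ^ \<rho> s t * (norm (Gr s \<omega> ** P))\<^sup>2) = (\<Sum>s<t. z ^ \<rho> s t * a s)"
        using int2 by (subst Bochner_Integration.integral_sum) (auto simp: a_def)
      ultimately show ?thesis using int1 by simp
    qed
    also have "expectation (\<lambda>\<omega>. (norm (\<Sum>s<t. N s \<omega> ** A t s))\<^sup>2) \<le> \<sigma>\<^sup>2 * (\<Sum>s<t. (norm (A t s))\<^sup>2)"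
      using t by (intro expectation_noise_sum) simp
    also have "(\<Sum>s<t. (norm (A t s))\<^sup>2) \<le> (\<Sum>s<t. (norm P)\<^sup>2 * (z\<^sup>2) ^ \<rho> s t)"
    proof (rule sum_mono)
      fix s
      have "norm (A t s) \<le> z ^ \<rho> s t * norm P" using norm_A[of "mat 1" t s] by simp
      then have "(norm (A t s))\<^sup>2 \<le> (z ^ \<rho> s t * norm P)\<^sup>2" by (intro power_mono) auto
      then show "(norm (A t s))\<^sup>2 \<le> (norm P)\<^sup>2 * (z\<^sup>2) ^ \<rho> s t"
        by (simp add: power_mult_distrib power_mult[symmetric] mult.commute)
    qed
    also have "\<dots> = (norm P)\<^sup>2 * (\<Sum>s<t. (z\<^sup>2) ^ \<rho> s t)" by (simp add: sum_distrib_left)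
    \<comment> \<open>Squared norms of the noise coefficients carry squared weights, hence 1 - z^2
      here against 1 - z in the gradient part.\<close>
    also have "(\<Sum>s<t. (z\<^sup>2) ^ \<rho> s t) \<le> real R / (1 - z\<^sup>2)"
      unfolding \<rho>_def by (rule geometric_block_sum_past_const[OF z2 R])
    finally show ?thesis
      by (simp add: mult_left_mono mult.assoc)
  qed
  \<comment> \<open>Exchanging the sums collects, for each time \<open>s\<close>, all the weight
    that its gradient has in later deviations; the kernel bound then holds for every
    \<open>s\<close> alike.\<close>
  have "(\<Sum>t<T. c t * (\<Sum>s<t. z ^ \<rho> s t * a s)) = (\<Sum>t<T. \<Sum>s<t. a s * (z ^ \<rho> s t * c t))"
    by (simp add: sum_distrib_left ac_simps)
  also have "\<dots> = (\<Sum>s<T. \<Sum>t\<in>{s<..<T}. a s * (z ^ \<rho> s t * c t))"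
  proof -
    have "(\<Sum>t<T. \<Sum>s\<in>{s\<in>{..<T}. s < t}. a s * (z ^ \<rho> s t * c t)) =
      (\<Sum>s<T. \<Sum>t\<in>{t\<in>{..<T}. s < t}. a s * (z ^ \<rho> s t * c t))"
      by (rule sum.swap_restrict) auto
    moreover have "{s\<in>{..<T}. s < t} = {..<t}" if "t < T" for t using that by auto
    moreover have "{t\<in>{..<T}. s < t} = {s<..<T}" for s by auto
    ultimately show ?thesis by simp
  qed
  also have "\<dots> = (\<Sum>s<T. a s * (\<Sum>t\<in>{s<..<T}. z ^ \<rho> s t * c t))"
    by (simp add: sum_distrib_left)
  also have "\<dots> \<le> (\<Sum>s<T. a s * block_kernel R z)"
    unfolding c_def \<rho>_def by (intro sum_mono mult_left_mono geometric_block_sum_kernel z R a0)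
  finally have kernel: "(\<Sum>t<T. c t * (\<Sum>s<t. z ^ \<rho> s t * a s)) \<le> block_kernel R z * (\<Sum>s<T. a s)"
    by (simp add: sum_distrib_left mult.commute)
  have "(\<Sum>t<T. expectation (\<lambda>\<omega>. (norm (Y t \<omega>))\<^sup>2)) \<le>
    (\<Sum>t<T. 2 * \<eta>\<^sup>2 * (\<sigma>\<^sup>2 * (norm P)\<^sup>2 * (real R / (1 - z\<^sup>2))) + 2 * \<eta>\<^sup>2 * (c t * (\<Sum>s<t. z ^ \<rho> s t * a s)))"
    by (intro sum_mono Y_bound) auto
  also have "\<dots> = 2 * \<eta>\<^sup>2 * (real T * real R * \<sigma>\<^sup>2 * (norm P)\<^sup>2 / (1 - z\<^sup>2))
      + 2 * \<eta>\<^sup>2 * (\<Sum>t<T. c t * (\<Sum>s<t. z ^ \<rho> s t * a s))"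
    by (simp add: sum.distrib sum_distrib_left)
  also have "\<dots> \<le> 2 * \<eta>\<^sup>2 * (real T * real R * \<sigma>\<^sup>2 * (norm P)\<^sup>2 / (1 - z\<^sup>2))
      + 2 * \<eta>\<^sup>2 * (block_kernel R z * (\<Sum>s<T. a s))"
    using kernel by (intro add_mono mult_left_mono order_refl) auto
  finally show ?thesis by (simp add: a_def)
qed

end

section \<open>Mini-batch sampling\<close>

context prob_space
begin

text \<open>Conditioning is replaced by Fubini: \<open>ind\<close> says that past and fresh sample
  have a product law, and integrating over the fresh sample first, with the past \<open>p\<close>
  frozen, gives the inner product of \<open>h p\<close> with 0.\<close>

lemma expectation_inner_unbiased:
  fixes h :: "'p \<Rightarrow> 'v::euclidean_space" and \<nu> :: "'p \<Rightarrow> 'b \<Rightarrow> 'v"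
  assumes P [measurable]: "P \<in> measurable M S" and \<phi> [measurable]: "\<phi> \<in> measurable M D"
    and ind: "distr M (S \<Otimes>\<^sub>M D) (\<lambda>\<omega>. (P \<omega>, \<phi> \<omega>)) = distr M S P \<Otimes>\<^sub>M D"
    and D: "prob_space D"
    and h [measurable]: "h \<in> borel_measurable S"
    and \<nu> [measurable]: "(\<lambda>(p, b). \<nu> p b) \<in> borel_measurable (S \<Otimes>\<^sub>M D)"
    and unbiased: "\<And>p. integrable D (\<nu> p)" "\<And>p. (\<integral>b. \<nu> p b \<partial>D) = 0"
    and int: "integrable M (\<lambda>\<omega>. h (P \<omega>) \<bullet> \<nu> (P \<omega>) (\<phi> \<omega>))"
  shows "expectation (\<lambda>\<omega>. h (P \<omega>) \<bullet> \<nu> (P \<omega>) (\<phi> \<omega>)) = 0"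
proof -
  interpret Q: prob_space "distr M S P" by (rule prob_space_distr) simp
  interpret D: prob_space D by (rule D)
  interpret pair_sigma_finite "distr M S P" D ..
  have meas: "(\<lambda>(p, b). h p \<bullet> \<nu> p b) \<in> borel_measurable (S \<Otimes>\<^sub>M D)" by measurable
  have "integrable (distr M (S \<Otimes>\<^sub>M D) (\<lambda>\<omega>. (P \<omega>, \<phi> \<omega>))) (\<lambda>(p, b). h p \<bullet> \<nu> p b)"
    using int meas by (subst integrable_distr_eq) auto
  then have int': "integrable (distr M S P \<Otimes>\<^sub>M D) (\<lambda>(p, b). h p \<bullet> \<nu> p b)"
    unfolding ind .
  have "expectation (\<lambda>\<omega>. h (P \<omega>) \<bullet> \<nu> (P \<omega>) (\<phi> \<omega>)) =
      (\<integral>x. (case x of (p, b) \<Rightarrow> h p \<bullet> \<nu> p b) \<partial>distr M (S \<Otimes>\<^sub>M D) (\<lambda>\<omega>. (P \<omega>, \<phi> \<omega>)))"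
    using meas by (subst integral_distr) auto
  also have "\<dots> = (\<integral>p. (\<integral>b. h p \<bullet> \<nu> p b \<partial>D) \<partial>distr M S P)"
    unfolding ind by (rule integral_fst[OF int', symmetric])
  also have "\<dots> = 0" using unbiased by simp
  finally show ?thesis .
qed

text \<open>Integrability along the random past is itself a claim, so the computation runs through
  nonnegative integrals and Tonelli; the resulting finite bound \<open>V\<close> then yields both
  conclusions.\<close>

lemma expectation_variance_indep:
  fixes \<nu> :: "'p \<Rightarrow> 'b \<Rightarrow> 'v::euclidean_space"
  assumes P [measurable]: "P \<in> measurable M S" and \<phi> [measurable]: "\<phi> \<in> measurable M D"
    and ind: "distr M (S \<Otimes>\<^sub>M D) (\<lambda>\<omega>. (P \<omega>, \<phi> \<omega>)) = distr M S P \<Otimes>\<^sub>M D"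
    and D: "prob_space D"
    and \<nu> [measurable]: "(\<lambda>(p, b). \<nu> p b) \<in> borel_measurable (S \<Otimes>\<^sub>M D)"
    and var: "\<And>p. integrable D (\<lambda>b. (norm (\<nu> p b))\<^sup>2)" "\<And>p. (\<integral>b. (norm (\<nu> p b))\<^sup>2 \<partial>D) \<le> V"
  shows "square_integrable M (\<lambda>\<omega>. \<nu> (P \<omega>) (\<phi> \<omega>))"
    and "expectation (\<lambda>\<omega>. (norm (\<nu> (P \<omega>) (\<phi> \<omega>)))\<^sup>2) \<le> V"
proof -
  interpret Q: prob_space "distr M S P" by (rule prob_space_distr) simp
  interpret D: prob_space D by (rule D)
  interpret pair_sigma_finite "distr M S P" D ..
  have V: "0 \<le> V" using var(2) by (rule order_trans[rotated]) simp
  have meas: "(\<lambda>(p, b). ennreal ((norm (\<nu> p b))\<^sup>2)) \<in> borel_measurable (S \<Otimes>\<^sub>M D)" by measurable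
  have meas': "(\<lambda>\<omega>. \<nu> (P \<omega>) (\<phi> \<omega>)) \<in> borel_measurable M" by measurable
  have "(\<integral>\<^sup>+\<omega>. ennreal ((norm (\<nu> (P \<omega>) (\<phi> \<omega>)))\<^sup>2) \<partial>M) =
      (\<integral>\<^sup>+x. (case x of (p, b) \<Rightarrow> ennreal ((norm (\<nu> p b))\<^sup>2)) \<partial>distr M (S \<Otimes>\<^sub>M D) (\<lambda>\<omega>. (P \<omega>, \<phi> \<omega>)))"
    using meas by (subst nn_integral_distr) auto
  also have "\<dots> = (\<integral>\<^sup>+p. \<integral>\<^sup>+b. ennreal ((norm (\<nu> p b))\<^sup>2) \<partial>D \<partial>distr M S P)"
    unfolding ind using meas by (subst D.nn_integral_fst[symmetric]) auto
  also have "\<dots> \<le> (\<integral>\<^sup>+p. ennreal V \<partial>distr M S P)"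
    by (intro nn_integral_mono) (auto simp: nn_integral_eq_integral var intro!: ennreal_leI)
  also have "\<dots> = ennreal V" using Q.emeasure_space_1 by simp
  finally have le: "(\<integral>\<^sup>+\<omega>. ennreal ((norm (\<nu> (P \<omega>) (\<phi> \<omega>)))\<^sup>2) \<partial>M) \<le> ennreal V" .
  have "integrable M (\<lambda>\<omega>. (norm (\<nu> (P \<omega>) (\<phi> \<omega>)))\<^sup>2)"
    using meas' le by (intro integrableI_nonneg) (auto simp: le_less_trans)
  then show "square_integrable M (\<lambda>\<omega>. \<nu> (P \<omega>) (\<phi> \<omega>))"
    using meas' by (simp add: square_integrable_def)
  show "expectation (\<lambda>\<omega>. (norm (\<nu> (P \<omega>) (\<phi> \<omega>)))\<^sup>2) \<le> V"
    using le V meas' by (subst integral_eq_nn_integral) (auto intro: enn2real_leI)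
qed

end

lemma borel_measurable_matrix:
  fixes f :: "'w \<Rightarrow> real^'n^'d"
  assumes "\<And>k. (\<lambda>\<omega>. column k (f \<omega>)) \<in> borel_measurable M"
  shows "f \<in> borel_measurable M"
proof -
  have "(\<lambda>\<omega>. f \<omega> \<bullet> i) \<in> borel_measurable M" if "i \<in> Basis" for i
  proof -
    from that obtain r k where i: "i = axis r (axis k 1)" by (auto simp: Basis_vec_def)
    have "(\<lambda>\<omega>. column k (f \<omega>) \<bullet> axis r 1) \<in> borel_measurable M" using assms by simp
    then show ?thesis by (simp add: i inner_axis column_def)
  qed
  then show ?thesis by (subst borel_measurable_euclidean_space) blast
qed

lemma square_integrable_matrix:
  fixes f :: "'w \<Rightarrow> real^'n^'d"
  assumes "\<And>k. square_integrable M (\<lambda>\<omega>. column k (f \<omega>))"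
  shows "square_integrable M f"
  using assms by (auto simp: square_integrable_def norm_matrix_columns intro: borel_measurable_matrix)

definition columnwise :: "('n \<Rightarrow> real^'d \<Rightarrow> real^'d) \<Rightarrow> real^'n^'d \<Rightarrow> real^'n^'d" where
  "columnwise h X = (\<chi> r k. h k (column k X) $ r)"

lemma column_columnwise: "column k (columnwise h X) = h k (column k X)"
  by (simp add: columnwise_def column_def)

lemma column_G_matrix: "column k (G_matrix g \<xi> X) = g k (\<xi> k) (column k X)"
  by (simp add: G_matrix_def column_def)

lemma ce_fedavg_cong:
  assumes "\<And>s k. s < t \<Longrightarrow> \<xi> s k = \<xi>' s k"
  shows "ce_fedavg S H \<pi> q \<tau> \<eta> g x1 \<xi> t = ce_fedavg S H \<pi> q \<tau> \<eta> g x1 \<xi>' t"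
  using assms by (induction t) (auto simp: G_matrix_def)

section \<open>Iterates and noise as functions of independent mini-batches\<close>

locale ce_fedavg_sampling = prob_space M for M :: "'w measure" +
  fixes S :: "'m::finite \<Rightarrow> 'n::finite set" and H :: "real^'m^'m" and \<pi> q \<tau> T :: nat and \<eta> L \<sigma> :: real
    and D :: "'n \<Rightarrow> 'b measure" and g :: "'n \<Rightarrow> 'b \<Rightarrow> real^'d \<Rightarrow> real^'d" and x1 :: "real^'d"
    and \<theta> :: "nat \<Rightarrow> 'n \<Rightarrow> 'w \<Rightarrow> 'b" and gr :: "'n \<Rightarrow> real^'d \<Rightarrow> real^'d"
  assumes indep: "indep_vars (\<lambda>(t, k). D k) (\<lambda>(t, k). \<theta> t k) ({..<T} \<times> UNIV)"
    and distr: "\<And>t k. t < T \<Longrightarrow> distr M (D k) (\<theta> t k) = D k"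
    and g_measurable: "\<And>k. (\<lambda>(b, x). g k b x) \<in> borel_measurable (D k \<Otimes>\<^sub>M borel)"
    and gr_lipschitz: "\<And>k x y. norm (gr k x - gr k y) \<le> L * norm (x - y)"
    and g_integrable: "\<And>k x. integrable (D k) (\<lambda>b. g k b x)"
    and g_unbiased: "\<And>k x. (LINT b|D k. g k b x) = gr k x"
    and g_sq_integrable: "\<And>k x. integrable (D k) (\<lambda>b. (norm (g k b x - gr k x))\<^sup>2)"
    and g_variance: "\<And>k x. (LINT b|D k. (norm (g k b x - gr k x))\<^sup>2) \<le> \<sigma>\<^sup>2"
begin

abbreviation iterate :: "(nat \<times> 'n \<Rightarrow> 'b) \<Rightarrow> nat \<Rightarrow> real^'n^'d" where
  "iterate \<xi> t \<equiv> ce_fedavg S H \<pi> q \<tau> \<eta> g x1 (\<lambda>s k. \<xi> (s, k)) t"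

definition X :: "nat \<Rightarrow> 'w \<Rightarrow> real^'n^'d" where
  "X t \<omega> = ce_fedavg S H \<pi> q \<tau> \<eta> g x1 (\<lambda>s k. \<theta> s k \<omega>) t"

definition Gr :: "nat \<Rightarrow> 'w \<Rightarrow> real^'n^'d" where
  "Gr t \<omega> = columnwise gr (X t \<omega>)"

definition N :: "nat \<Rightarrow> 'w \<Rightarrow> real^'n^'d" where
  "N t \<omega> = G_matrix g (\<lambda>k. \<theta> t k \<omega>) (X t \<omega>) - Gr t \<omega>"

abbreviation sample_space :: "(nat \<times> 'n) set \<Rightarrow> (nat \<times> 'n \<Rightarrow> 'b) measure" where
  "sample_space J \<equiv> PiM J (\<lambda>(t, k). D k)"

text \<open>The restriction makes the values extensional, as elements of the product space
  \<open>sample_space J\<close> have to be.\<close>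

definition sample :: "(nat \<times> 'n) set \<Rightarrow> 'w \<Rightarrow> nat \<times> 'n \<Rightarrow> 'b" where
  "sample J \<omega> = restrict (\<lambda>(t, k). \<theta> t k \<omega>) J"

text \<open>All mini-batches up to time \<open>t\<close> except that of device \<open>k\<close> at time \<open>t\<close>: it determines
  the state at time \<open>t\<close> and the noise of every other device at that time.\<close>

definition history :: "nat \<Rightarrow> 'n \<Rightarrow> (nat \<times> 'n) set" where
  "history t k = {..t} \<times> UNIV - {(t, k)}"

lemma X_Suc: "X (Suc t) \<omega> = (X t \<omega> - \<eta> *\<^sub>R (Gr t \<omega> + N t \<omega>)) ** W_matrix S H \<pi> q \<tau> t"
  by (simp add: X_def N_def)

lemma column_N: "column k (N t \<omega>) = g k (\<theta> t k \<omega>) (column k (X t \<omega>)) - gr k (column k (X t \<omega>))"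
  by (simp add: N_def Gr_def bounded_linear.linear[OF bounded_linear_column, THEN linear_diff]
      column_columnwise column_G_matrix)

lemma gr_measurable [measurable]: "gr k \<in> borel_measurable borel"
  by (rule borel_measurable_lipschitz[OF gr_lipschitz])

lemma sample_component [measurable]: "(s, k) \<in> J \<Longrightarrow> (\<lambda>\<xi>. \<xi> (s, k)) \<in> measurable (sample_space J) (D k)"
  using measurable_component_singleton[of "(s, k)" J "\<lambda>(t, k). D k"] by simp

lemma column_measurable:
  "(\<lambda>\<omega>. f \<omega>) \<in> borel_measurable A \<Longrightarrow> (\<lambda>\<omega>. column k (f \<omega> :: real^'j^'i)) \<in> borel_measurable A"
  by (rule measurable_compose[OF _ borel_measurable_continuous_onI])
    (auto intro: linear_continuous_on bounded_linear_column)

lemma g_compose_measurable: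
  assumes "b \<in> measurable A (D k)" "x \<in> borel_measurable A"
  shows "(\<lambda>\<omega>. g k (b \<omega>) (x \<omega>)) \<in> borel_measurable A"
  using measurable_compose[OF measurable_Pair[OF assms] g_measurable[of k]] by simp

lemma iterate_measurable:
  assumes "{..<t} \<times> UNIV \<subseteq> J"
  shows "(\<lambda>\<xi>. iterate \<xi> t) \<in> borel_measurable (sample_space J)"
  using assms
proof (induction t)
  case (Suc t)
  have "{..<t} \<times> UNIV \<subseteq> J" using Suc.prems by (auto simp: lessThan_Suc)
  then have IH [measurable]: "(\<lambda>\<xi>. iterate \<xi> t) \<in> borel_measurable (sample_space J)" by (rule Suc.IH)
  have "(\<lambda>\<xi>. G_matrix g (\<lambda>k. \<xi> (t, k)) (iterate \<xi> t)) \<in> borel_measurable (sample_space J)"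
  proof (rule borel_measurable_matrix, unfold column_G_matrix)
    fix k
    show "(\<lambda>\<xi>. g k (\<xi> (t, k)) (column k (iterate \<xi> t))) \<in> borel_measurable (sample_space J)"
      using Suc.prems by (intro g_compose_measurable sample_component column_measurable IH) auto
  qed
  then have "(\<lambda>\<xi>. iterate \<xi> t - \<eta> *\<^sub>R G_matrix g (\<lambda>k. \<xi> (t, k)) (iterate \<xi> t)) \<in> borel_measurable (sample_space J)"
    by measurable
  then show ?case
    by simp (erule measurable_compose[OF _ borel_measurable_continuous_onI],
      intro linear_continuous_on bounded_linear_matrix_mult_left)
qed simp

lemma X_eq_iterate:
  assumes "{..<t} \<times> UNIV \<subseteq> J"
  shows "X t \<omega> = iterate (sample J \<omega>) t"
  unfolding X_def by (rule ce_fedavg_cong) (use assms in \<open>auto simp: sample_def\<close>)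

lemma \<theta>_measurable: "t < T \<Longrightarrow> \<theta> t k \<in> measurable M (D k)"
  using indep by (auto simp: indep_vars_def)

lemma prob_space_D: "t < T \<Longrightarrow> prob_space (D k)"
  using prob_space_distr[OF \<theta>_measurable[of t k]] distr[of t k] by simp

lemma sample_measurable:
  assumes "J \<subseteq> {..<T} \<times> UNIV"
  shows "sample J \<in> measurable M (sample_space J)"
  unfolding sample_def[abs_def] using assms
  by (intro measurable_restrict) (auto intro: \<theta>_measurable)

text \<open>Families indexed by the disjoint sets \<open>history t k\<close> and
  \<open>{(t, k)}\<close> are independent, so their joint law is a product. Projecting the
  one-element product space to its only component turns the second factor into
  \<open>D k\<close>.\<close>

lemma history_indep:
  assumes t: "t < T"
  shows "distr M (sample_space (history t k) \<Otimes>\<^sub>M D k) (\<lambda>\<omega>. (sample (history t k) \<omega>, \<theta> t k \<omega>)) =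
    distr M (sample_space (history t k)) (sample (history t k)) \<Otimes>\<^sub>M D k"
proof -
  let ?S = "sample_space (history t k)" and ?S' = "sample_space {(t, k)}"
  let ?P = "sample (history t k)" and ?P' = "sample {(t, k)}" and ?c = "\<lambda>\<xi>. \<xi> (t, k)"
  have [measurable]: "?P \<in> measurable M ?S" "?P' \<in> measurable M ?S'" "?c \<in> measurable ?S' (D k)"
    using t by (auto intro!: sample_measurable sample_component simp: history_def)
  have eq: "(\<lambda>\<omega>. restrict (\<lambda>i. (case i of (t, k) \<Rightarrow> \<theta> t k) \<omega>) J) = sample J" for J
    by (auto simp: fun_eq_iff sample_def restrict_def split: prod.splits)
  have c: "?c \<circ> ?P' = \<theta> t k" by (auto simp: sample_def)
  have "indep_var ?S (\<lambda>\<omega>. restrict (\<lambda>i. (case i of (t, k) \<Rightarrow> \<theta> t k) \<omega>) (history t k))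
     ?S' (\<lambda>\<omega>. restrict (\<lambda>i. (case i of (t, k) \<Rightarrow> \<theta> t k) \<omega>) {(t, k)})"
    by (rule indep_var_restrict[OF indep]) (use t in \<open>auto simp: history_def\<close>)
  then have pair: "distr M ?S ?P \<Otimes>\<^sub>M distr M ?S' ?P' = distr M (?S \<Otimes>\<^sub>M ?S') (\<lambda>\<omega>. (?P \<omega>, ?P' \<omega>))"
    unfolding eq indep_var_distribution_eq by simp
  have D: "distr (distr M ?S' ?P') (D k) ?c = D k"
    using distr[OF t, of k] by (subst distr_distr) (auto simp: c)
  interpret D: prob_space "D k" by (rule prob_space_D[OF t])
  \<comment> \<open>Writing the first factor as its own image under the identity allows the product
    to be pushed forward in the second factor alone.\<close>
  have "distr M ?S ?P \<Otimes>\<^sub>M D k = distr (distr M ?S ?P) ?S (\<lambda>x. x) \<Otimes>\<^sub>M distr (distr M ?S' ?P') (D k) ?c"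
    unfolding D by (simp add: distr_id2)
  also have "\<dots> = distr (distr M ?S ?P \<Otimes>\<^sub>M distr M ?S' ?P') (?S \<Otimes>\<^sub>M D k) (\<lambda>(x, y). (x, ?c y))"
    by (rule pair_measure_distr) (auto simp: D intro: D.sigma_finite_measure_axioms)
  also have "\<dots> = distr M (?S \<Otimes>\<^sub>M D k) (\<lambda>\<omega>. (?P \<omega>, \<theta> t k \<omega>))"
    unfolding pair by (subst distr_distr) (auto simp: comp_def c[unfolded comp_def, THEN fun_cong])
  finally show ?thesis by simp
qed

lemma history_subset: "{..<t} \<times> UNIV \<subseteq> history t k"
  by (auto simp: history_def)

text \<open>The noise as a function of a frozen past and one fresh mini-batch, the form in which the
  Fubini arguments apply.\<close>

definition noise_of :: "nat \<Rightarrow> 'n \<Rightarrow> (nat \<times> 'n \<Rightarrow> 'b) \<Rightarrow> 'b \<Rightarrow> real^'d" where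
  "noise_of t k \<xi> b = g k b (column k (iterate \<xi> t)) - gr k (column k (iterate \<xi> t))"

lemma column_N_eq:
  assumes "{..<t} \<times> UNIV \<subseteq> J"
  shows "column k (N t \<omega>) = noise_of t k (sample J \<omega>) (\<theta> t k \<omega>)"
  unfolding column_N noise_of_def X_eq_iterate[OF assms] ..

lemma noise_of_measurable:
  assumes "{..<t} \<times> UNIV \<subseteq> J" and a: "a \<in> measurable A (sample_space J)" and b: "b \<in> measurable A (D k)"
  shows "(\<lambda>x. noise_of t k (a x) (b x)) \<in> borel_measurable A"
proof -
  have "(\<lambda>x. column k (iterate (a x) t)) \<in> borel_measurable A"
    using measurable_compose[OF a column_measurable[OF iterate_measurable[OF assms(1)]]] .
  then show ?thesis
    unfolding noise_of_def
    by (intro borel_measurable_diff g_compose_measurable b measurable_compose[OF _ gr_measurable])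
qed

lemma noise_of_measurable_pair:
  "(\<lambda>(p, b). noise_of t k p b) \<in> borel_measurable (sample_space (history t k) \<Otimes>\<^sub>M D k)"
proof -
  have eq: "(\<lambda>(p, b). noise_of t k p b) = (\<lambda>x. noise_of t k (fst x) (snd x))" by auto
  show ?thesis
    unfolding eq by (intro noise_of_measurable[OF history_subset[of t k]] measurable_fst measurable_snd)
qed

lemma history_measurable: "t < T \<Longrightarrow> sample (history t k) \<in> measurable M (sample_space (history t k))"
  by (rule sample_measurable) (auto simp: history_def)

lemma
  assumes t: "t < T"
  shows column_N_square_integrable: "square_integrable M (\<lambda>\<omega>. column k (N t \<omega>))"
    and column_N_variance: "expectation (\<lambda>\<omega>. (norm (column k (N t \<omega>)))\<^sup>2) \<le> \<sigma>\<^sup>2"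
  using expectation_variance_indep[OF history_measurable[OF t] \<theta>_measurable[OF t] history_indep[OF t]
      prob_space_D[OF t] noise_of_measurable_pair, of k "\<sigma>\<^sup>2"] g_sq_integrable g_variance
  unfolding column_N_eq[OF history_subset[of t k]] by (auto simp: noise_of_def)

lemma N_square_integrable: "t < T \<Longrightarrow> square_integrable M (N t)"
  by (rule square_integrable_matrix) (rule column_N_square_integrable)

text \<open>The mini-batch of device \<open>k\<close> at time \<open>t\<close> is independent of its
  history and the noise has mean 0 for every frozen history. Taking for \<open>h\<close> a function
  of the state removes the cross terms of the descent step; taking another noise column gives
  orthogonality.\<close>

lemma expectation_history_noise:
  assumes t: "t < T" and h: "h \<in> borel_measurable (sample_space (history t k))"
    and sq: "square_integrable M (\<lambda>\<omega>. h (sample (history t k) \<omega>))"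
  shows "expectation (\<lambda>\<omega>. h (sample (history t k) \<omega>) \<bullet> column k (N t \<omega>)) = 0"
proof -
  interpret D: prob_space "D k" by (rule prob_space_D[OF t])
  show ?thesis
    unfolding column_N_eq[OF history_subset[of t k]]
  proof (rule expectation_inner_unbiased[OF history_measurable[OF t] \<theta>_measurable[OF t] history_indep[OF t]
        prob_space_D[OF t] h noise_of_measurable_pair])
    show "integrable (D k) (noise_of t k p)" for p
      unfolding noise_of_def using g_integrable by auto
    show "(\<integral>b. noise_of t k p b \<partial>D k) = 0" for p
      unfolding noise_of_def using g_integrable g_unbiased by (simp add: D.prob_space)
    show "integrable M (\<lambda>\<omega>. h (sample (history t k) \<omega>) \<bullet> noise_of t k (sample (history t k) \<omega>) (\<theta> t k \<omega>))"
      using square_integrable_inner[OF sq column_N_square_integrable[OF t, of k]]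
      unfolding column_N_eq[OF history_subset[of t k]] .
  qed
qed

lemma expectation_state_noise:
  assumes t: "t < T" and h: "h \<in> borel_measurable borel" and sq: "square_integrable M (\<lambda>\<omega>. h (X t \<omega>))"
  shows "expectation (\<lambda>\<omega>. h (X t \<omega>) \<bullet> column k (N t \<omega>)) = 0"
  using expectation_history_noise[OF t, of "\<lambda>\<xi>. h (iterate \<xi> t)" k] sq
    measurable_compose[OF iterate_measurable[OF history_subset] h]
  unfolding X_eq_iterate[OF history_subset[of t k]] by simp

text \<open>The noise of device \<open>k\<close> at time \<open>s\<close> is computed from the
  mini-batches before \<open>s\<close> and its own one, and all of these belong to the history of
  \<open>(t, l)\<close>.\<close>

lemma noise_orthogonal_aux:
  assumes t: "t < T" and s: "(s, k) \<in> history t l"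
  shows "expectation (\<lambda>\<omega>. column k (N s \<omega>) \<bullet> column l (N t \<omega>)) = 0"
proof -
  have sub: "{..<s} \<times> UNIV \<subseteq> history t l" and sT: "s < T"
    using s t by (auto simp: history_def)
  have eq: "column k (N s \<omega>) = noise_of s k (sample (history t l) \<omega>) (sample (history t l) \<omega> (s, k))" for \<omega>
    using s by (simp add: column_N_eq[OF sub] sample_def)
  show ?thesis
    unfolding eq
    by (rule expectation_history_noise[OF t])
      (use column_N_square_integrable[OF sT, of k] s in
        \<open>auto simp: eq intro!: noise_of_measurable[OF sub] sample_component\<close>)
qed

sublocale orthogonal_noise M N T \<sigma>
proof unfold_locales
  fix s t and k l :: 'n assume *: "s < T" "t < T" "(s, k) \<noteq> (t, l)"
  \<comment> \<open>Of two distinct pairs the earlier lies in the history of the later; at equal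
    times each lies in the history of the other.\<close>
  then have "(s, k) \<in> history t l \<or> (t, l) \<in> history s k" by (auto simp: history_def)
  then show "expectation (\<lambda>\<omega>. column k (N s \<omega>) \<bullet> column l (N t \<omega>)) = 0"
    using noise_orthogonal_aux[of t s k l] noise_orthogonal_aux[of s t l k] * by (auto simp: inner_commute)
qed (auto intro: N_square_integrable column_N_variance)

lemma columnwise_square_integrable:
  assumes "square_integrable M f"
  shows "square_integrable M (\<lambda>\<omega>. columnwise gr (f \<omega>))"
  by (rule square_integrable_matrix, unfold column_columnwise)
    (intro square_integrable_lipschitz[OF finite_measure_axioms _ gr_lipschitz]
      square_integrable_bounded_linear[OF bounded_linear_column assms])

lemma X_square_integrable: "t \<le> T \<Longrightarrow> square_integrable M (X t)"
proof (induction t)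
  case 0
  then show ?case by (simp add: X_def[abs_def] square_integrable_def)
next
  case (Suc t)
  then have "square_integrable M (X t)" "t < T" by auto
  then show ?case
    unfolding X_Suc[abs_def] Gr_def
    by (intro square_integrable_bounded_linear[OF bounded_linear_matrix_mult_left] square_integrable_diff
        square_integrable_scaleR square_integrable_add columnwise_square_integrable N_square_integrable)
qed

lemma Gr_square_integrable: "t \<le> T \<Longrightarrow> square_integrable M (Gr t)"
  unfolding Gr_def[abs_def] by (intro columnwise_square_integrable X_square_integrable)

end

section \<open>Descent of the averaged model\<close>

lemma average_model_columns: "average_model X = (1 / real CARD('n)) *\<^sub>R (\<Sum>k\<in>UNIV. column k X)"
  for X :: "real^'n^'d"
  by (simp add: average_model_def matrix_vector_mult_def column_def vec_eq_iff)

lemma bounded_linear_average_model: "bounded_linear (average_model :: real^'n^'d \<Rightarrow> real^'d)"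
  unfolding average_model_columns[abs_def]
  by (intro bounded_linear_const_scaleR bounded_linear_sum bounded_linear_column)

lemma average_model_mult:
  fixes X :: "real^'n^'d" and W :: "real^'n^'n"
  assumes "W *v 1 = 1"
  shows "average_model (X ** W) = average_model X"
  using assms by (simp add: average_model_def matrix_vector_mul_assoc[symmetric])

lemma column_mult_J: "column k (X ** J_matrix) = average_model X" for X :: "real^'n^'d"
  unfolding column_matrix_mult average_model_columns by (simp add: J_matrix_def scaleR_sum_right)

lemma column_diff: "column k (X - Y) = column k X - column k Y" for X Y :: "real^'n^'d"
  using bounded_linear.linear[OF bounded_linear_column] by (rule linear_diff)

lemma norm_average_power2_le:
  fixes v :: "'n::finite \<Rightarrow> 'a::real_normed_vector"
  shows "(norm ((1 / real CARD('n)) *\<^sub>R (\<Sum>k\<in>UNIV. v k)))\<^sup>2 \<le> (1 / real CARD('n)) * (\<Sum>k\<in>UNIV. (norm (v k))\<^sup>2)"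
proof -
  have "norm ((1 / real CARD('n)) *\<^sub>R (\<Sum>k\<in>UNIV. v k)) \<le> (\<Sum>k\<in>UNIV. (1 / real CARD('n)) * norm (v k))"
    unfolding scaleR_sum_right by (rule order_trans[OF norm_sum]) simp
  then have "(norm ((1 / real CARD('n)) *\<^sub>R (\<Sum>k\<in>UNIV. v k)))\<^sup>2 \<le> (\<Sum>k\<in>UNIV. (1 / real CARD('n)) * norm (v k))\<^sup>2"
    by (intro power_mono) auto
  also have "\<dots> \<le> (\<Sum>k\<in>(UNIV::'n set). 1 / real CARD('n)) * (\<Sum>k\<in>UNIV. (1 / real CARD('n)) * (norm (v k))\<^sup>2)"
    by (rule weighted_sum_power2_le) simp
  finally show ?thesis by (simp add: sum_distrib_left)
qed

text \<open>Smoothness along the step and polarisation, 2 (a . b) = |a|^2 + |b|^2 - |a - b|^2, trade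
  the inner product with the inexact gradient \<open>h\<close> for its error. What remains of |h|^2
  has the factor -(1 - \<eta> L) \<eta> / 2 and is dropped. The noise is kept linear in two terms
  because these vanish in expectation.\<close>

lemma descent_step_pathwise:
  fixes f :: "'a::euclidean_space \<Rightarrow> real"
  assumes deriv: "\<And>x. GDERIV f x :> g x"
    and lip: "\<And>x y. norm (g x - g y) \<le> L * norm (x - y)"
    and eta: "0 \<le> \<eta>" "\<eta> * L \<le> 1"
  shows "f (u - \<eta> *\<^sub>R (h + \<nu>)) \<le> f u - \<eta> / 2 * (norm (g u))\<^sup>2 + \<eta> / 2 * (norm (g u - h))\<^sup>2
    - \<eta> * (g u \<bullet> \<nu>) + L * \<eta>\<^sup>2 * (h \<bullet> \<nu>) + L * \<eta>\<^sup>2 / 2 * (norm \<nu>)\<^sup>2"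
proof -
  have "f (u - \<eta> *\<^sub>R (h + \<nu>)) \<le> f u + g u \<bullet> (- \<eta> *\<^sub>R (h + \<nu>)) + L / 2 * (norm (- \<eta> *\<^sub>R (h + \<nu>)))\<^sup>2"
    using smooth_upper_bound[OF deriv lip, of "u - \<eta> *\<^sub>R (h + \<nu>)" u] by simp
  also have "(norm (- \<eta> *\<^sub>R (h + \<nu>)))\<^sup>2 = \<eta>\<^sup>2 * ((norm h)\<^sup>2 + 2 * (h \<bullet> \<nu>) + (norm \<nu>)\<^sup>2)"
    unfolding power2_norm_eq_inner by (simp add: inner_add inner_commute power2_eq_square algebra_simps)
  also have "g u \<bullet> (- \<eta> *\<^sub>R (h + \<nu>)) = - \<eta> * (g u \<bullet> \<nu>) - \<eta> / 2 * ((norm (g u))\<^sup>2 + (norm h)\<^sup>2 - (norm (g u - h))\<^sup>2)"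
    unfolding power2_norm_eq_inner by (simp add: inner_add inner_diff inner_commute algebra_simps)
  finally have "f (u - \<eta> *\<^sub>R (h + \<nu>)) \<le> f u - \<eta> / 2 * (norm (g u))\<^sup>2 + \<eta> / 2 * (norm (g u - h))\<^sup>2
    - \<eta> * (g u \<bullet> \<nu>) + L * \<eta>\<^sup>2 * (h \<bullet> \<nu>) + L * \<eta>\<^sup>2 / 2 * (norm \<nu>)\<^sup>2
    - \<eta> / 2 * (1 - \<eta> * L) * (norm h)\<^sup>2"
    by (simp add: algebra_simps power2_eq_square add_divide_distrib diff_divide_distrib)
  moreover have "0 \<le> \<eta> / 2 * (1 - \<eta> * L) * (norm h)\<^sup>2" using eta by simp
  ultimately show ?thesis by linarith
qed

context ce_fedavg_sampling
begin

definition U :: "nat \<Rightarrow> 'w \<Rightarrow> real^'d" where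
  "U t \<omega> = average_model (X t \<omega>)"

definition gF :: "real^'d \<Rightarrow> real^'d" where
  "gF x = (1 / real CARD('n)) *\<^sub>R (\<Sum>k\<in>UNIV. gr k x)"

lemma gF_lipschitz: "norm (gF x - gF y) \<le> L * norm (x - y)"
proof -
  have "norm (gF x - gF y) \<le> (\<Sum>k\<in>(UNIV::'n set). (1 / real CARD('n)) * norm (gr k x - gr k y))"
    unfolding gF_def scaleR_right_diff_distrib[symmetric] sum_subtractf[symmetric] scaleR_sum_right
    by (rule order_trans[OF norm_sum]) simp
  also have "\<dots> \<le> (\<Sum>k\<in>(UNIV::'n set). (1 / real CARD('n)) * (L * norm (x - y)))"
    by (intro sum_mono mult_left_mono gr_lipschitz) auto
  finally show ?thesis by simp
qed

lemma gF_measurable [measurable]: "gF \<in> borel_measurable borel"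
  unfolding gF_def[abs_def] by measurable

lemma average_model_measurable [measurable]: "(average_model :: real^'n^'d \<Rightarrow> real^'d) \<in> borel_measurable borel"
  by (intro borel_measurable_continuous_onI linear_continuous_on bounded_linear_average_model)

lemma U_square_integrable: "t \<le> T \<Longrightarrow> square_integrable M (U t)"
  unfolding U_def[abs_def]
  by (intro square_integrable_bounded_linear[OF bounded_linear_average_model] X_square_integrable)

lemma gF_U_square_integrable: "t \<le> T \<Longrightarrow> square_integrable M (\<lambda>\<omega>. gF (U t \<omega>))"
  by (intro square_integrable_lipschitz[OF finite_measure_axioms _ gF_lipschitz] U_square_integrable)

text \<open>Mixing does not move the average since the mixing matrix fixes the all-ones vector; the
  averaged model therefore follows a plain stochastic gradient step.\<close>

lemma U_Suc:
  assumes "W_matrix S H \<pi> q \<tau> t *v 1 = 1"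
  shows "U (Suc t) \<omega> = U t \<omega> - \<eta> *\<^sub>R (average_model (Gr t \<omega>) + average_model (N t \<omega>))"
proof -
  have lin: "linear (average_model :: real^'n^'d \<Rightarrow> real^'d)"
    by (rule bounded_linear.linear[OF bounded_linear_average_model])
  show ?thesis
    unfolding U_def X_Suc average_model_mult[OF assms]
    by (simp add: linear_diff[OF lin] linear_scale[OF lin] linear_add[OF lin])
qed

lemma expectation_state_average_noise:
  assumes t: "t < T" and h: "h \<in> borel_measurable borel" and sq: "square_integrable M (\<lambda>\<omega>. h (X t \<omega>))"
  shows "expectation (\<lambda>\<omega>. h (X t \<omega>) \<bullet> average_model (N t \<omega>)) = 0"
proof -
  have "integrable M (\<lambda>\<omega>. h (X t \<omega>) \<bullet> column k (N t \<omega>))" for k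
    by (rule square_integrable_inner[OF sq column_N_square_integrable[OF t]])
  then show ?thesis
    using expectation_state_noise[OF assms]
    by (simp add: average_model_columns inner_sum_right Bochner_Integration.integral_sum)
qed

text \<open>Orthogonality across devices turns n terms with coefficient 1/n into n * (1/n)^2, the
  variance reduction behind \<sigma>^2 / n.\<close>

lemma expectation_average_noise:
  assumes t: "t < T"
  shows "expectation (\<lambda>\<omega>. (norm (average_model (N t \<omega>)))\<^sup>2) \<le> \<sigma>\<^sup>2 / real CARD('n)"
proof -
  have "expectation (\<lambda>\<omega>. (norm (\<Sum>k\<in>UNIV. (1 / real CARD('n)) *\<^sub>R column k (N t \<omega>)))\<^sup>2)
      \<le> \<sigma>\<^sup>2 * (\<Sum>k\<in>(UNIV::'n set). (1 / real CARD('n))\<^sup>2)"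
    using t by (intro expectation_orthogonal_sum column_N_square_integrable noise_orthogonal column_N_variance) auto
  then show ?thesis
    by (simp add: average_model_columns scaleR_sum_right power2_eq_square)
qed

text \<open>Column \<open>k\<close> of X (I - J) is the distance vector of device \<open>k\<close>
  from the average, so Jensen's inequality and smoothness of each device bound the error by the
  deviation.\<close>

lemma gradient_deviation:
  "(norm (gF (U t \<omega>) - average_model (Gr t \<omega>)))\<^sup>2
    \<le> L\<^sup>2 / real CARD('n) * (norm (X t \<omega> ** (mat 1 - J_matrix)))\<^sup>2"
proof -
  have "(norm (gF (U t \<omega>) - average_model (Gr t \<omega>)))\<^sup>2
     \<le> (1 / real CARD('n)) * (\<Sum>k\<in>UNIV. (norm (gr k (U t \<omega>) - gr k (column k (X t \<omega>))))\<^sup>2)"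
    using norm_average_power2_le[of "\<lambda>k. gr k (U t \<omega>) - gr k (column k (X t \<omega>))"]
    by (simp add: gF_def average_model_columns Gr_def column_columnwise sum_subtractf scaleR_right_diff_distrib)
  also have "\<dots> \<le> (1 / real CARD('n)) * (\<Sum>k\<in>UNIV. (L * norm (column k (X t \<omega> ** (mat 1 - J_matrix))))\<^sup>2)"
  proof (intro mult_left_mono sum_mono power_mono)
    fix k
    show "norm (gr k (U t \<omega>) - gr k (column k (X t \<omega>))) \<le> L * norm (column k (X t \<omega> ** (mat 1 - J_matrix)))"
      using gr_lipschitz[of k "U t \<omega>" "column k (X t \<omega>)"]
      by (simp add: matrix_diff_ldistrib column_diff column_mult_J U_def norm_minus_commute)
  qed auto
  finally show ?thesis
    by (simp add: norm_matrix_columns power_mult_distrib sum_distrib_left)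
qed

text \<open>The objective is squeezed between the constant lower bound and the quadratic upper bound
  that smoothness gives around 0, and the averaged model is square integrable.\<close>

lemma objective_integrable:
  assumes deriv: "\<And>x. GDERIV f x :> gF x" and inf: "\<And>x. F\<^sub>i\<^sub>n\<^sub>f \<le> f x" and t: "t \<le> T"
  shows "integrable M (\<lambda>\<omega>. f (U t \<omega>))"
proof (rule Bochner_Integration.integrable_bound)
  have sq: "square_integrable M (U t)" by (rule U_square_integrable[OF t])
  have "continuous_on UNIV f"
    using deriv by (auto simp: gderiv_def intro!: has_derivative_continuous_on intro: has_derivative_at_withinI)
  then have "f \<in> borel_measurable borel" by (rule borel_measurable_continuous_onI)
  then show "(\<lambda>\<omega>. f (U t \<omega>)) \<in> borel_measurable M"
    using sq by (auto simp: square_integrable_def)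
  let ?b = "\<lambda>\<omega>. \<bar>F\<^sub>i\<^sub>n\<^sub>f\<bar> + \<bar>f 0\<bar> + (norm (gF 0))\<^sup>2 + (1 + \<bar>L\<bar>) * (norm (U t \<omega>))\<^sup>2"
  show "integrable M ?b" using sq by (auto simp: square_integrable_def)
  show "AE \<omega> in M. norm (f (U t \<omega>)) \<le> norm (?b \<omega>)"
  proof (rule AE_I2)
    fix \<omega>
    have "f (U t \<omega>) \<le> f 0 + gF 0 \<bullet> U t \<omega> + L / 2 * (norm (U t \<omega>))\<^sup>2"
      using smooth_upper_bound[OF deriv gF_lipschitz, of "U t \<omega>" 0] by simp
    moreover have "gF 0 \<bullet> U t \<omega> \<le> (norm (gF 0))\<^sup>2 + (norm (U t \<omega>))\<^sup>2"
    proof -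
      have "0 \<le> (norm (gF 0 - U t \<omega>))\<^sup>2" by simp
      then have "2 * (gF 0 \<bullet> U t \<omega>) \<le> (norm (gF 0))\<^sup>2 + (norm (U t \<omega>))\<^sup>2"
        unfolding power2_norm_eq_inner by (simp add: inner_diff inner_commute)
      moreover have "0 \<le> (norm (gF 0))\<^sup>2" "0 \<le> (norm (U t \<omega>))\<^sup>2" by auto
      ultimately show ?thesis by linarith
    qed
    moreover have "L / 2 * (norm (U t \<omega>))\<^sup>2 \<le> \<bar>L\<bar> * (norm (U t \<omega>))\<^sup>2"
      by (intro mult_right_mono) auto
    moreover have "0 \<le> (norm (gF 0))\<^sup>2" "0 \<le> (norm (U t \<omega>))\<^sup>2" "0 \<le> \<bar>L\<bar> * (norm (U t \<omega>))\<^sup>2" by auto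
    ultimately have "\<bar>f (U t \<omega>)\<bar> \<le> ?b \<omega>"
      using inf[of "U t \<omega>"] unfolding distrib_right mult_1_left by linarith
    then show "norm (f (U t \<omega>)) \<le> norm (?b \<omega>)" by simp
  qed
qed

lemma expectation_descent_step:
  assumes deriv: "\<And>x. GDERIV f x :> gF x" and inf: "\<And>x. F\<^sub>i\<^sub>n\<^sub>f \<le> f x"
    and eta: "0 \<le> \<eta>" "\<eta> * L \<le> 1" and L: "0 \<le> L" and t: "t < T"
    and W: "W_matrix S H \<pi> q \<tau> t *v 1 = 1"
  shows "expectation (\<lambda>\<omega>. f (U (Suc t) \<omega>)) \<le> expectation (\<lambda>\<omega>. f (U t \<omega>))
    - \<eta> / 2 * expectation (\<lambda>\<omega>. (norm (gF (U t \<omega>)))\<^sup>2)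
    + \<eta> * L\<^sup>2 / (2 * real CARD('n)) * expectation (\<lambda>\<omega>. (norm (X t \<omega> ** (mat 1 - J_matrix)))\<^sup>2)
    + L * \<eta>\<^sup>2 * \<sigma>\<^sup>2 / (2 * real CARD('n))"
proof -
  let ?h = "\<lambda>\<omega>. average_model (Gr t \<omega>)" and ?\<nu> = "\<lambda>\<omega>. average_model (N t \<omega>)"
  let ?X = "\<lambda>\<omega>. X t \<omega> ** (mat 1 - J_matrix)"
  have t': "t \<le> T" "Suc t \<le> T" using t by auto
  have sq_\<nu>: "square_integrable M ?\<nu>"
    by (rule square_integrable_bounded_linear[OF bounded_linear_average_model N_square_integrable[OF t]])
  have sq_h: "square_integrable M ?h"
    by (rule square_integrable_bounded_linear[OF bounded_linear_average_model Gr_square_integrable[OF t'(1)]])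
  have sq_g: "square_integrable M (\<lambda>\<omega>. gF (U t \<omega>))" by (rule gF_U_square_integrable[OF t'(1)])
  have sq_X: "square_integrable M ?X"
    by (rule square_integrable_bounded_linear[OF bounded_linear_matrix_mult_left X_square_integrable[OF t'(1)]])
  note int = objective_integrable[OF deriv inf t'(1)] square_integrable_norm_sq[OF sq_g]
    square_integrable_norm_sq[OF sq_X] square_integrable_inner[OF sq_g sq_\<nu>]
    square_integrable_inner[OF sq_h sq_\<nu>] square_integrable_norm_sq[OF sq_\<nu>]
  \<comment> \<open>Both cross terms pair the fresh noise with a function of the current state: the
    gradient at the average here, the average of the local gradients in \<open>h0\<close>.\<close>
  have g0: "expectation (\<lambda>\<omega>. gF (U t \<omega>) \<bullet> ?\<nu> \<omega>) = 0"
    unfolding U_def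
    by (rule expectation_state_average_noise[OF t, of "\<lambda>x. gF (average_model x)"])
      (use sq_g in \<open>auto simp: U_def\<close>)
  have h0: "expectation (\<lambda>\<omega>. ?h \<omega> \<bullet> ?\<nu> \<omega>) = 0"
  proof -
    have "columnwise gr \<in> borel_measurable borel"
      by (rule borel_measurable_matrix, unfold column_columnwise)
        (rule measurable_compose[OF column_measurable gr_measurable], simp)
    then show ?thesis
      unfolding Gr_def
      by (intro expectation_state_average_noise[OF t, of "\<lambda>x. average_model (columnwise gr x)"])
        (use sq_h in \<open>auto simp: Gr_def\<close>)
  qed
  have "expectation (\<lambda>\<omega>. f (U (Suc t) \<omega>)) \<le> expectation (\<lambda>\<omega>. f (U t \<omega>) - \<eta> / 2 * (norm (gF (U t \<omega>)))\<^sup>2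
      + \<eta> / 2 * (L\<^sup>2 / real CARD('n) * (norm (?X \<omega>))\<^sup>2)
      - \<eta> * (gF (U t \<omega>) \<bullet> ?\<nu> \<omega>) + L * \<eta>\<^sup>2 * (?h \<omega> \<bullet> ?\<nu> \<omega>) + L * \<eta>\<^sup>2 / 2 * (norm (?\<nu> \<omega>))\<^sup>2)"
  proof (rule integral_mono)
    show "integrable M (\<lambda>\<omega>. f (U (Suc t) \<omega>))" by (rule objective_integrable[OF deriv inf t'(2)])
    show "integrable M (\<lambda>\<omega>. f (U t \<omega>) - \<eta> / 2 * (norm (gF (U t \<omega>)))\<^sup>2
      + \<eta> / 2 * (L\<^sup>2 / real CARD('n) * (norm (?X \<omega>))\<^sup>2)
      - \<eta> * (gF (U t \<omega>) \<bullet> ?\<nu> \<omega>) + L * \<eta>\<^sup>2 * (?h \<omega> \<bullet> ?\<nu> \<omega>) + L * \<eta>\<^sup>2 / 2 * (norm (?\<nu> \<omega>))\<^sup>2)"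
      by (intro Bochner_Integration.integrable_add Bochner_Integration.integrable_diff integrable_mult_right int)
    fix \<omega>
    have "f (U (Suc t) \<omega>) \<le> f (U t \<omega>) - \<eta> / 2 * (norm (gF (U t \<omega>)))\<^sup>2 + \<eta> / 2 * (norm (gF (U t \<omega>) - ?h \<omega>))\<^sup>2
      - \<eta> * (gF (U t \<omega>) \<bullet> ?\<nu> \<omega>) + L * \<eta>\<^sup>2 * (?h \<omega> \<bullet> ?\<nu> \<omega>) + L * \<eta>\<^sup>2 / 2 * (norm (?\<nu> \<omega>))\<^sup>2"
      unfolding U_Suc[OF W] by (rule descent_step_pathwise[OF deriv gF_lipschitz eta])
    moreover have "\<eta> / 2 * (norm (gF (U t \<omega>) - ?h \<omega>))\<^sup>2 \<le> \<eta> / 2 * (L\<^sup>2 / real CARD('n) * (norm (?X \<omega>))\<^sup>2)"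
      using eta by (intro mult_left_mono gradient_deviation) auto
    ultimately show "f (U (Suc t) \<omega>) \<le> f (U t \<omega>) - \<eta> / 2 * (norm (gF (U t \<omega>)))\<^sup>2
      + \<eta> / 2 * (L\<^sup>2 / real CARD('n) * (norm (?X \<omega>))\<^sup>2)
      - \<eta> * (gF (U t \<omega>) \<bullet> ?\<nu> \<omega>) + L * \<eta>\<^sup>2 * (?h \<omega> \<bullet> ?\<nu> \<omega>) + L * \<eta>\<^sup>2 / 2 * (norm (?\<nu> \<omega>))\<^sup>2"
      by linarith
  qed
  also have "\<dots> = expectation (\<lambda>\<omega>. f (U t \<omega>)) - \<eta> / 2 * expectation (\<lambda>\<omega>. (norm (gF (U t \<omega>)))\<^sup>2)
    + \<eta> / 2 * (L\<^sup>2 / real CARD('n) * expectation (\<lambda>\<omega>. (norm (?X \<omega>))\<^sup>2))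
    + L * \<eta>\<^sup>2 / 2 * expectation (\<lambda>\<omega>. (norm (?\<nu> \<omega>))\<^sup>2)"
    using int by (simp add: g0 h0)
  also have "L * \<eta>\<^sup>2 / 2 * expectation (\<lambda>\<omega>. (norm (?\<nu> \<omega>))\<^sup>2) \<le> L * \<eta>\<^sup>2 / 2 * (\<sigma>\<^sup>2 / real CARD('n))"
    using L by (intro mult_left_mono expectation_average_noise[OF t]) auto
  finally show ?thesis by simp
qed

text \<open>The one-step inequality, multiplied by 2 / \<eta>, telescopes; the last expected
  objective value is bounded below by the infimum.\<close>

lemma expectation_gradient_sum:
  assumes deriv: "\<And>x. GDERIV f x :> gF x" and inf: "\<And>x. F\<^sub>i\<^sub>n\<^sub>f \<le> f x"
    and eta: "0 < \<eta>" "\<eta> * L \<le> 1" and L: "0 \<le> L"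
    and W: "\<And>t. W_matrix S H \<pi> q \<tau> t *v 1 = 1"
  shows "(\<Sum>t<T. expectation (\<lambda>\<omega>. (norm (gF (U t \<omega>)))\<^sup>2)) \<le>
    2 * (f x1 - F\<^sub>i\<^sub>n\<^sub>f) / \<eta> + real T * (\<eta> * L * \<sigma>\<^sup>2 / real CARD('n))
    + L\<^sup>2 / real CARD('n) * (\<Sum>t<T. expectation (\<lambda>\<omega>. (norm (X t \<omega> ** (mat 1 - J_matrix)))\<^sup>2))"
proof -
  let ?f = "\<lambda>t. expectation (\<lambda>\<omega>. f (U t \<omega>))"
  let ?a = "\<lambda>t. expectation (\<lambda>\<omega>. (norm (gF (U t \<omega>)))\<^sup>2)"
  let ?b = "\<lambda>t. expectation (\<lambda>\<omega>. (norm (X t \<omega> ** (mat 1 - J_matrix)))\<^sup>2)"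
  let ?c = "\<eta> * L * \<sigma>\<^sup>2 / real CARD('n)"
  have step: "?a t \<le> 2 / \<eta> * (?f t - ?f (Suc t)) + ?c + L\<^sup>2 / real CARD('n) * ?b t" if "t < T" for t
  proof -
    have "\<eta> / 2 * ?a t \<le> ?f t - ?f (Suc t) + \<eta> * L\<^sup>2 / (2 * real CARD('n)) * ?b t
        + L * \<eta>\<^sup>2 * \<sigma>\<^sup>2 / (2 * real CARD('n))"
      using expectation_descent_step[OF deriv inf less_imp_le[OF eta(1)] eta(2) L that W] by linarith
    then have "2 / \<eta> * (\<eta> / 2 * ?a t) \<le> 2 / \<eta> * (?f t - ?f (Suc t) + \<eta> * L\<^sup>2 / (2 * real CARD('n)) * ?b t
        + L * \<eta>\<^sup>2 * \<sigma>\<^sup>2 / (2 * real CARD('n)))"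
      using eta by (intro mult_left_mono) auto
    then show ?thesis using eta by (simp add: distrib_left power2_eq_square mult.commute mult.left_commute)
  qed
  have "(\<Sum>t<T. ?a t) \<le> (\<Sum>t<T. 2 / \<eta> * (?f t - ?f (Suc t)) + ?c + L\<^sup>2 / real CARD('n) * ?b t)"
    by (intro sum_mono step) auto
  also have "\<dots> = 2 / \<eta> * (\<Sum>t<T. ?f t - ?f (Suc t)) + real T * ?c + L\<^sup>2 / real CARD('n) * (\<Sum>t<T. ?b t)"
    by (simp only: sum.distrib sum_distrib_left[symmetric]) simp
  also have "(\<Sum>t<T. ?f t - ?f (Suc t)) = ?f 0 - ?f T" by (rule sum_lessThan_telescope')
  also have "?f 0 = f x1"
  proof -
    have "average_model (X 0 \<omega>) = x1" for \<omega>
    proof -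
      have "column k (X 0 \<omega>) = x1" for k by (simp add: X_def column_def vec_eq_iff)
      then show ?thesis by (simp add: average_model_columns sum_constant_scaleR del: sum_constant)
    qed
    then show ?thesis by (simp add: U_def prob_space)
  qed
  also have "2 / \<eta> * (f x1 - ?f T) \<le> 2 / \<eta> * (f x1 - F\<^sub>i\<^sub>n\<^sub>f)"
  proof -
    have "F\<^sub>i\<^sub>n\<^sub>f \<le> ?f T"
      using integral_mono[of M "\<lambda>_. F\<^sub>i\<^sub>n\<^sub>f" "\<lambda>\<omega>. f (U T \<omega>)"] objective_integrable[OF deriv inf, of T] inf
      by (simp add: prob_space)
    then show ?thesis using eta by (intro mult_left_mono) auto
  qed
  finally show ?thesis by simp
qed

end

section \<open>Deviation from the averaged model\<close>

context clustering
begin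

definition cluster_gradient :: "('n \<Rightarrow> real^'d \<Rightarrow> real^'d) \<Rightarrow> 'm \<Rightarrow> real^'d \<Rightarrow> real^'d" where
  "cluster_gradient gr i x = (1 / real (card (S i))) *\<^sub>R (\<Sum>k\<in>S i. gr k x)"

lemma mat_1_V_one: "(mat 1 - V_matrix S) *v 1 = 0" and V_J_one: "(V_matrix S - J_matrix) *v 1 = 0"
  by (simp_all add: matrix_vector_mult_diff_rdistrib V_matrix_one)
    (simp add: matrix_vector_mult_def J_matrix_def vec_eq_iff)

lemma V_mat_1_V: "V_matrix S ** (mat 1 - V_matrix S) = 0"
  and V_V_J: "V_matrix S ** (V_matrix S - J_matrix) = V_matrix S - J_matrix"
  using orthogonal_projection_V by (simp_all add: matrix_diff_ldistrib V_J orthogonal_projection_def)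

lemma deviation_pythagoras:
  fixes X :: "real^'n^'d"
  shows "(norm (X ** (mat 1 - J_matrix)))\<^sup>2 =
    (norm (X ** (mat 1 - V_matrix S)))\<^sup>2 + (norm (X ** (V_matrix S - J_matrix)))\<^sup>2"
proof -
  have eq: "(mat 1 - V_matrix S) + (V_matrix S - J_matrix) = mat 1 - J_matrix" by simp
  have "orthogonal_projection (mat 1 - J_matrix :: real^'n^'n)"
    by (rule orthogonal_projection_diff) (simp_all add: orthogonal_projection_mat_1 orthogonal_projection_J)
  then show ?thesis
    using orthogonal_projection_pythagoras[OF orthogonal_projection_mat_1_V orthogonal_projection_V_J, of X]
    unfolding eq by simp
qed

text \<open>The gradients are compared with those at X V, where all devices of a cluster hold the
  same model. There I - V leaves exactly the difference between a device gradient and its cluster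
  gradient, controlled by \<open>intra\<close>. The error of the comparison is governed by X - X V,
  so the deviation within clusters alone occurs on the right.\<close>

lemma intra_divergence:
  fixes X :: "real^'n^'d"
  assumes lip: "\<And>k x y. norm (gr k x - gr k y) \<le> L * norm (x - y)"
    and intra: "\<And>i x. (1 / real (card (S i))) * (\<Sum>k\<in>S i. (norm (cluster_gradient gr i x - gr k x))\<^sup>2) \<le> (\<epsilon>c i)\<^sup>2"
  shows "(norm (columnwise gr X ** (mat 1 - V_matrix S)))\<^sup>2 \<le>
    2 * (L\<^sup>2 * (norm (X ** (mat 1 - V_matrix S)))\<^sup>2) + 2 * (\<Sum>i\<in>UNIV. real (card (S i)) * (\<epsilon>c i)\<^sup>2)"
proof -
  let ?P = "mat 1 - V_matrix S" and ?XV = "X ** V_matrix S"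
  define x where "x i = (1 / real (card (S i))) *\<^sub>R (\<Sum>l\<in>S i. column l X)" for i
  have XV: "column k ?XV = x (cluster_of k)" for k by (simp add: column_mult_V x_def)
  have "columnwise gr X ** ?P = (columnwise gr X - columnwise gr ?XV) ** ?P + columnwise gr ?XV ** ?P"
    by (simp add: matrix_diff_rdistrib)
  then have "(norm (columnwise gr X ** ?P))\<^sup>2 \<le> 2 * (norm ((columnwise gr X - columnwise gr ?XV) ** ?P))\<^sup>2
      + 2 * (norm (columnwise gr ?XV ** ?P))\<^sup>2"
    using norm_add_power2_le by metis
  also have "(norm ((columnwise gr X - columnwise gr ?XV) ** ?P))\<^sup>2 \<le> (norm (columnwise gr X - columnwise gr ?XV))\<^sup>2"
    by (intro power_mono orthogonal_projection_norm_le orthogonal_projection_mat_1_V) auto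
  also have "\<dots> \<le> (\<Sum>k\<in>UNIV. (L * norm (column k (X ** ?P)))\<^sup>2)"
    unfolding norm_matrix_columns column_diff column_columnwise matrix_diff_ldistrib matrix_mul_rid
    by (intro sum_mono power_mono lip) auto
  also have "\<dots> = L\<^sup>2 * (norm (X ** ?P))\<^sup>2"
    by (simp add: norm_matrix_columns power_mult_distrib sum_distrib_left)
  also have "(norm (columnwise gr ?XV ** ?P))\<^sup>2 \<le> (\<Sum>i\<in>UNIV. real (card (S i)) * (\<epsilon>c i)\<^sup>2)"
  proof -
    have "column k (columnwise gr ?XV ** ?P) = gr k (x (cluster_of k)) - cluster_gradient gr (cluster_of k) (x (cluster_of k))" for k
    proof -
      have "(\<Sum>l\<in>S (cluster_of k). gr l (x (cluster_of l))) = (\<Sum>l\<in>S (cluster_of k). gr l (x (cluster_of k)))"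
        by (intro sum.cong refl) (simp add: in_cluster_iff)
      then show ?thesis
        by (simp add: matrix_diff_ldistrib column_diff column_mult_V[of _ "columnwise gr ?XV"] column_columnwise XV
            cluster_gradient_def)
    qed
    then have "(norm (columnwise gr ?XV ** ?P))\<^sup>2 =
        (\<Sum>i\<in>UNIV. \<Sum>k\<in>S i. (norm (cluster_gradient gr i (x i) - gr k (x i)))\<^sup>2)"
      unfolding sum_clusters norm_matrix_columns by (simp add: norm_minus_commute)
    also have "\<dots> \<le> (\<Sum>i\<in>UNIV. real (card (S i)) * (\<epsilon>c i)\<^sup>2)"
    proof (rule sum_mono)
      fix i
      show "(\<Sum>k\<in>S i. (norm (cluster_gradient gr i (x i) - gr k (x i)))\<^sup>2) \<le> real (card (S i)) * (\<epsilon>c i)\<^sup>2"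
        using intra[of i "x i"] card_cluster_pos[of i] by (simp add: field_simps)
    qed
    finally show ?thesis .
  qed
  finally show ?thesis by simp
qed

text \<open>Cluster gradients can be compared with the global gradient only at one common model, so
  the reference point is the global average X J. The error then involves the full deviation X (I -
  J), which couples this estimate to the one within clusters.\<close>

lemma inter_divergence:
  fixes X :: "real^'n^'d"
  assumes lip: "\<And>k x y. norm (gr k x - gr k y) \<le> L * norm (x - y)"
    and inter: "\<And>x. (\<Sum>i\<in>UNIV. real (card (S i)) / real CARD('n) *
      (norm (cluster_gradient gr i x - (1 / real CARD('n)) *\<^sub>R (\<Sum>k\<in>UNIV. gr k x)))\<^sup>2) \<le> \<epsilon>\<^sup>2"
  shows "(norm (columnwise gr X ** (V_matrix S - J_matrix)))\<^sup>2 \<le>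
    2 * (L\<^sup>2 * (norm (X ** (mat 1 - J_matrix)))\<^sup>2) + 2 * (real CARD('n) * \<epsilon>\<^sup>2)"
proof -
  let ?P = "V_matrix S - J_matrix" and ?XJ = "X ** J_matrix"
  define x where "x = average_model X"
  have XJ: "column k ?XJ = x" for k by (simp add: column_mult_J x_def)
  have "columnwise gr X ** ?P = (columnwise gr X - columnwise gr ?XJ) ** ?P + columnwise gr ?XJ ** ?P"
    by (simp add: matrix_diff_rdistrib)
  then have "(norm (columnwise gr X ** ?P))\<^sup>2 \<le> 2 * (norm ((columnwise gr X - columnwise gr ?XJ) ** ?P))\<^sup>2
      + 2 * (norm (columnwise gr ?XJ ** ?P))\<^sup>2"
    using norm_add_power2_le by metis
  also have "(norm ((columnwise gr X - columnwise gr ?XJ) ** ?P))\<^sup>2 \<le> (norm (columnwise gr X - columnwise gr ?XJ))\<^sup>2"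
    by (intro power_mono orthogonal_projection_norm_le orthogonal_projection_V_J) auto
  also have "\<dots> \<le> (\<Sum>k\<in>UNIV. (L * norm (column k (X ** (mat 1 - J_matrix))))\<^sup>2)"
    unfolding norm_matrix_columns column_diff column_columnwise matrix_diff_ldistrib matrix_mul_rid
    by (intro sum_mono power_mono lip) auto
  also have "\<dots> = L\<^sup>2 * (norm (X ** (mat 1 - J_matrix)))\<^sup>2"
    by (simp add: norm_matrix_columns power_mult_distrib sum_distrib_left)
  also have "(norm (columnwise gr ?XJ ** ?P))\<^sup>2 \<le> real CARD('n) * \<epsilon>\<^sup>2"
  proof -
    have "column k (columnwise gr ?XJ ** ?P) =
        cluster_gradient gr (cluster_of k) x - (1 / real CARD('n)) *\<^sub>R (\<Sum>k\<in>UNIV. gr k x)" for k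
      by (simp add: matrix_diff_ldistrib column_diff column_mult_V[of _ "columnwise gr ?XJ"]
          column_mult_J[of _ "columnwise gr ?XJ"] average_model_columns[of "columnwise gr ?XJ"]
          column_columnwise XJ cluster_gradient_def)
    then have "(norm (columnwise gr ?XJ ** ?P))\<^sup>2 = (\<Sum>i\<in>UNIV. real (card (S i)) *
        (norm (cluster_gradient gr i x - (1 / real CARD('n)) *\<^sub>R (\<Sum>k\<in>UNIV. gr k x)))\<^sup>2)"
      unfolding norm_matrix_columns by (simp add: sum_cluster_of[symmetric])
    also have "\<dots> = real CARD('n) * (\<Sum>i\<in>UNIV. real (card (S i)) / real CARD('n) *
        (norm (cluster_gradient gr i x - (1 / real CARD('n)) *\<^sub>R (\<Sum>k\<in>UNIV. gr k x)))\<^sup>2)"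
      by (subst sum_distrib_left) simp
    also have "\<dots> \<le> real CARD('n) * \<epsilon>\<^sup>2"
      by (intro mult_left_mono inter) auto
    finally show ?thesis .
  qed
  finally show ?thesis by simp
qed

end

lemma projected_step:
  fixes X G :: "real^'n^'d" and P K :: "real^'n^'n"
  shows "(X - \<eta> *\<^sub>R G) ** (if c then P ** K else P) =
    (if c then (X ** P - \<eta> *\<^sub>R (G ** P)) ** K else X ** P - \<eta> *\<^sub>R (G ** P))"
  by (simp add: matrix_mul_assoc matrix_diff_rdistrib matrix_scaleR_left)

section \<open>Joint estimate of the two deviations\<close>

locale ce_fedavg_convergence =
  ce_fedavg_sampling M S H \<pi> q \<tau> T \<eta> L \<sigma> D g x1 \<theta> gr + cluster_mixing S H \<pi> z
  for M :: "'w measure" and S :: "'m::finite \<Rightarrow> 'n::finite set" and H \<pi> q \<tau> T \<eta> L \<sigma>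
    and D :: "'n \<Rightarrow> 'b measure" and g :: "'n \<Rightarrow> 'b \<Rightarrow> real^'d \<Rightarrow> real^'d" and x1 \<theta> gr z +
  fixes \<epsilon>c :: "'m \<Rightarrow> real" and \<epsilon> :: real
  assumes \<tau>: "0 < \<tau>" and q: "0 < q" and L: "0 \<le> L"
    and intra: "\<And>i x. (1 / real (card (S i))) * (\<Sum>k\<in>S i. (norm (cluster_gradient gr i x - gr k x))\<^sup>2) \<le> (\<epsilon>c i)\<^sup>2"
    and inter: "\<And>x. (\<Sum>i\<in>UNIV. real (card (S i)) / real CARD('n) *
      (norm (cluster_gradient gr i x - (1 / real CARD('n)) *\<^sub>R (\<Sum>k\<in>UNIV. gr k x)))\<^sup>2) \<le> \<epsilon>\<^sup>2"
begin

lemma W_one: "W_matrix S H \<pi> q \<tau> t *v 1 = 1"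
  by (simp add: W_matrix_def Z_one V_matrix_one)

text \<open>With a common initial model every row of the initial matrix is a multiple of the
  all-ones vector, so both deviations start at 0, as the unrolling requires.\<close>

lemma X_0_mult:
  assumes P: "P *v 1 = 0" "orthogonal_projection P"
  shows "X 0 \<omega> ** P = 0"
proof -
  have "X 0 \<omega> $ r = x1 $ r *\<^sub>R 1" for r
    by (simp add: X_def vec_eq_iff)
  moreover have "1 v* P = 0" using P by (metis orthogonal_projection_def transpose_matrix_vector)
  ultimately have "(X 0 \<omega> ** P) $ r = 0" for r
    by (simp add: row_matrix_mult scaleR_vector_matrix_assoc)
  then show ?thesis by (simp add: vec_eq_iff)
qed

definition intra_dev :: real where
  "intra_dev = (\<Sum>t<T. expectation (\<lambda>\<omega>. (norm (X t \<omega> ** (mat 1 - V_matrix S)))\<^sup>2))"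

definition inter_dev :: real where
  "inter_dev = (\<Sum>t<T. expectation (\<lambda>\<omega>. (norm (X t \<omega> ** (V_matrix S - J_matrix)))\<^sup>2))"

lemma X_mult_integrable: "t < T \<Longrightarrow> integrable M (\<lambda>\<omega>. (norm (X t \<omega> ** P))\<^sup>2)"
  by (intro square_integrable_norm_sq square_integrable_bounded_linear[OF bounded_linear_matrix_mult_left]
      X_square_integrable) simp

lemma Gr_mult_integrable: "t < T \<Longrightarrow> integrable M (\<lambda>\<omega>. (norm (Gr t \<omega> ** P))\<^sup>2)"
  by (intro square_integrable_norm_sq square_integrable_bounded_linear[OF bounded_linear_matrix_mult_left]
      Gr_square_integrable) simp

lemma total_dev:
  "(\<Sum>t<T. expectation (\<lambda>\<omega>. (norm (X t \<omega> ** (mat 1 - J_matrix)))\<^sup>2)) = intra_dev + inter_dev"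
  unfolding intra_dev_def inter_dev_def deviation_pythagoras sum.distrib[symmetric]
  by (intro sum.cong refl) (simp add: X_mult_integrable)

lemma intra_dev_le:
  "intra_dev \<le> 2 * \<eta>\<^sup>2 * (real T * real \<tau> * \<sigma>\<^sup>2 * (real CARD('n) - real CARD('m)))
    + \<eta>\<^sup>2 * (real \<tau>)\<^sup>2 * (2 * L\<^sup>2 * intra_dev + 2 * real T * (\<Sum>i\<in>UNIV. real (card (S i)) * (\<epsilon>c i)\<^sup>2))"
proof -
  let ?P = "mat 1 - V_matrix S" and ?e = "\<Sum>i\<in>UNIV. real (card (S i)) * (\<epsilon>c i)\<^sup>2"
  have Z0: "Z_matrix S H \<pi> ** ?P = 0" by (simp add: matrix_diff_ldistrib Z_V)
  have rec: "intra_dev \<le> 2 * \<eta>\<^sup>2 * (real T * real \<tau> * \<sigma>\<^sup>2 * (norm ?P)\<^sup>2 / (1 - 0\<^sup>2))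
      + 2 * \<eta>\<^sup>2 * (block_kernel \<tau> 0 * (\<Sum>s<T. expectation (\<lambda>\<omega>. (norm (Gr s \<omega> ** ?P))\<^sup>2)))"
    unfolding intra_dev_def
  \<comment> \<open>Here the contraction factor is 0. As \<open>0 ^ 0 = 1\<close>, the weights are 1
    inside the current period of length \<open>\<tau>\<close> and 0 before it.\<close>
  proof (rule expectation_recursion_sum[where K = 0])
    show "?P ** ?P = ?P" using orthogonal_projection_mat_1_V by (simp add: orthogonal_projection_def)
    show "X 0 \<omega> ** ?P = 0" for \<omega> by (rule X_0_mult[OF mat_1_V_one orthogonal_projection_mat_1_V])
    fix t \<omega>
    have "X (Suc t) \<omega> ** ?P = (X t \<omega> - \<eta> *\<^sub>R (Gr t \<omega> + N t \<omega>)) ** (W_matrix S H \<pi> q \<tau> t ** ?P)"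
      by (simp add: X_Suc matrix_mul_assoc)
    \<comment> \<open>Every multiple of \<open>q * \<tau>\<close> is a multiple of
      \<open>\<tau>\<close>, and both V and Z annihilate I - V; so either kind of aggregation resets
      the deviation.\<close>
    moreover have "W_matrix S H \<pi> q \<tau> t ** ?P = (if \<tau> dvd Suc t then 0 else ?P)"
    proof (cases "\<tau> dvd Suc t")
      case True
      then show ?thesis by (auto simp: W_matrix_def Z0 V_mat_1_V dvd_eq_mod_eq_0)
    next
      case False
      then have "\<not> q * \<tau> dvd Suc t" using dvd_mult_right by blast
      with False show ?thesis by (auto simp: W_matrix_def dvd_eq_mod_eq_0)
    qed
    ultimately show "X (Suc t) \<omega> ** ?P = (if \<tau> dvd Suc t
       then (X t \<omega> ** ?P - \<eta> *\<^sub>R ((Gr t \<omega> + N t \<omega>) ** ?P)) ** 0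
       else X t \<omega> ** ?P - \<eta> *\<^sub>R ((Gr t \<omega> + N t \<omega>) ** ?P))"
      by (simp add: matrix_diff_rdistrib matrix_scaleR_left)
  qed (use \<tau> in \<open>auto intro: Gr_square_integrable\<close>)
  have grad: "(\<Sum>s<T. expectation (\<lambda>\<omega>. (norm (Gr s \<omega> ** ?P))\<^sup>2)) \<le> 2 * (L\<^sup>2 * intra_dev) + real T * (2 * ?e)"
  proof -
    have "(\<Sum>s<T. expectation (\<lambda>\<omega>. (norm (Gr s \<omega> ** ?P))\<^sup>2)) \<le>
      (\<Sum>s<T. expectation (\<lambda>\<omega>. 2 * (L\<^sup>2 * (norm (X s \<omega> ** ?P))\<^sup>2) + 2 * ?e))"
    proof (intro sum_mono integral_mono Gr_mult_integrable)
      fix s \<omega> assume "s \<in> {..<T}"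
      then show "integrable M (\<lambda>\<omega>. 2 * (L\<^sup>2 * (norm (X s \<omega> ** ?P))\<^sup>2) + 2 * ?e)"
        by (intro Bochner_Integration.integrable_add integrable_mult_right X_mult_integrable) auto
      show "(norm (Gr s \<omega> ** ?P))\<^sup>2 \<le> 2 * (L\<^sup>2 * (norm (X s \<omega> ** ?P))\<^sup>2) + 2 * ?e"
        unfolding Gr_def by (rule intra_divergence[OF gr_lipschitz intra])
    qed simp
    also have "\<dots> = (\<Sum>s<T. 2 * (L\<^sup>2 * expectation (\<lambda>\<omega>. (norm (X s \<omega> ** ?P))\<^sup>2)) + 2 * ?e)"
      using X_mult_integrable[of _ ?P] by (intro sum.cong refl) (simp add: prob_space)
    finally show ?thesis
      unfolding sum.distrib sum_distrib_left[symmetric] intra_dev_def[symmetric] by simp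
  qed
  have "2 * \<eta>\<^sup>2 * ((real \<tau>)\<^sup>2 / 2 * (\<Sum>s<T. expectation (\<lambda>\<omega>. (norm (Gr s \<omega> ** ?P))\<^sup>2)))
      \<le> 2 * \<eta>\<^sup>2 * ((real \<tau>)\<^sup>2 / 2 * (2 * (L\<^sup>2 * intra_dev) + real T * (2 * ?e)))"
    by (intro mult_left_mono grad) auto
  moreover have kernel: "block_kernel \<tau> 0 = (real \<tau>)\<^sup>2 / 2" by (simp add: block_kernel_def)
  ultimately show ?thesis using rec unfolding norm_mat_1_V kernel by (simp add: algebra_simps)
qed

lemma inter_dev_le:
  "inter_dev \<le> 2 * \<eta>\<^sup>2 * (real T * real (q * \<tau>) * \<sigma>\<^sup>2 * (real CARD('m) - 1) / (1 - z\<^sup>2))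
    + 2 * \<eta>\<^sup>2 * block_kernel (q * \<tau>) z * (2 * L\<^sup>2 * (intra_dev + inter_dev) + 2 * real T * real CARD('n) * \<epsilon>\<^sup>2)"
proof -
  let ?P = "V_matrix S - J_matrix" and ?Z = "Z_matrix S H \<pi>" and ?e = "real CARD('n) * \<epsilon>\<^sup>2"
  have PZ: "?P ** ?Z = ?Z - J_matrix" and ZP: "?Z ** ?P = ?Z - J_matrix"
    by (simp_all add: matrix_diff_ldistrib matrix_diff_rdistrib Z_V V_Z Z_J J_Z)
  have kernel0: "0 \<le> block_kernel (q * \<tau>) z"
    using z by (auto simp: block_kernel_def intro!: add_nonneg_nonneg divide_nonneg_nonneg)
  have rec: "inter_dev \<le> 2 * \<eta>\<^sup>2 * (real T * real (q * \<tau>) * \<sigma>\<^sup>2 * (norm ?P)\<^sup>2 / (1 - z\<^sup>2))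
      + 2 * \<eta>\<^sup>2 * (block_kernel (q * \<tau>) z * (\<Sum>s<T. expectation (\<lambda>\<omega>. (norm (Gr s \<omega> ** ?P))\<^sup>2)))"
    unfolding inter_dev_def
  proof (rule expectation_recursion_sum[where K = ?Z])
    show "?P ** ?P = ?P" using orthogonal_projection_V_J by (simp add: orthogonal_projection_def)
    show "?P ** ?Z = ?Z ** ?P" by (simp add: PZ ZP)
    show "norm (x v* (?P ** ?Z)) \<le> z * norm (x v* ?P)" for x by (rule Z_contraction)
    show "X 0 \<omega> ** ?P = 0" for \<omega> by (rule X_0_mult[OF V_J_one orthogonal_projection_V_J])
    fix t \<omega>
    have "X (Suc t) \<omega> ** ?P = (X t \<omega> - \<eta> *\<^sub>R (Gr t \<omega> + N t \<omega>)) ** (W_matrix S H \<pi> q \<tau> t ** ?P)"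
      by (simp add: X_Suc matrix_mul_assoc)
    \<comment> \<open>An aggregation inside the clusters leaves V - J unchanged, so the period of
      this recursion is \<open>q * \<tau>\<close>; at its end Z can be moved to the right of the
      projection.\<close>
    moreover have "W_matrix S H \<pi> q \<tau> t ** ?P = (if q * \<tau> dvd Suc t then ?P ** ?Z else ?P)"
      by (auto simp: W_matrix_def dvd_eq_mod_eq_0 PZ ZP V_V_J)
    ultimately show "X (Suc t) \<omega> ** ?P = (if q * \<tau> dvd Suc t
       then (X t \<omega> ** ?P - \<eta> *\<^sub>R ((Gr t \<omega> + N t \<omega>) ** ?P)) ** ?Z
       else X t \<omega> ** ?P - \<eta> *\<^sub>R ((Gr t \<omega> + N t \<omega>) ** ?P))"
      by (simp only: projected_step)
  qed (use \<tau> q z in \<open>auto intro: Gr_square_integrable\<close>)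
  have grad: "(\<Sum>s<T. expectation (\<lambda>\<omega>. (norm (Gr s \<omega> ** ?P))\<^sup>2)) \<le> 2 * (L\<^sup>2 * (intra_dev + inter_dev)) + real T * (2 * ?e)"
  proof -
    have "(\<Sum>s<T. expectation (\<lambda>\<omega>. (norm (Gr s \<omega> ** ?P))\<^sup>2)) \<le>
      (\<Sum>s<T. expectation (\<lambda>\<omega>. 2 * (L\<^sup>2 * (norm (X s \<omega> ** (mat 1 - J_matrix)))\<^sup>2) + 2 * ?e))"
    proof (intro sum_mono integral_mono Gr_mult_integrable)
      fix s \<omega> assume "s \<in> {..<T}"
      then show "integrable M (\<lambda>\<omega>. 2 * (L\<^sup>2 * (norm (X s \<omega> ** (mat 1 - J_matrix)))\<^sup>2) + 2 * ?e)"
        by (intro Bochner_Integration.integrable_add integrable_mult_right X_mult_integrable) auto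
      show "(norm (Gr s \<omega> ** ?P))\<^sup>2 \<le> 2 * (L\<^sup>2 * (norm (X s \<omega> ** (mat 1 - J_matrix)))\<^sup>2) + 2 * ?e"
        unfolding Gr_def by (rule inter_divergence[OF gr_lipschitz inter])
    qed simp
    also have "\<dots> = (\<Sum>s<T. 2 * (L\<^sup>2 * expectation (\<lambda>\<omega>. (norm (X s \<omega> ** (mat 1 - J_matrix)))\<^sup>2)) + 2 * ?e)"
      using X_mult_integrable[of _ "mat 1 - J_matrix"] by (intro sum.cong refl) (simp add: prob_space)
    finally show ?thesis
      unfolding sum.distrib sum_distrib_left[symmetric] total_dev by (simp add: mult.left_commute)
  qed
  have "2 * \<eta>\<^sup>2 * (block_kernel (q * \<tau>) z * (\<Sum>s<T. expectation (\<lambda>\<omega>. (norm (Gr s \<omega> ** ?P))\<^sup>2)))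
      \<le> 2 * \<eta>\<^sup>2 * (block_kernel (q * \<tau>) z * (2 * (L\<^sup>2 * (intra_dev + inter_dev)) + real T * (2 * ?e)))"
    by (intro mult_left_mono grad kernel0) auto
  then show ?thesis using rec unfolding norm_V_J by (simp only: mult_ac)
qed

text \<open>The first condition makes the self-term within clusters at most half of
  \<open>intra_dev\<close>, which doubles the remaining terms. The second makes the self-term
  between clusters at most half of \<open>intra_dev + inter_dev\<close>; solving gives 2
  \<open>intra_dev\<close> plus twice the remaining terms. The sources within clusters are thus
  doubled twice.\<close>

lemma dev_le:
  assumes eta_intra: "4 * (\<eta>\<^sup>2 * (real \<tau>)\<^sup>2 * L\<^sup>2) \<le> 1"
    and eta_inter: "8 * (\<eta>\<^sup>2 * block_kernel (q * \<tau>) z * L\<^sup>2) \<le> 1"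
  shows "intra_dev + inter_dev \<le>
    4 * \<eta>\<^sup>2 * (real T * real (q * \<tau>) * \<sigma>\<^sup>2 * (real CARD('m) - 1) / (1 - z\<^sup>2))
    + 8 * \<eta>\<^sup>2 * (real T * real \<tau> * \<sigma>\<^sup>2 * (real CARD('n) - real CARD('m)))
    + 8 * \<eta>\<^sup>2 * (real \<tau>)\<^sup>2 * real T * (\<Sum>i\<in>UNIV. real (card (S i)) * (\<epsilon>c i)\<^sup>2)
    + 8 * \<eta>\<^sup>2 * block_kernel (q * \<tau>) z * real T * real CARD('n) * \<epsilon>\<^sup>2"
proof -
  have nonneg: "0 \<le> intra_dev" "0 \<le> inter_dev"
    unfolding intra_dev_def inter_dev_def by (auto intro!: sum_nonneg)
  have "4 * (\<eta>\<^sup>2 * (real \<tau>)\<^sup>2 * L\<^sup>2) * intra_dev \<le> 1 * intra_dev"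
    by (intro mult_right_mono eta_intra nonneg)
  moreover have "8 * (\<eta>\<^sup>2 * block_kernel (q * \<tau>) z * L\<^sup>2) * (intra_dev + inter_dev) \<le> 1 * (intra_dev + inter_dev)"
    using nonneg by (intro mult_right_mono eta_inter) auto
  moreover define a where "a = real T * real (q * \<tau>) * \<sigma>\<^sup>2 * (real CARD('m) - 1) / (1 - z\<^sup>2)"
  ultimately show ?thesis
    using intra_dev_le inter_dev_le[folded a_def] unfolding a_def[symmetric] by (simp add: algebra_simps)
qed

end

section \<open>Assembly of the convergence bound\<close>

lemma GDERIV_scaled_sum:
  assumes "\<And>k. GDERIV (F k) x :> G k"
  shows "GDERIV (\<lambda>x. c * (\<Sum>k\<in>A. F k x)) x :> c *\<^sub>R (\<Sum>k\<in>A. G k)"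
proof -
  have "((\<lambda>x. c * (\<Sum>k\<in>A. F k x)) has_derivative (\<lambda>h. c * (\<Sum>k\<in>A. h \<bullet> G k))) (at x)"
    using assms unfolding gderiv_def by (intro has_derivative_mult_right has_derivative_sum) auto
  then show ?thesis by (simp add: gderiv_def inner_sum_right)
qed

text \<open>With z = \<zeta>^\<pi> the bracket is \<open>\<Omega>\<^sub>2\<close>. It dominates
  termwise: the last summand is the same, 2 / (1 - z) exceeds 1 / (2 (1 - z)), and the first summand
  is nonnegative.\<close>

lemma block_kernel_le:
  assumes "0 \<le> z" "z < 1"
  shows "block_kernel R z \<le> (real R)\<^sup>2 * (1 / (1 - z\<^sup>2) + 2 / (1 - z) + z / (1 - z)\<^sup>2)"
proof -
  have "z\<^sup>2 \<le> 1" using assms by (simp add: power_le_one)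
  have "1 / (2 * (1 - z)) \<le> 2 / (1 - z)" using assms by (simp add: field_simps)
  moreover have "0 \<le> 1 / (1 - z\<^sup>2)" using \<open>z\<^sup>2 \<le> 1\<close> by simp
  ultimately have "1 / (2 * (1 - z)) + z / (1 - z)\<^sup>2 \<le> 1 / (1 - z\<^sup>2) + 2 / (1 - z) + z / (1 - z)\<^sup>2"
    by linarith
  then have "(real R)\<^sup>2 * (1 / (2 * (1 - z)) + z / (1 - z)\<^sup>2) \<le> (real R)\<^sup>2 * (1 / (1 - z\<^sup>2) + 2 / (1 - z) + z / (1 - z)\<^sup>2)"
    by (intro mult_left_mono) auto
  then show ?thesis by (simp add: block_kernel_def distrib_left)
qed

text \<open>The integrability conjunct gives the bound its meaning: the integral of a function that
  is not integrable has the default value 0, so a bound on the integrals alone could hold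
  vacuously.\<close>

theorem theorem1:
  fixes S :: "'m::finite \<Rightarrow> 'n::finite set"
    and E :: "('m \<times> 'm) set"
    and H :: "real^'m^'m"
    and eig :: "nat \<Rightarrow> real"
    and F :: "'n \<Rightarrow> real^'d::finite \<Rightarrow> real"
    and D :: "'n \<Rightarrow> 'b measure"
    and g :: "'n \<Rightarrow> 'b \<Rightarrow> real^'d \<Rightarrow> real^'d"
    and M :: "'w measure"
    and \<theta> :: "nat \<Rightarrow> 'n \<Rightarrow> 'w \<Rightarrow> 'b"
    and u :: "nat \<Rightarrow> 'w \<Rightarrow> real^'d"
    and x1 :: "real^'d"
    and \<tau> q p \<pi> T :: nat
    and \<eta> L \<sigma> F\<^sub>i\<^sub>n\<^sub>f \<epsilon> \<zeta> \<Omega>\<^sub>1 \<Omega>\<^sub>2 :: real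
    and \<epsilon>c :: "'m \<Rightarrow> real"
  assumes clusters: "is_clustering S"
    and periods: "\<tau> \<ge> 1" "q \<ge> 1" "p \<ge> 1" "\<pi> \<ge> 1" "T = p * q * \<tau>"
    and eta_pos: "\<eta> > 0"
    and differentiable: "\<And>k x. F k differentiable (at x)"
    and Z_ones: "Z_matrix S H \<pi> *v 1 = 1"
    \<comment> \<open>mini-batch sampling and the iterates\<close>
    and prob: "prob_space M"
    and indep: "prob_space.indep_vars M (\<lambda>(t, k). D k) (\<lambda>(t, k). \<theta> t k) ({..<T} \<times> UNIV)"
    and distr: "\<And>t k. t < T \<Longrightarrow> distr M (D k) (\<theta> t k) = D k"
    and g_measurable: "\<And>k. (\<lambda>(b, x). g k b x) \<in> borel_measurable (D k \<Otimes>\<^sub>M borel)"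
    and u_def: "\<And>t \<omega>. u t \<omega> =
      average_model (ce_fedavg S H \<pi> q \<tau> \<eta> g x1 (\<lambda>s k. \<theta> s k \<omega>) t)"
    \<comment> \<open>(1) smoothness\<close>
    and L_pos: "L > 0"
    and smooth: "\<And>k x x'. norm (gradient (F k) x - gradient (F k) x') \<le> L * norm (x - x')"
    \<comment> \<open>(2) unbiased stochastic gradients of bounded variance\<close>
    and g_integrable: "\<And>k x. integrable (D k) (\<lambda>b. g k b x)"
    and g_unbiased: "\<And>k x. (LINT b|D k. g k b x) = gradient (F k) x"
    and g_sq_integrable: "\<And>k x. integrable (D k) (\<lambda>b. (norm (g k b x - gradient (F k) x))\<^sup>2)"
    and g_variance: "\<And>k x. (LINT b|D k. (norm (g k b x - gradient (F k) x))\<^sup>2) \<le> \<sigma>\<^sup>2"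
    \<comment> \<open>(3) lower boundedness\<close>
    and F_inf: "\<And>x. global_objective F x \<ge> F\<^sub>i\<^sub>n\<^sub>f"
    \<comment> \<open>(4) mixing matrix\<close>
    and graph: "connected_graph E"
    and H_sym: "transpose H = H"
    and H_stochastic: "doubly_stochastic H"
    and H_edge: "\<And>i j. i \<noteq> j \<Longrightarrow> (i, j) \<in> E \<Longrightarrow> H $ i $ j > 0"
    and H_nonedge: "\<And>i j. i \<noteq> j \<Longrightarrow> (i, j) \<notin> E \<Longrightarrow> H $ i $ j = 0"
    and eigenvalues: "ordered_eigenvalues H eig" "eig 1 = 1"
    and zeta_def: "\<zeta> = (if CARD('m) = 1 then 0 else max \<bar>eig 2\<bar> \<bar>eig CARD('m)\<bar>)"
    and zeta_less: "\<zeta> < 1"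
    \<comment> \<open>(5) intra-cluster divergence\<close>
    and epsc_nonneg: "\<And>i. \<epsilon>c i \<ge> 0"
    and intra: "\<And>i x. (1 / real (card (S i))) *
      (\<Sum>k\<in>S i. (norm (gradient (cluster_objective S F i) x - gradient (F k) x))\<^sup>2) \<le> (\<epsilon>c i)\<^sup>2"
    \<comment> \<open>(6) inter-cluster divergence\<close>
    and eps_nonneg: "\<epsilon> \<ge> 0"
    and inter: "\<And>x. (\<Sum>i\<in>UNIV. real (card (S i)) / real CARD('n) *
      (norm (gradient (cluster_objective S F i) x - gradient (global_objective F) x))\<^sup>2) \<le> \<epsilon>\<^sup>2"
    and Omega1_def: "\<Omega>\<^sub>1 = \<zeta> ^ (2 * \<pi>) / (1 - \<zeta> ^ (2 * \<pi>))"
    and Omega2_def: "\<Omega>\<^sub>2 = 1 / (1 - \<zeta> ^ (2 * \<pi>)) + 2 / (1 - \<zeta> ^ \<pi>) + \<zeta> ^ \<pi> / (1 - \<zeta> ^ \<pi>)\<^sup>2"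
    and eta_le: "\<eta> \<le> min (1 / (2 * L * real \<tau>)) (1 / (2 * sqrt (2 * \<Omega>\<^sub>2) * L * real q * real \<tau>))"
  shows "(\<forall>t<T. integrable M (\<lambda>\<omega>. (norm (gradient (global_objective F) (u t \<omega>)))\<^sup>2)) \<and>
    (1 / real T) * (\<Sum>t<T. prob_space.expectation M
        (\<lambda>\<omega>. (norm (gradient (global_objective F) (u t \<omega>)))\<^sup>2))
      \<le> 2 * (global_objective F x1 - F\<^sub>i\<^sub>n\<^sub>f) / (\<eta> * real T)
        + \<eta> * L * \<sigma>\<^sup>2 / real CARD('n)
        + 8 * \<eta>\<^sup>2 * L\<^sup>2 * (\<Omega>\<^sub>1 * real q * real \<tau>
            + (real CARD('m) - 1) / real CARD('n) * real q * real \<tau>) * \<sigma>\<^sup>2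
        + 16 * \<eta>\<^sup>2 * L\<^sup>2 * (real q)\<^sup>2 * (real \<tau>)\<^sup>2 * \<Omega>\<^sub>2 * \<epsilon>\<^sup>2
        + 8 * ((real CARD('n) - real CARD('m)) / real CARD('n)) * \<eta>\<^sup>2 * L\<^sup>2 * real \<tau> * \<sigma>\<^sup>2
        + 16 * L\<^sup>2 * \<eta>\<^sup>2 * (real \<tau>)\<^sup>2 *
            (\<Sum>i\<in>UNIV. real (card (S i)) / real CARD('n) * (\<epsilon>c i)\<^sup>2)"
proof -
  interpret prob_space M by (rule prob)
  define gr where "gr k = gradient (F k)" for k
  define z where "z = \<zeta> ^ \<pi>"
  have zeta0: "0 \<le> \<zeta>" by (auto simp: zeta_def)
  have z: "0 \<le> z" "z < 1"
    using zeta0 zeta_less periods(4) by (auto simp: z_def power_less_one_iff)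
  have z2: "0 \<le> z\<^sup>2" "z\<^sup>2 < 1" using z by (auto simp: abs_square_less_1)
  have T: "0 < T" using periods by simp
  note mixing = mixing_contraction[OF graph H_sym H_stochastic H_edge eigenvalues zeta_def]
  have H_one: "H *v 1 = 1"
    using H_stochastic by (simp add: doubly_stochastic_def matrix_vector_mult_def vec_eq_iff)
  have contraction: "norm (matrix_power H \<pi> *v v) \<le> z * norm v" if "(\<Sum>i\<in>UNIV. v $ i) = 0" for v
    unfolding z_def using mixing zeta0 that by (intro matrix_power_contraction) auto
  have deriv_F: "GDERIV (F k) x :> gr k x" for k x
    unfolding gr_def by (rule GDERIV_gradient[OF differentiable])
  interpret clustering S by unfold_locales (rule clusters)
  have grad_cluster: "gradient (cluster_objective S F i) x = cluster_gradient gr i x" for i x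
    unfolding cluster_objective_def[abs_def] cluster_gradient_def
    by (rule gradient_eqI[OF GDERIV_scaled_sum[OF deriv_F]])
  have deriv_global: "GDERIV (global_objective F) x :> (1 / real CARD('n)) *\<^sub>R (\<Sum>k\<in>UNIV. gr k x)" for x
    unfolding global_objective_def[abs_def] by (rule GDERIV_scaled_sum[OF deriv_F])
  note grad_global = gradient_eqI[OF deriv_global]
  have smooth': "norm (gr k x - gr k y) \<le> L * norm (x - y)" for k x y
    unfolding gr_def by (rule smooth)
  have unbiased': "(LINT b|D k. g k b x) = gr k x" for k x
    unfolding gr_def by (rule g_unbiased)
  have sq_integrable': "integrable (D k) (\<lambda>b. (norm (g k b x - gr k x))\<^sup>2)" for k x
    unfolding gr_def by (rule g_sq_integrable)
  have variance': "(LINT b|D k. (norm (g k b x - gr k x))\<^sup>2) \<le> \<sigma>\<^sup>2" for k x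
    unfolding gr_def by (rule g_variance)
  have intra': "(1 / real (card (S i))) * (\<Sum>k\<in>S i. (norm (cluster_gradient gr i x - gr k x))\<^sup>2) \<le> (\<epsilon>c i)\<^sup>2" for i x
    using intra[of i x] unfolding grad_cluster gr_def[symmetric] .
  have inter': "(\<Sum>i\<in>UNIV. real (card (S i)) / real CARD('n) *
      (norm (cluster_gradient gr i x - (1 / real CARD('n)) *\<^sub>R (\<Sum>k\<in>UNIV. gr k x)))\<^sup>2) \<le> \<epsilon>\<^sup>2" for x
    using inter[of x] unfolding grad_cluster grad_global .
  have pos: "0 < \<tau>" "0 < q" "0 \<le> L" using periods L_pos by auto
  interpret ce_fedavg_convergence M S H \<pi> q \<tau> T \<eta> L \<sigma> D g x1 \<theta> gr z \<epsilon>c \<epsilon>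
    by unfold_locales (fact indep distr g_measurable smooth' g_integrable unbiased' sq_integrable' variance'
      H_sym H_one contraction z Z_ones pos intra' inter')+
  have grad_u: "gradient (global_objective F) (u t \<omega>) = gF (U t \<omega>)" for t \<omega>
    by (simp add: grad_global gF_def U_def X_def u_def)
  let ?n = "real CARD('n)" and ?m = "real CARD('m)" and ?Q = "real q * real \<tau>"
  let ?e = "\<Sum>i\<in>UNIV. real (card (S i)) * (\<epsilon>c i)\<^sup>2"
  \<comment> \<open>That there are at most as many clusters as devices is read off from n - m being
    a squared norm.\<close>
  have nm: "1 \<le> ?m" "?m \<le> ?n" "0 < ?n"
    using norm_mat_1_V zero_le_power2[of "norm (mat 1 - V_matrix S)"] by (auto simp: Suc_le_eq)

  have eta_tau: "\<eta> * L * real \<tau> \<le> 1 / 2"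
    using eta_le L_pos periods by (simp add: field_simps)
  have "\<eta> * L * 1 \<le> \<eta> * L * real \<tau>"
    using eta_pos L_pos periods by (intro mult_left_mono) auto
  with eta_tau have eta_L: "\<eta> * L \<le> 1" by simp
  have eta_intra: "4 * (\<eta>\<^sup>2 * (real \<tau>)\<^sup>2 * L\<^sup>2) \<le> 1"
    using power_mono[OF eta_tau, of 2] eta_pos L_pos by (simp add: power_mult_distrib field_simps)
  have Omega2: "\<Omega>\<^sub>2 = 1 / (1 - z\<^sup>2) + 2 / (1 - z) + z / (1 - z)\<^sup>2"
    by (simp add: Omega2_def z_def power_mult[symmetric] mult.commute)
  have Omega2_pos: "0 < \<Omega>\<^sub>2"
    unfolding Omega2 using z z2 by (intro add_pos_nonneg add_pos_pos) auto
  have kernel: "block_kernel (q * \<tau>) z \<le> ?Q\<^sup>2 * \<Omega>\<^sub>2"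
    using block_kernel_le[OF z, of "q * \<tau>"] by (simp add: Omega2)
  \<comment> \<open>The second bound on the learning rate; its square is the absorption condition
    with constant 8, since the square of 2 sqrt(2 x) is 8 x.\<close>
  have "\<eta> * (2 * sqrt (2 * \<Omega>\<^sub>2) * L * ?Q) \<le> 1"
    using eta_le L_pos periods Omega2_pos by (simp add: field_simps)
  then have "(\<eta> * (2 * sqrt (2 * \<Omega>\<^sub>2) * L * ?Q))\<^sup>2 \<le> 1\<^sup>2"
    using eta_pos L_pos Omega2_pos by (intro power_mono) auto
  then have eta_Omega2: "8 * (\<eta>\<^sup>2 * (?Q\<^sup>2 * \<Omega>\<^sub>2) * L\<^sup>2) \<le> 1"
    using Omega2_pos by (simp add: power_mult_distrib mult_ac)
  have "8 * (\<eta>\<^sup>2 * block_kernel (q * \<tau>) z * L\<^sup>2) \<le> 8 * (\<eta>\<^sup>2 * (?Q\<^sup>2 * \<Omega>\<^sub>2) * L\<^sup>2)"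
    using kernel by (intro mult_left_mono mult_right_mono) auto
  with eta_Omega2 have eta_inter: "8 * (\<eta>\<^sup>2 * block_kernel (q * \<tau>) z * L\<^sup>2) \<le> 1" by linarith

  \<comment> \<open>The factor with which the summed deviation enters the bound on the time average
    of the squared gradients.\<close>
  let ?c = "L\<^sup>2 / ?n / real T"
  have inter_noise: "?c * (4 * \<eta>\<^sup>2 * (real T * real (q * \<tau>) * \<sigma>\<^sup>2 * (?m - 1) / (1 - z\<^sup>2)))
     \<le> 8 * \<eta>\<^sup>2 * L\<^sup>2 * (\<Omega>\<^sub>1 * real q * real \<tau> + (?m - 1) / ?n * real q * real \<tau>) * \<sigma>\<^sup>2"
  proof -
    define r where "r = (?m - 1) / ?n"
    have r: "0 \<le> r" "r \<le> 1" using nm by (auto simp: r_def)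
    have Om1: "\<Omega>\<^sub>1 = z\<^sup>2 / (1 - z\<^sup>2)"
      by (simp add: Omega1_def z_def power_mult[symmetric] mult.commute)
    have Om1_pos: "0 \<le> \<Omega>\<^sub>1" unfolding Om1 using z2 by (intro divide_nonneg_nonneg) auto
    have inv: "1 / (1 - z\<^sup>2) = 1 + \<Omega>\<^sub>1" unfolding Om1 using z2 by (simp add: field_simps)
    have "?c * (4 * \<eta>\<^sup>2 * (real T * real (q * \<tau>) * \<sigma>\<^sup>2 * (?m - 1) / (1 - z\<^sup>2)))
      = 4 * \<eta>\<^sup>2 * L\<^sup>2 * ?Q * \<sigma>\<^sup>2 * (r * (1 / (1 - z\<^sup>2)))"
      using T nm by (simp add: r_def)
    \<comment> \<open>From 1 / (1 - z^2) = 1 + \<open>\<Omega>\<^sub>1\<close> and r <= 1 one gets r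
      (1 + \<open>\<Omega>\<^sub>1\<close>) <= \<open>\<Omega>\<^sub>1\<close> + r, which separates
      the two noise terms. The extra factor 2 passes from the constant 4 of \<open>dev_le\<close> to
      the 8 of the claim.\<close>
    also have "r * (1 / (1 - z\<^sup>2)) \<le> 2 * (\<Omega>\<^sub>1 + r)"
      unfolding inv using r Om1_pos mult_right_mono[OF r(2) Om1_pos] by (simp add: distrib_left)
    finally have "?c * (4 * \<eta>\<^sup>2 * (real T * real (q * \<tau>) * \<sigma>\<^sup>2 * (?m - 1) / (1 - z\<^sup>2)))
      \<le> 4 * \<eta>\<^sup>2 * L\<^sup>2 * ?Q * \<sigma>\<^sup>2 * (2 * (\<Omega>\<^sub>1 + r))"
      using L_pos by (simp add: mult_left_mono)
    then show ?thesis unfolding r_def[symmetric] by (simp add: algebra_simps)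
  qed
  have intra_noise: "?c * (8 * \<eta>\<^sup>2 * (real T * real \<tau> * \<sigma>\<^sup>2 * (?n - ?m)))
     = 8 * ((?n - ?m) / ?n) * \<eta>\<^sup>2 * L\<^sup>2 * real \<tau> * \<sigma>\<^sup>2"
    using T by simp
  have intra_div: "?c * (8 * \<eta>\<^sup>2 * (real \<tau>)\<^sup>2 * real T * ?e)
     \<le> 16 * L\<^sup>2 * \<eta>\<^sup>2 * (real \<tau>)\<^sup>2 * (\<Sum>i\<in>UNIV. real (card (S i)) / ?n * (\<epsilon>c i)\<^sup>2)"
  proof -
    have "?e / ?n = (\<Sum>i\<in>UNIV. real (card (S i)) / ?n * (\<epsilon>c i)\<^sup>2)"
      by (simp add: sum_divide_distrib)
    moreover have "?c * (8 * \<eta>\<^sup>2 * (real \<tau>)\<^sup>2 * real T * ?e) = 8 * L\<^sup>2 * \<eta>\<^sup>2 * (real \<tau>)\<^sup>2 * (?e / ?n)"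
      using T by simp
    moreover have "8 * L\<^sup>2 * \<eta>\<^sup>2 * (real \<tau>)\<^sup>2 * (?e / ?n) \<le> 16 * L\<^sup>2 * \<eta>\<^sup>2 * (real \<tau>)\<^sup>2 * (?e / ?n)"
      by (intro mult_right_mono divide_nonneg_nonneg sum_nonneg) auto
    ultimately show ?thesis by simp
  qed
  have inter_div: "?c * (8 * \<eta>\<^sup>2 * block_kernel (q * \<tau>) z * real T * ?n * \<epsilon>\<^sup>2)
     \<le> 16 * \<eta>\<^sup>2 * L\<^sup>2 * (real q)\<^sup>2 * (real \<tau>)\<^sup>2 * \<Omega>\<^sub>2 * \<epsilon>\<^sup>2"
  proof -
    have "?c * (8 * \<eta>\<^sup>2 * block_kernel (q * \<tau>) z * real T * ?n * \<epsilon>\<^sup>2) = 8 * \<eta>\<^sup>2 * L\<^sup>2 * \<epsilon>\<^sup>2 * block_kernel (q * \<tau>) z"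
      using T by simp
    also have "\<dots> \<le> 8 * \<eta>\<^sup>2 * L\<^sup>2 * \<epsilon>\<^sup>2 * (?Q\<^sup>2 * \<Omega>\<^sub>2)"
      using kernel by (intro mult_left_mono) auto
    also have "\<dots> \<le> 16 * \<eta>\<^sup>2 * L\<^sup>2 * \<epsilon>\<^sup>2 * (?Q\<^sup>2 * \<Omega>\<^sub>2)"
      using Omega2_pos by (intro mult_right_mono) auto
    finally show ?thesis by (simp add: power_mult_distrib mult_ac)
  qed

  have "(\<Sum>t<T. expectation (\<lambda>\<omega>. (norm (gradient (global_objective F) (u t \<omega>)))\<^sup>2)) \<le>
    2 * (global_objective F x1 - F\<^sub>i\<^sub>n\<^sub>f) / \<eta> + real T * (\<eta> * L * \<sigma>\<^sup>2 / ?n)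
    + L\<^sup>2 / ?n * (intra_dev + inter_dev)"
    unfolding grad_u total_dev[symmetric]
    by (rule expectation_gradient_sum)
      (use deriv_global F_inf eta_pos eta_L L_pos W_one in \<open>auto simp: gF_def\<close>)
  then have "(1 / real T) * (\<Sum>t<T. expectation (\<lambda>\<omega>. (norm (gradient (global_objective F) (u t \<omega>)))\<^sup>2)) \<le>
    (1 / real T) * (2 * (global_objective F x1 - F\<^sub>i\<^sub>n\<^sub>f) / \<eta> + real T * (\<eta> * L * \<sigma>\<^sup>2 / ?n)
    + L\<^sup>2 / ?n * (intra_dev + inter_dev))"
    by (rule mult_left_mono) simp
  also have "\<dots> = 2 * (global_objective F x1 - F\<^sub>i\<^sub>n\<^sub>f) / (\<eta> * real T) + \<eta> * L * \<sigma>\<^sup>2 / ?n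
    + ?c * (intra_dev + inter_dev)"
    using T by (simp add: distrib_left mult.commute)
  finally have main: "(1 / real T) * (\<Sum>t<T. expectation (\<lambda>\<omega>. (norm (gradient (global_objective F) (u t \<omega>)))\<^sup>2)) \<le>
    2 * (global_objective F x1 - F\<^sub>i\<^sub>n\<^sub>f) / (\<eta> * real T) + \<eta> * L * \<sigma>\<^sup>2 / ?n
    + ?c * (intra_dev + inter_dev)" .
  have "?c * (intra_dev + inter_dev) \<le> ?c * (
    4 * \<eta>\<^sup>2 * (real T * real (q * \<tau>) * \<sigma>\<^sup>2 * (?m - 1) / (1 - z\<^sup>2))
    + 8 * \<eta>\<^sup>2 * (real T * real \<tau> * \<sigma>\<^sup>2 * (?n - ?m))
    + 8 * \<eta>\<^sup>2 * (real \<tau>)\<^sup>2 * real T * ?e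
    + 8 * \<eta>\<^sup>2 * block_kernel (q * \<tau>) z * real T * ?n * \<epsilon>\<^sup>2)"
    by (intro mult_left_mono dev_le eta_intra eta_inter) auto
  then have "?c * (intra_dev + inter_dev) \<le>
    8 * \<eta>\<^sup>2 * L\<^sup>2 * (\<Omega>\<^sub>1 * real q * real \<tau> + (?m - 1) / ?n * real q * real \<tau>) * \<sigma>\<^sup>2
    + 8 * ((?n - ?m) / ?n) * \<eta>\<^sup>2 * L\<^sup>2 * real \<tau> * \<sigma>\<^sup>2
    + 16 * L\<^sup>2 * \<eta>\<^sup>2 * (real \<tau>)\<^sup>2 * (\<Sum>i\<in>UNIV. real (card (S i)) / ?n * (\<epsilon>c i)\<^sup>2)
    + 16 * \<eta>\<^sup>2 * L\<^sup>2 * (real q)\<^sup>2 * (real \<tau>)\<^sup>2 * \<Omega>\<^sub>2 * \<epsilon>\<^sup>2"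
    using inter_noise intra_noise intra_div inter_div unfolding distrib_left[of ?c] by linarith
  with main have "(1 / real T) * (\<Sum>t<T. expectation (\<lambda>\<omega>. (norm (gradient (global_objective F) (u t \<omega>)))\<^sup>2)) \<le>
    2 * (global_objective F x1 - F\<^sub>i\<^sub>n\<^sub>f) / (\<eta> * real T) + \<eta> * L * \<sigma>\<^sup>2 / ?n
    + 8 * \<eta>\<^sup>2 * L\<^sup>2 * (\<Omega>\<^sub>1 * real q * real \<tau> + (?m - 1) / ?n * real q * real \<tau>) * \<sigma>\<^sup>2
    + 16 * \<eta>\<^sup>2 * L\<^sup>2 * (real q)\<^sup>2 * (real \<tau>)\<^sup>2 * \<Omega>\<^sub>2 * \<epsilon>\<^sup>2
    + 8 * ((?n - ?m) / ?n) * \<eta>\<^sup>2 * L\<^sup>2 * real \<tau> * \<sigma>\<^sup>2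
    + 16 * L\<^sup>2 * \<eta>\<^sup>2 * (real \<tau>)\<^sup>2 * (\<Sum>i\<in>UNIV. real (card (S i)) / ?n * (\<epsilon>c i)\<^sup>2)"
    by linarith
  moreover have "\<forall>t<T. integrable M (\<lambda>\<omega>. (norm (gradient (global_objective F) (u t \<omega>)))\<^sup>2)"
    unfolding grad_u by (simp add: square_integrable_norm_sq[OF gF_U_square_integrable])
  ultimately show ?thesis by blast
qed

end
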